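(* Let $p>1$ and $1<\rho<\frac{2}{p-1}$, and let $\varepsilon>0$ be small enough (that is, there is $\varepsilon_*>0$ such that the following holds for all $0<\varepsilon\le\varepsilon_*$). Let $(u_0,u_1)\in \big(W^{1,1}\cap W^{1,\infty}(\mathbb R)\big)\times\big(L^1\cap L^\infty(\mathbb R)\big)$ satisfy $$0\le u_0(x)\le\varepsilon\langle x\rangle^{-\rho},\qquad 0\le u_1(x)+\tfrac12u_0(x)\le\varepsilon\langle x\rangle^{-\rho}$$ for almost every $x \in \mathbb R$. Then the solution $u$ to the Cauchy problem $$\partial_t^2u+\partial_tu-\Delta u+u^p=0\ \ (t>0,\ x\in\mathbb R),\qquad u(0,x)=u_0(x),\quad \partial_tu(0,x)=u_1(x)$$ satisfies, for every $q\in[1,\infty]$, $$\|u(t)\|_{L^q(\mathbb R)}\lesssim t^{\frac1{q\rho(p-1)}-\frac1{p-1}}\qquad(t>0),$$ where the implicit constant is independent of $t$ (and $1/q=0$ if $q=\infty$). In particular $u\in L^p(0,\infty;L^p(\mathbb R))$.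
   Context: The space dimension is one, so $\Delta=\partial_x^2$, and $\langle x\rangle=(1+|x|^2)^{1/2}$. For locally integrable $f$, $$S(t)f(x)=\frac{e^{-t/2}}2\int_{-t}^tI_0\Big(\frac{\sqrt{t^2-y^2}}2\Big)f(x-y)\,dy,$$ where $I_0$ is the modified Bessel function of the first kind of order $0$; $\partial_tS(t)f$ denotes its time derivative. The solution $u$ of the Cauchy problem means a mild solution, i.e. $u$ is non-negative and satisfies $$u(t,x)=S(t)(u_0+u_1)+\partial_tS(t)u_0-\int_0^tS(t-\tau)u^p(\tau)\,d\tau .$$ *)

theory Defs
  imports "HOL-Analysis.Analysis" "HOL-Probability.Essential_Supremum"
begin

text \<open>Elements of function spaces are represented by Lebesgue measurable functions; equalities and
  inequalities between them are stated almost everywhere.\<close>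

definition Lq_norm :: "'a measure \<Rightarrow> ennreal \<Rightarrow> ('a \<Rightarrow> real) \<Rightarrow> ennreal" where
  "Lq_norm M q f =
     (if q = \<infinity> then esssup M (\<lambda>x. ennreal \<bar>f x\<bar>)
      else let I = (\<integral>\<^sup>+ x. ennreal (\<bar>f x\<bar> powr enn2real q) \<partial>M)
           in if I = \<infinity> then \<infinity> else ennreal (enn2real I powr (1 / enn2real q)))"

definition Lq_space :: "'a measure \<Rightarrow> ennreal \<Rightarrow> ('a \<Rightarrow> real) set" where
  "Lq_space M q = {f \<in> borel_measurable M. Lq_norm M q f < \<infinity>}"

text \<open>\<open>L\<^sup>r(0,\<infinity>; L\<^sup>q(\<real>))\<close> for functions of \<open>(t,x)\<close>. For finite \<open>q\<close> the space \<open>L\<^sup>q(\<real>)\<close> is separable and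
  strong measurability in time is expressed by joint measurability; the definition is
  meant for finite \<open>q\<close> only.\<close>
definition Lr_time_Lq_space :: "ennreal \<Rightarrow> ennreal \<Rightarrow> (real \<Rightarrow> real \<Rightarrow> real) set" where
  "Lr_time_Lq_space r q =
     {u. (\<lambda>(t, x). u t x) \<in> borel_measurable (lebesgue_on ({0<..} \<times> UNIV)) \<and>
         (AE t in lebesgue_on {0<..}. u t \<in> Lq_space lebesgue q) \<and>
         (\<lambda>t. enn2real (Lq_norm lebesgue q (u t))) \<in> Lq_space (lebesgue_on {0<..}) r}"

definition locally_integrable :: "(real \<Rightarrow> real) \<Rightarrow> bool" where
  "locally_integrable f \<longleftrightarrow> (\<forall>K. compact K \<longrightarrow> f absolutely_integrable_on K)"

definition test_function :: "(real \<Rightarrow> real) \<Rightarrow> bool" where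
  "test_function \<phi> \<longleftrightarrow>
     (\<forall>k x. (deriv ^^ k) \<phi> differentiable (at x)) \<and> compact (closure {x. \<phi> x \<noteq> 0})"

definition weak_derivative :: "(real \<Rightarrow> real) \<Rightarrow> (real \<Rightarrow> real) \<Rightarrow> bool" where
  "weak_derivative f g \<longleftrightarrow> locally_integrable f \<and> locally_integrable g \<and>
     (\<forall>\<phi>. test_function \<phi> \<longrightarrow>
        (LINT x|lebesgue. f x * deriv \<phi> x) = - (LINT x|lebesgue. g x * \<phi> x))"

definition W1q_space :: "ennreal \<Rightarrow> (real \<Rightarrow> real) set" where
  "W1q_space q = {f \<in> Lq_space lebesgue q. \<exists>g \<in> Lq_space lebesgue q. weak_derivative f g}"

definition bessel_I0 :: "real \<Rightarrow> real" where
  "bessel_I0 z = (\<Sum>k. (z / 2) ^ (2 * k) / (fact k)\<^sup>2)"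

definition japanese_bracket :: "real \<Rightarrow> real" where
  "japanese_bracket x = (1 + \<bar>x\<bar>\<^sup>2) powr (1 / 2)"

definition S :: "real \<Rightarrow> (real \<Rightarrow> real) \<Rightarrow> real \<Rightarrow> real" where
  "S t f x = exp (- t / 2) / 2 *
     (LINT y:{-t..t}|lebesgue. bessel_I0 (sqrt (t\<^sup>2 - y\<^sup>2) / 2) * f (x - y))"

text \<open>One-sided at \<open>t = 0\<close>, where \<open>dt_S 0 f = f\<close> for continuous \<open>f\<close>. As \<open>S t f\<close> depends only on the
  almost everywhere class of \<open>f\<close>, so does \<open>dt_S\<close>; for \<open>f\<close> in \<open>W\<^sup>1\<^sup>,\<^sup>\<infinity>\<close> (which has a Lipschitz
  representative) the derivative exists at every \<open>x\<close> and \<open>t \<ge> 0\<close>.\<close>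
definition dt_S :: "real \<Rightarrow> (real \<Rightarrow> real) \<Rightarrow> real \<Rightarrow> real" where
  "dt_S t f x = vector_derivative (\<lambda>s. S s f x) (at t within {0..})"

text \<open>The measurability and integrability clauses say that the Duhamel integral is a genuine
  integral rather than the default value 0. At \<open>t = 0\<close> the integral equation reads
  \<open>u 0 x = u0 x\<close>.\<close>
definition mild_solution ::
  "real \<Rightarrow> (real \<Rightarrow> real) \<Rightarrow> (real \<Rightarrow> real) \<Rightarrow> (real \<Rightarrow> real \<Rightarrow> real) \<Rightarrow> bool" where
  "mild_solution p u0 u1 u \<longleftrightarrow>
     (\<lambda>(t, x). u t x) \<in> borel_measurable (lebesgue_on ({0..} \<times> UNIV)) \<and>
     (\<forall>t\<ge>0. u t \<in> borel_measurable lebesgue) \<and>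
     (\<forall>t\<ge>0. AE x in lebesgue. 0 \<le> u t x) \<and>
     (\<forall>t\<ge>0. locally_integrable (\<lambda>x. u t x powr p)) \<and>
     (\<forall>t\<ge>0. AE x in lebesgue.
        set_integrable lebesgue {0..t} (\<lambda>\<tau>. S (t - \<tau>) (\<lambda>y. u \<tau> y powr p) x) \<and>
        u t x = S t (\<lambda>y. u0 y + u1 y) x + dt_S t u0 x
                - (LINT \<tau>:{0..t}|lebesgue. S (t - \<tau>) (\<lambda>y. u \<tau> y powr p) x))"

end

theory Submission
  imports Defs
begin

text \<open>
  Write \<open>K(t,x) = exp (-t/2)/2 * I\<^sub>0(sqrt (t\<^sup>2 - x\<^sup>2)/2)\<close> on the light cone \<open>\<bar>x\<bar> \<le> t\<close> and
  \<open>E(t,x) = exp (-t/2)/2\<close> there; both vanish outside. Then \<open>K\<close> is the fundamental solution of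
  \<open>\<partial>\<^sub>t\<^sup>2 + \<partial>\<^sub>t - \<partial>\<^sub>x\<^sup>2\<close>, and \<open>E\<close> is the one of \<open>(\<partial>\<^sub>t + 1/2)\<^sup>2 - \<partial>\<^sub>x\<^sup>2\<close>, which is the same operator plus
  \<open>1/4\<close>. Hence \<open>K = E + 1/4 E * K\<close> for the convolution over space-time
  (\<open>resolvent_identity\<close>), and the mild formulation \<open>u = g + 1/4 K * g - K * u\<^sup>p\<close> is the same as
  \<open>u = g + E * (u/4 - u\<^sup>p)\<close>, where \<open>g\<close> is the d'Alembert solution belonging to the data
  (\<open>wave_form_of_damped_form\<close>, \<open>damped_form_of_wave_form\<close>). The second form is
  monotone in \<open>u\<close>: \<open>E\<close> is non-negative and \<open>a/4 - a\<^sup>p\<close> is non-negative and increasing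
  for \<open>0 \<le> a \<le> (4 p) powr (-1/(p-1))\<close>. So solutions with values in this interval obey a comparison
  principle. The data enter \<open>g\<close> only through \<open>u\<^sub>0\<close> and \<open>u\<^sub>1 + u\<^sub>0/2\<close>, which explains the
  hypotheses on these two functions. The smallness comes for free: a mild solution is
  non-negative, so the absorption can only lower it below the linear flow, and the linear flow is
  at most \<open>2 \<epsilon>\<close> (\<open>mild_solution_le_two_eps\<close>).

  The decay is that of the barrier \<open>w = (\<kappa> ((1 + x\<^sup>2) powr m + t) + 4 p) powr (-1/(p-1))\<close> with
  \<open>m = \<rho> (p-1)/2\<close>, which looks like the solution of \<open>w' = - w\<^sup>p\<close> started at each point \<open>x\<close> from a
  multiple of \<open>\<langle>x\<rangle> powr -\<rho>\<close>. The hypothesis \<open>\<rho> < 2/(p-1)\<close> says \<open>m < 1\<close>: the transition between the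
  regimes \<open>\<langle>x\<rangle> powr -\<rho>\<close> and \<open>t powr (-1/(p-1))\<close> happens at \<open>\<bar>x\<bar> \<approx> t powr (1/(2m))\<close>, far beyond the
  diffusive scale \<open>sqrt t\<close>. Therefore \<open>\<partial>\<^sub>x\<^sup>2 w\<close> is dominated by \<open>w\<^sup>p\<close>, and for small \<open>\<kappa>\<close> the function \<open>w\<close>
  is a supersolution (\<open>barrier_supersolution\<close>). Integrating twice along characteristics turns
  this into the integral inequality \<open>g + E * (w/4 - w\<^sup>p) \<le> w\<close> (\<open>barrier_dominates\<close>), and a Gronwall
  argument for \<open>(u - w)\<^sup>+\<close> gives \<open>u \<le> w\<close> (\<open>comparison\<close>, \<open>mild_solution_le_barrier\<close>). The
  substitution \<open>x = t powr (1/(2m)) y\<close> yields the norms of \<open>w\<close>; the remaining integral in \<open>y\<close> is finite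
  because \<open>\<rho> > 1\<close>.

  A solution is obtained by monotone iteration of \<open>u \<mapsto> g + E * (u/4 - u\<^sup>p)\<close> from \<open>0\<close>, with the
  constant \<open>2 \<epsilon>\<close> as upper bound (\<open>wave_form_solution_exists\<close>).

  Convolutions are integrals of non-negative extended real functions on the plane that vanish for
  \<open>t < 0\<close>, so that Tonelli's theorem applies throughout. Equations are multiplied by 4 to avoid
  fractions of extended reals.
\<close>

section \<open>Space-time convolution\<close>

definition conv :: "('a::euclidean_space \<Rightarrow> ennreal) \<Rightarrow> ('a \<Rightarrow> ennreal) \<Rightarrow> 'a \<Rightarrow> ennreal" where
  "conv G F p = (\<integral>\<^sup>+q. G (p - q) * F q \<partial>lborel)"

lemma conv_measurable [measurable]:
  assumes [measurable]: "G \<in> borel_measurable borel" "F \<in> borel_measurable borel"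
  shows "conv G F \<in> borel_measurable borel"
proof -
  have "(\<lambda>p. \<integral>\<^sup>+q. G (p - q) * F q \<partial>lborel) \<in> borel_measurable borel"
    by measurable
  then show ?thesis
    by (simp add: conv_def[abs_def])
qed

lemma nn_integral_lborel_translation:
  fixes f :: "'a::euclidean_space \<Rightarrow> ennreal"
  assumes [measurable]: "f \<in> borel_measurable borel"
  shows "(\<integral>\<^sup>+q. f (q + c) \<partial>lborel) = (\<integral>\<^sup>+q. f q \<partial>lborel)"
  by (subst (2) lborel_affine[of 1 c])
     (simp_all add: nn_integral_density nn_integral_distr add.commute)

lemma nn_integral_lborel_reflection:
  fixes f :: "'a::euclidean_space \<Rightarrow> ennreal"
  assumes [measurable]: "f \<in> borel_measurable borel"
  shows "(\<integral>\<^sup>+q. f (c - q) \<partial>lborel) = (\<integral>\<^sup>+q. f q \<partial>lborel)"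
  by (subst (2) lborel_affine[of "-1" c])
     (simp_all add: nn_integral_density nn_integral_distr)

lemma conv_commute:
  fixes F G :: "'a::euclidean_space \<Rightarrow> ennreal"
  assumes [measurable]: "G \<in> borel_measurable borel" "F \<in> borel_measurable borel"
  shows "conv G F = conv F G"
proof
  fix p
  have "conv G F p = (\<integral>\<^sup>+q. G (p - (p - q)) * F (p - q) \<partial>lborel)"
    unfolding conv_def
    by (subst nn_integral_lborel_reflection[of "\<lambda>q. G (p - q) * F q" p]) simp_all
  then show "conv G F p = conv F G p"
    by (simp add: conv_def mult.commute)
qed

text \<open>Tonelli, followed by the translation \<open>q \<mapsto> q + r\<close> of the inner variable.\<close>
lemma conv_assoc:
  fixes F G H :: "'a::euclidean_space \<Rightarrow> ennreal"
  assumes [measurable]: "G \<in> borel_measurable borel" "H \<in> borel_measurable borel"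
    "F \<in> borel_measurable borel"
  shows "conv G (conv H F) = conv (conv G H) F"
proof
  fix p
  have "conv G (conv H F) p
      = (\<integral>\<^sup>+q. \<integral>\<^sup>+r. G (p - q) * (H (q - r) * F r) \<partial>lborel \<partial>lborel)"
    unfolding conv_def by (simp add: nn_integral_cmult)
  also have "\<dots> = (\<integral>\<^sup>+r. \<integral>\<^sup>+q. G (p - q) * (H (q - r) * F r) \<partial>lborel \<partial>lborel)"
    by (rule lborel_pair.Fubini') measurable
  also have "\<dots> = (\<integral>\<^sup>+r. (\<integral>\<^sup>+q. G (p - q) * H (q - r) \<partial>lborel) * F r \<partial>lborel)"
    by (simp add: nn_integral_multc mult.assoc[symmetric])
  also have "\<dots> = (\<integral>\<^sup>+r. (\<integral>\<^sup>+q. G (p - r - q) * H q \<partial>lborel) * F r \<partial>lborel)"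
  proof (rule nn_integral_cong, rule arg_cong2[where f="(*)", OF _ refl])
    fix r :: 'a
    show "(\<integral>\<^sup>+q. G (p - q) * H (q - r) \<partial>lborel) = (\<integral>\<^sup>+q. G (p - r - q) * H q \<partial>lborel)"
      by (subst nn_integral_lborel_translation[of _ r, symmetric])
         (simp_all add: algebra_simps)
  qed
  finally show "conv G (conv H F) p = conv (conv G H) F p"
    by (simp add: conv_def)
qed

lemma conv_add:
  fixes F G H :: "'a::euclidean_space \<Rightarrow> ennreal"
  assumes [measurable]: "G \<in> borel_measurable borel" "F \<in> borel_measurable borel"
    "H \<in> borel_measurable borel"
  shows "conv G (\<lambda>q. F q + H q) p = conv G F p + conv G H p"
  by (simp add: conv_def distrib_left nn_integral_add)

lemma conv_cmult:
  fixes F G :: "'a::euclidean_space \<Rightarrow> ennreal"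
  assumes [measurable]: "G \<in> borel_measurable borel" "F \<in> borel_measurable borel"
  shows "conv G (\<lambda>q. c * F q) p = c * conv G F p"
  by (simp add: conv_def nn_integral_cmult[symmetric] mult.left_commute)

lemma conv_mono_AE:
  assumes "AE q in lborel. F q \<le> H q"
  shows "conv G F p \<le> conv G H p"
  unfolding conv_def using assms by (intro nn_integral_mono_AE) (auto intro!: mult_left_mono)

lemma conv_mono: "(\<And>q. F q \<le> H q) \<Longrightarrow> conv G F p \<le> conv G H p"
  by (rule conv_mono_AE) simp

lemma conv_cong_AE:
  assumes "AE q in lborel. F q = H q"
  shows "conv G F p = conv G H p"
  using assms by (intro antisym conv_mono_AE) auto

lemma conv_iterated:
  fixes F G :: "real \<times> real \<Rightarrow> ennreal"
  assumes [measurable]: "G \<in> borel_measurable borel" "F \<in> borel_measurable borel"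
  shows "conv G F (t, x) = (\<integral>\<^sup>+\<tau>. \<integral>\<^sup>+y. G (t - \<tau>, x - y) * F (\<tau>, y) \<partial>lborel \<partial>lborel)"
  unfolding conv_def lborel_prod[symmetric]
  by (subst lborel.nn_integral_fst[symmetric]) (simp_all add: lborel_prod)

section \<open>The Bessel kernel and the wave kernel\<close>

lemma summable_bessel_I0: "summable (\<lambda>k. (z / 2) ^ (2 * k) / (fact k)\<^sup>2 :: real)"
proof (rule summable_comparison_test'[where N = 0])
  show "summable (\<lambda>k. ((z / 2)\<^sup>2) ^ k / fact k)"
    using summable_exp_generic[of "(z / 2)\<^sup>2"] by (simp add: field_simps)
  fix k :: nat
  have "(fact k :: real) \<ge> 1" by simp
  then have "(fact k :: real) \<le> (fact k)\<^sup>2"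
    by (simp add: power2_eq_square)
  then show "norm ((z / 2) ^ (2 * k) / (fact k)\<^sup>2) \<le> ((z / 2)\<^sup>2) ^ k / fact k"
    unfolding power_mult by (simp add: divide_left_mono)
qed

lemma bessel_I0_measurable [measurable]: "bessel_I0 \<in> borel_measurable borel"
  unfolding bessel_I0_def[abs_def] by measurable

lemma bessel_I0_nonneg: "0 \<le> bessel_I0 z"
  unfolding bessel_I0_def by (intro suminf_nonneg summable_bessel_I0) simp

lemma bessel_I0_mono: "0 \<le> y \<Longrightarrow> y \<le> z \<Longrightarrow> bessel_I0 y \<le> bessel_I0 z"
  unfolding bessel_I0_def
  by (intro suminf_le summable_bessel_I0 divide_right_mono power_mono) auto

text \<open>The projections are also measurable for the product sigma-algebra; the Borel version lets kernels be treated as functions of one point of the plane.\<close>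
lemma fst_snd_measurable [measurable]:
  "(fst :: real \<times> real \<Rightarrow> real) \<in> borel_measurable borel"
  "(snd :: real \<times> real \<Rightarrow> real) \<in> borel_measurable borel"
  by (intro borel_measurable_continuous_onI continuous_intros)+

definition light_cone :: "(real \<times> real) set" where
  "light_cone = {p. \<bar>snd p\<bar> \<le> fst p}"

lemma light_cone_measurable [measurable]: "light_cone \<in> sets borel"
  unfolding light_cone_def by (intro borel_closed closed_Collect_le continuous_intros)

definition wave_kernel :: "real \<times> real \<Rightarrow> ennreal" where
  "wave_kernel p = ennreal (exp (- fst p / 2) / 2) * indicator light_cone p"

definition damped_kernel :: "real \<times> real \<Rightarrow> ennreal" where
  "damped_kernel p =
     ennreal (exp (- fst p / 2) / 2 * bessel_I0 (sqrt ((fst p)\<^sup>2 - (snd p)\<^sup>2) / 2))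
       * indicator light_cone p"

text \<open>The \<open>n\<close>-th term of the power series of \<open>I\<^sub>0\<close>, whose argument satisfies \<open>(z/2)\<^sup>2 = (t\<^sup>2 - x\<^sup>2)/16\<close>.\<close>
definition damped_kernel_term :: "nat \<Rightarrow> real \<times> real \<Rightarrow> ennreal" where
  "damped_kernel_term n p =
     ennreal (exp (- fst p / 2) / 2 * ((((fst p)\<^sup>2 - (snd p)\<^sup>2) / 16) ^ n / (fact n)\<^sup>2))
       * indicator light_cone p"

lemma kernels_measurable [measurable]:
  "wave_kernel \<in> borel_measurable borel"
  "damped_kernel \<in> borel_measurable borel"
  "damped_kernel_term n \<in> borel_measurable borel"
  unfolding wave_kernel_def[abs_def] damped_kernel_def[abs_def] damped_kernel_term_def[abs_def]
  by measurable

lemma light_cone_square: "p \<in> light_cone \<Longrightarrow> (snd p)\<^sup>2 \<le> (fst p)\<^sup>2"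
  by (auto simp: light_cone_def abs_le_square_iff[symmetric])

lemma damped_kernel_series: "damped_kernel p = (\<Sum>n. damped_kernel_term n p)"
proof (cases "p \<in> light_cone")
  case True
  let ?r = "(fst p)\<^sup>2 - (snd p)\<^sup>2"
  have r: "0 \<le> ?r" using light_cone_square[OF True] by simp
  have eq: "(sqrt ?r / 2 / 2) ^ (2 * n) = (?r / 16) ^ n" for n
    using r by (simp add: power_mult power_divide)
  have s: "summable (\<lambda>n. (?r / 16) ^ n / (fact n)\<^sup>2)"
    using summable_bessel_I0[of "sqrt ?r / 2"] by (simp only: eq)
  have "damped_kernel p = ennreal (\<Sum>n. exp (- fst p / 2) / 2 * ((?r / 16) ^ n / (fact n)\<^sup>2))"
    using True unfolding damped_kernel_def bessel_I0_def eq by (simp add: suminf_mult[OF s] del: times_divide_eq_left times_divide_eq_right)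
  also have "\<dots> = (\<Sum>n. ennreal (exp (- fst p / 2) / 2 * ((?r / 16) ^ n / (fact n)\<^sup>2)))"
    using r by (intro suminf_ennreal2[symmetric] summable_mult s) auto
  finally show ?thesis
    using True by (simp add: damped_kernel_term_def)
qed (simp add: damped_kernel_def damped_kernel_term_def)

text \<open>In the coordinates \<open>a = t - x\<close>, \<open>b = t + x\<close> light cones become quadrants and \<open>t\<^sup>2 - x\<^sup>2 = a b\<close>, so
  that the convolutions below factor into one-dimensional integrals.\<close>
lemma nn_integral_characteristic_coordinates:
  fixes f :: "real \<Rightarrow> real \<Rightarrow> ennreal"
  assumes [measurable]: "(\<lambda>(t, x). f t x) \<in> borel_measurable borel"
  shows "(\<integral>\<^sup>+t. \<integral>\<^sup>+x. f t x \<partial>lborel \<partial>lborel)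
       = ennreal (1/2) * (\<integral>\<^sup>+b. \<integral>\<^sup>+a. f ((a + b) / 2) ((b - a) / 2) \<partial>lborel \<partial>lborel)"
proof -
  have [measurable]: "(\<lambda>(t, x). f t x) \<in> borel_measurable (borel \<Otimes>\<^sub>M borel)"
    using assms by (simp add: borel_prod)
  have m: "(\<lambda>x. f (u x) (v x)) \<in> borel_measurable M"
    if "u \<in> borel_measurable M" "v \<in> borel_measurable M" for u v and M :: "'c measure"
    using that by measurable
  have "(\<integral>\<^sup>+t. \<integral>\<^sup>+x. f t x \<partial>lborel \<partial>lborel) = (\<integral>\<^sup>+t. \<integral>\<^sup>+b. f t (b - t) \<partial>lborel \<partial>lborel)"
  proof (rule nn_integral_cong)
    fix t
    show "(\<integral>\<^sup>+x. f t x \<partial>lborel) = (\<integral>\<^sup>+b. f t (b - t) \<partial>lborel)"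
      by (subst nn_integral_real_affine[where c=1 and t="-t"]) (auto intro!: m)
  qed
  also have "\<dots> = (\<integral>\<^sup>+b. \<integral>\<^sup>+t. f t (b - t) \<partial>lborel \<partial>lborel)"
    by (rule lborel_pair.Fubini'[symmetric]) (auto intro!: m simp: split_def)
  also have "\<dots> = (\<integral>\<^sup>+b. ennreal (1/2) * (\<integral>\<^sup>+a. f ((a + b) / 2) ((b - a) / 2) \<partial>lborel) \<partial>lborel)"
  proof (rule nn_integral_cong)
    fix b
    have "(\<integral>\<^sup>+t. f t (b - t) \<partial>lborel)
        = ennreal \<bar>1/2\<bar> * (\<integral>\<^sup>+a. f (b/2 + 1/2 * a) (b - (b/2 + 1/2 * a)) \<partial>lborel)"
      by (rule nn_integral_real_affine) (auto intro!: m)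
    then show "(\<integral>\<^sup>+t. f t (b - t) \<partial>lborel)
        = ennreal (1/2) * (\<integral>\<^sup>+a. f ((a + b) / 2) ((b - a) / 2) \<partial>lborel)"
      by (simp add: add_divide_distrib diff_divide_distrib algebra_simps)
  qed
  also have "\<dots> = ennreal (1/2) * (\<integral>\<^sup>+b. \<integral>\<^sup>+a. f ((a + b) / 2) ((b - a) / 2) \<partial>lborel \<partial>lborel)"
    by (intro nn_integral_cmult) measurable
  finally show ?thesis .
qed

lemma nn_integral_power_Icc:
  "0 \<le> c \<Longrightarrow> (\<integral>\<^sup>+x. ennreal (x ^ n) * indicator {0..c} x \<partial>lborel) = ennreal (c ^ Suc n / Suc n)"
  by (subst nn_integral_FTC_Icc[where F = "\<lambda>x. x ^ Suc n / Suc n"])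
     (auto intro!: derivative_eq_intros simp del: of_nat_Suc power_Suc)

text \<open>In characteristic coordinates the intersection of the forward cone at \<open>0\<close> with the backward cone
  at \<open>p\<close> is a rectangle, the exponentials multiply to a constant, and
  the two integrals of \<open>a\<^sup>n\<close> and \<open>b\<^sup>n\<close> raise the power of \<open>a b\<close> by one and produce \<open>1/(n+1)\<^sup>2\<close>: exactly the
  step from one term of the Bessel series to the next.\<close>
lemma conv_wave_kernel_term:
  "conv wave_kernel (damped_kernel_term n) p = 4 * damped_kernel_term (Suc n) p"
proof -
  obtain t x where p: "p = (t, x)" by fastforce
  define A B where "A = t - x" and "B = t + x"
  define k where "k = (1 / (16 ^ n * (fact n)\<^sup>2) :: real)"
  have k0: "0 \<le> k" by (simp add: k_def)
  define C where "C = exp (- t / 2) / 4 * k"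
  have C0: "0 \<le> C" using k0 by (simp add: C_def)
  have "conv wave_kernel (damped_kernel_term n) p
      = (\<integral>\<^sup>+\<tau>. \<integral>\<^sup>+y. wave_kernel (t - \<tau>, x - y) * damped_kernel_term n (\<tau>, y) \<partial>lborel \<partial>lborel)"
    unfolding p by (intro conv_iterated) measurable
  also have "\<dots> = ennreal (1/2) * (\<integral>\<^sup>+b. \<integral>\<^sup>+a. wave_kernel (t - (a + b) / 2, x - (b - a) / 2)
      * damped_kernel_term n ((a + b) / 2, (b - a) / 2) \<partial>lborel \<partial>lborel)"
    by (rule nn_integral_characteristic_coordinates) (unfold split_def, measurable)
  also have "(\<lambda>b a. wave_kernel (t - (a + b) / 2, x - (b - a) / 2)
      * damped_kernel_term n ((a + b) / 2, (b - a) / 2))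
     = (\<lambda>b a. ennreal C * (ennreal (b ^ n) * indicator {0..B} b)
          * (ennreal (a ^ n) * indicator {0..A} a))"
  proof (intro ext)
    fix b a :: real
    have i1: "(t - (a + b) / 2, x - (b - a) / 2) \<in> light_cone \<longleftrightarrow> a \<le> A \<and> b \<le> B"
      by (auto simp: light_cone_def A_def B_def abs_le_iff field_simps)
    have i2: "((a + b) / 2, (b - a) / 2) \<in> light_cone \<longleftrightarrow> 0 \<le> a \<and> 0 \<le> b"
      by (auto simp: light_cone_def abs_le_iff field_simps)
    have e: "exp (- (t - (a + b) / 2) / 2) * exp (- ((a + b) / 2) / 2) = exp (- t / 2)"
      by (simp add: exp_add[symmetric] field_simps)
    have q: "(((a + b) / 2)\<^sup>2 - ((b - a) / 2)\<^sup>2) = a * b"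
      by (simp add: power2_eq_square field_simps)
    show "wave_kernel (t - (a + b) / 2, x - (b - a) / 2)
      * damped_kernel_term n ((a + b) / 2, (b - a) / 2)
      = ennreal C * (ennreal (b ^ n) * indicator {0..B} b) * (ennreal (a ^ n) * indicator {0..A} a)"
    proof (cases "0 \<le> a \<and> a \<le> A \<and> 0 \<le> b \<and> b \<le> B")
      case True
      have "exp (- (t - (a + b) / 2) / 2) / 2 *
         (exp (- ((a + b) / 2) / 2) / 2 * ((a * b / 16) ^ n / (fact n)\<^sup>2))
         = exp (- (t - (a + b) / 2) / 2) * exp (- ((a + b) / 2) / 2) / 4 * k * b ^ n * a ^ n"
        by (simp add: k_def power_mult_distrib power_divide)
      also have "\<dots> = C * b ^ n * a ^ n"
        unfolding e C_def by simp
      finally show ?thesis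
        using True i1 i2 C0
        by (simp add: wave_kernel_def damped_kernel_term_def q ennreal_mult[symmetric] mult.assoc)
    next
      case False
      then show ?thesis
        using i1 i2 by (auto simp: wave_kernel_def damped_kernel_term_def split: split_indicator)
    qed
  qed
  also have "ennreal (1/2) * (\<integral>\<^sup>+b. \<integral>\<^sup>+a. ennreal C * (ennreal (b ^ n) * indicator {0..B} b)
          * (ennreal (a ^ n) * indicator {0..A} a) \<partial>lborel \<partial>lborel)
      = ennreal (1/2) * (ennreal C * (\<integral>\<^sup>+b. ennreal (b ^ n) * indicator {0..B} b \<partial>lborel)
          * (\<integral>\<^sup>+a. ennreal (a ^ n) * indicator {0..A} a \<partial>lborel))"
    by (simp add: nn_integral_cmult nn_integral_multc)
  also have "\<dots> = 4 * damped_kernel_term (Suc n) p"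
  proof (cases "0 \<le> A \<and> 0 \<le> B")
    case True
    have pc: "p \<in> light_cone"
      using True by (auto simp: p light_cone_def A_def B_def abs_le_iff)
    have AB: "t\<^sup>2 - x\<^sup>2 = A * B"
      by (simp add: A_def B_def power2_eq_square algebra_simps)
    have arith: "1/2 * (e / 4 * (1 / (s * f\<^sup>2)) * (b / m) * (a / m))
        = 4 * (e / 2 * (a * b / (16 * s) / (m * f)\<^sup>2))"
      if "s \<noteq> 0" "f \<noteq> 0" "m \<noteq> 0" for a b e f m s :: real
      using that by (simp add: divide_simps power2_eq_square)
    have "1/2 * (C * (B ^ Suc n / Suc n) * (A ^ Suc n / Suc n))
        = 4 * (exp (- t / 2) / 2 * (A ^ Suc n * B ^ Suc n / (16 * 16 ^ n) / (real (Suc n) * fact n)\<^sup>2))"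
      unfolding C_def k_def by (rule arith) auto
    then have "1/2 * (C * (B ^ Suc n / Suc n) * (A ^ Suc n / Suc n))
        = 4 * (exp (- t / 2) / 2 * ((A * B / 16) ^ Suc n / (fact (Suc n))\<^sup>2))"
      by (simp add: power_mult_distrib power_divide)
    moreover have "ennreal (1/2) * (ennreal C * ennreal (B ^ Suc n / Suc n) * ennreal (A ^ Suc n / Suc n))
       = ennreal (1/2 * (C * (B ^ Suc n / Suc n) * (A ^ Suc n / Suc n)))"
      using True C0 by (subst ennreal_mult[symmetric], simp, simp)+ simp
    moreover have "ennreal (4 * (exp (- t / 2) / 2 * ((A * B / 16) ^ Suc n / (fact (Suc n))\<^sup>2)))
       = 4 * damped_kernel_term (Suc n) p"
      using True pc unfolding damped_kernel_term_def p fst_conv snd_conv AB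
      by (subst ennreal_mult) (auto simp del: fact_Suc)
    ultimately show ?thesis
      using True by (simp only: nn_integral_power_Icc)
  next
    case False
    then have "p \<notin> light_cone"
      by (auto simp: p light_cone_def A_def B_def abs_le_iff)
    with False show ?thesis
      by (auto simp: damped_kernel_term_def not_le)
  qed
  finally show ?thesis .
qed

text \<open>Summing the previous lemma over \<open>n\<close> gives every term of the series but the first, and the first one is the wave kernel.\<close>
lemma resolvent_identity:
  "4 * wave_kernel p + conv wave_kernel damped_kernel p = 4 * damped_kernel p"
proof -
  have "conv wave_kernel damped_kernel p = (\<Sum>n. conv wave_kernel (damped_kernel_term n) p)"
    unfolding conv_def damped_kernel_series
    by (simp add: nn_integral_suminf[symmetric])
  also have "\<dots> = 4 * (\<Sum>n. damped_kernel_term (Suc n) p)"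
    by (simp add: conv_wave_kernel_term)
  finally have "4 * wave_kernel p + conv wave_kernel damped_kernel p
      = 4 * (wave_kernel p + (\<Sum>n. damped_kernel_term (Suc n) p))"
    by (simp add: distrib_left)
  moreover have "wave_kernel p = damped_kernel_term 0 p"
    by (simp add: wave_kernel_def damped_kernel_term_def)
  moreover have "(\<Sum>n. damped_kernel_term n p)
      = damped_kernel_term 0 p + (\<Sum>n. damped_kernel_term (Suc n) p)"
    using suminf_offset[of "\<lambda>n. damped_kernel_term n p" 1] by simp
  ultimately show ?thesis
    by (simp add: damped_kernel_series)
qed

section \<open>Bounded sources and the two forms of the equation\<close>

definition future :: "(real \<times> real) set" where
  "future = {p. 0 \<le> fst p}"

lemma future_measurable [measurable]: "future \<in> sets borel"
  unfolding future_def by (intro borel_closed closed_Collect_le continuous_intros)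

text \<open>The mass of \<open>E(s, \<cdot>)\<close> is \<open>s exp (-s/2)\<close>; its exponential moments are the integrals needed to convolve \<open>E\<close> with functions of time alone.\<close>
lemma nn_integral_linear_exp:
  assumes "0 < \<mu>" "0 \<le> t"
  shows "(\<integral>\<^sup>+s. ennreal (s * exp (- \<mu> * s)) * indicator {0..t} s \<partial>lborel)
       = ennreal (1 / \<mu>\<^sup>2 - exp (- \<mu> * t) * (t / \<mu> + 1 / \<mu>\<^sup>2))"
proof (subst nn_integral_FTC_Icc[where F = "\<lambda>s. - exp (- \<mu> * s) * (s / \<mu> + 1 / \<mu>\<^sup>2)"])
  show "((\<lambda>s. - exp (- \<mu> * s) * (s / \<mu> + 1 / \<mu>\<^sup>2)) has_real_derivative s * exp (- \<mu> * s)) (at s)" for s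
    using assms by (auto intro!: derivative_eq_intros simp: field_simps power2_eq_square)
qed (use assms in \<open>auto simp: mult.commute\<close>)

lemma conv_wave_kernel_exp:
  assumes "0 \<le> t" "- 1 / 2 < r"
  shows "conv wave_kernel (\<lambda>q. ennreal (exp (r * fst q)) * indicator future q) (t, x)
    = ennreal (exp (r * t) * (1 / (r + 1/2)\<^sup>2
        - exp (- (r + 1/2) * t) * (t / (r + 1/2) + 1 / (r + 1/2)\<^sup>2)))"
proof -
  let ?F = "\<lambda>q. ennreal (exp (r * fst q)) * indicator future q"
  have "conv wave_kernel ?F (t, x) = conv ?F wave_kernel (t, x)"
    by (subst conv_commute) measurable
  also have "\<dots> = (\<integral>\<^sup>+\<tau>. \<integral>\<^sup>+y. ?F (t - \<tau>, x - y) * wave_kernel (\<tau>, y) \<partial>lborel \<partial>lborel)"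
    by (intro conv_iterated) measurable
  also have "\<dots> = (\<integral>\<^sup>+\<tau>. ennreal (exp (r * t)) *
      (ennreal (\<tau> * exp (- (r + 1/2) * \<tau>)) * indicator {0..t} \<tau>) \<partial>lborel)"
  proof (rule nn_integral_cong)
    fix \<tau> :: real
    have "(\<integral>\<^sup>+y. ?F (t - \<tau>, x - y) * wave_kernel (\<tau>, y) \<partial>lborel)
        = (\<integral>\<^sup>+y. ennreal (exp (r * (t - \<tau>))) * indicator {..t} \<tau> * ennreal (exp (- \<tau> / 2) / 2)
             * indicator {-\<tau>..\<tau>} y \<partial>lborel)"
      by (intro nn_integral_cong)
         (auto simp: wave_kernel_def future_def light_cone_def abs_le_iff mult.assoc
            split: split_indicator)
    also have "\<dots> = ennreal (exp (r * (t - \<tau>))) * indicator {..t} \<tau>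
        * ennreal (exp (- \<tau> / 2) / 2) * emeasure lborel {-\<tau>..\<tau>}"
      by (simp add: nn_integral_cmult)
    also have "\<dots> = ennreal (exp (r * t)) *
      (ennreal (\<tau> * exp (- (r + 1/2) * \<tau>)) * indicator {0..t} \<tau>)"
    proof (cases "0 \<le> \<tau> \<and> \<tau> \<le> t")
      case True
      have "exp (r * (t - \<tau>)) * (exp (- \<tau> / 2) / 2) * (2 * \<tau>)
          = exp (r * t) * (\<tau> * exp (- (r + 1/2) * \<tau>))"
        by (simp add: exp_add[symmetric] field_simps)
      with True show ?thesis
        by (simp add: ennreal_mult[symmetric])
    qed (auto split: split_indicator)
    finally show "(\<integral>\<^sup>+y. ?F (t - \<tau>, x - y) * wave_kernel (\<tau>, y) \<partial>lborel) = \<dots>" .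
  qed
  also have "\<dots> = ennreal (exp (r * t)) * ennreal (1 / (r + 1/2)\<^sup>2
        - exp (- (r + 1/2) * t) * (t / (r + 1/2) + 1 / (r + 1/2)\<^sup>2))"
    using nn_integral_linear_exp[of "r + 1/2" t] assms
    by (simp add: nn_integral_cmult)
  finally show ?thesis
    by (simp add: ennreal_mult'[symmetric])
qed

lemma conv_past:
  assumes "\<And>q. q \<notin> light_cone \<Longrightarrow> G q = 0" "\<And>q. q \<notin> future \<Longrightarrow> F q = 0" "p \<notin> future"
  shows "conv G F p = 0"
proof -
  have "G (p - q) * F q = 0" for q
    using assms(3) assms(1)[of "p - q"] assms(2)[of q]
    by (cases "q \<in> future") (auto simp: light_cone_def future_def)
  then show ?thesis by (simp add: conv_def del: mult_eq_0_iff)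
qed

lemma kernels_outside: "q \<notin> light_cone \<Longrightarrow> wave_kernel q = 0"
  "q \<notin> light_cone \<Longrightarrow> damped_kernel q = 0"
  by (simp_all add: wave_kernel_def damped_kernel_def)

text \<open>The d'Alembert solution \<open>exp (-t/2) (1 + t/2)\<close> with both data equal to the constants that make \<open>1\<close> a
  solution of the linear equation: \<open>u\<^sub>0 = 1\<close> and \<open>u\<^sub>1 + u\<^sub>0/2 = 1/2\<close>.\<close>
definition unit_profile :: "real \<times> real \<Rightarrow> ennreal" where
  "unit_profile p = ennreal (exp (- fst p / 2) * (1 + fst p / 2)) * indicator future p"

lemma unit_profile_measurable [measurable]: "unit_profile \<in> borel_measurable borel"
  unfolding unit_profile_def[abs_def] by measurable

text \<open>The constant \<open>1\<close> solves the linear equation \<open>\<partial>\<^sub>t\<^sup>2 u + \<partial>\<^sub>t u - \<partial>\<^sub>x\<^sup>2 u = 0\<close>; this is its wave form.\<close>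
lemma wave_equation_one:
  "4 * indicator future p = 4 * unit_profile p + conv wave_kernel (indicator future) p"
proof (cases "p \<in> future")
  case True
  obtain t x where p: "p = (t, x)" by fastforce
  have t: "0 \<le> t" using True by (simp add: p future_def)
  have pos: "0 \<le> 4 - exp (- t / 2) * (2 * t + 4)"
    using exp_ge_add_one_self[of "t/2"] by (simp add: exp_minus field_simps)
  have "conv wave_kernel (indicator future) p = ennreal (4 - exp (- t / 2) * (2 * t + 4))"
    using conv_wave_kernel_exp[OF t, of 0 x] by (simp add: p power2_eq_square mult.commute)
  moreover have "4 * unit_profile p = ennreal (4 * (exp (- t / 2) * (1 + t / 2)))"
    using True t by (simp add: unit_profile_def p ennreal_mult)
  ultimately have "4 * unit_profile p + conv wave_kernel (indicator future) p
      = ennreal (4 * (exp (- t / 2) * (1 + t / 2)) + (4 - exp (- t / 2) * (2 * t + 4)))"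
    using t pos by (subst ennreal_plus) auto
  also have "\<dots> = ennreal 4"
    by (simp add: algebra_simps)
  finally show ?thesis using True by simp
next
  case False
  then show ?thesis
    by (simp add: unit_profile_def conv_past kernels_outside)
qed

text \<open>The true constant is \<open>4/9\<close>. What matters is that it is below \<open>4\<close>, so that \<open>d \<mapsto> 1/4 E * d\<close> contracts in
  the norm weighted with \<open>exp (-t)\<close>.\<close>
lemma conv_wave_kernel_exp_le:
  "conv wave_kernel (\<lambda>q. ennreal (exp (fst q)) * indicator future q) p
     \<le> ennreal (exp (fst p)) * indicator future p"
proof (cases "p \<in> future")
  case True
  obtain t x where p: "p = (t, x)" by fastforce
  have t: "0 \<le> t" using True by (simp add: p future_def)
  have "conv wave_kernel (\<lambda>q. ennreal (exp (fst q)) * indicator future q) p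
      = ennreal (exp t * (4 / 9 - exp (- (3 / 2 * t)) * (t * 2 / 3 + 4 / 9)))"
    using conv_wave_kernel_exp[OF t, of 1 x] by (simp add: p power2_eq_square)
  also have "\<dots> \<le> ennreal (exp t)"
  proof (rule ennreal_leI)
    have "4 / 9 - exp (- (3 / 2 * t)) * (t * 2 / 3 + 4 / 9) \<le> 1"
      using t by (smt (verit) divide_less_eq_1 divide_nonneg_nonneg exp_ge_zero mult_nonneg_nonneg)
    then show "exp t * (4 / 9 - exp (- (3 / 2 * t)) * (t * 2 / 3 + 4 / 9)) \<le> exp t"
      by (simp add: mult_left_le)
  qed
  finally show ?thesis using True by (simp add: p)
qed (simp add: conv_past kernels_outside)

text \<open>On bounded time intervals the Bessel factor is bounded, because \<open>I\<^sub>0\<close> increases and \<open>t\<^sup>2 - x\<^sup>2 \<le> T\<^sup>2\<close>.\<close>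
lemma damped_kernel_le_wave_kernel:
  assumes "fst q \<le> T"
  shows "damped_kernel q \<le> ennreal (bessel_I0 (T / 2)) * wave_kernel q"
proof (cases "q \<in> light_cone")
  case True
  then have 0: "0 \<le> fst q" by (auto simp: light_cone_def)
  have "sqrt ((fst q)\<^sup>2 - (snd q)\<^sup>2) \<le> sqrt ((fst q)\<^sup>2)"
    by (rule real_sqrt_le_mono) simp
  also have "\<dots> \<le> T" using 0 assms by simp
  finally have "bessel_I0 (sqrt ((fst q)\<^sup>2 - (snd q)\<^sup>2) / 2) \<le> bessel_I0 (T / 2)"
    using light_cone_square[OF True] by (intro bessel_I0_mono) auto
  then have "exp (- fst q / 2) / 2 * bessel_I0 (sqrt ((fst q)\<^sup>2 - (snd q)\<^sup>2) / 2)
      \<le> bessel_I0 (T / 2) * (exp (- fst q / 2) / 2)"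
    by (subst mult.commute, intro mult_right_mono) auto
  then show ?thesis
    using True bessel_I0_nonneg
    by (simp add: damped_kernel_def wave_kernel_def ennreal_mult[symmetric] ennreal_leI)
qed (simp add: kernels_outside)

text \<open>Finiteness is what permits cancelling convolutions in identities between extended reals.\<close>
lemma conv_damped_kernel_finite:
  assumes "\<And>q. F q \<le> ennreal M * indicator future q"
  shows "conv damped_kernel F p < top"
proof -
  obtain t x where p: "p = (t, x)" by fastforce
  have "conv damped_kernel F p \<le> (\<integral>\<^sup>+q. (ennreal (bessel_I0 (t / 2)) * ennreal M)
      * (wave_kernel (p - q) * indicator future q) \<partial>lborel)"
    unfolding conv_def
  proof (rule nn_integral_mono)
    fix q :: "real \<times> real"
    show "damped_kernel (p - q) * F q
        \<le> (ennreal (bessel_I0 (t / 2)) * ennreal M) * (wave_kernel (p - q) * indicator future q)"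
    proof (cases "q \<in> future")
      case True
      then have "damped_kernel (p - q) * F q
          \<le> (ennreal (bessel_I0 (t / 2)) * wave_kernel (p - q)) * ennreal M"
        using assms[of q]
        by (intro mult_mono damped_kernel_le_wave_kernel) (auto simp: p future_def)
      with True show ?thesis by (simp add: mult_ac)
    qed (use assms[of q] in simp)
  qed
  also have "\<dots> = (ennreal (bessel_I0 (t / 2)) * ennreal M) * conv wave_kernel (indicator future) p"
    unfolding conv_def by (rule nn_integral_cmult) measurable
  also have "\<dots> < top"
  proof -
    have "conv wave_kernel (indicator future) p \<le> 4 * indicator future p"
      by (subst wave_equation_one) simp
    also have "\<dots> \<le> 4" by (simp split: split_indicator)
    also have "\<dots> < top" by simp
    finally show ?thesis by (simp add: ennreal_mult_less_top)
  qed
  finally show ?thesis .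
qed

text \<open>The resolvent identity for the operators; the two versions differ in the order of the kernels, and both orders are needed to pass between the two forms of the equation.\<close>
lemma conv_resolvent:
  assumes [measurable]: "F \<in> borel_measurable borel"
  shows "4 * conv wave_kernel F p + conv wave_kernel (conv damped_kernel F) p
       = 4 * conv damped_kernel F p"
    and "4 * conv wave_kernel F p + conv damped_kernel (conv wave_kernel F) p
       = 4 * conv damped_kernel F p"
proof -
  have "4 * conv wave_kernel F p + conv (conv wave_kernel damped_kernel) F p
      = (\<integral>\<^sup>+q. (4 * wave_kernel (p - q) + conv wave_kernel damped_kernel (p - q)) * F q \<partial>lborel)"
    unfolding conv_def[of _ F]
    by (simp add: distrib_right nn_integral_add nn_integral_cmult mult.assoc)
  also have "\<dots> = 4 * conv damped_kernel F p"
    unfolding resolvent_identity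
    by (simp add: conv_def[of _ F] nn_integral_cmult mult.assoc)
  finally have *: "4 * conv wave_kernel F p + conv (conv wave_kernel damped_kernel) F p
      = 4 * conv damped_kernel F p" .
  from * show "4 * conv wave_kernel F p + conv wave_kernel (conv damped_kernel F) p
       = 4 * conv damped_kernel F p"
    by (simp add: conv_assoc)
  from * show "4 * conv wave_kernel F p + conv damped_kernel (conv wave_kernel F) p
       = 4 * conv damped_kernel F p"
    by (simp add: conv_assoc conv_commute[of damped_kernel wave_kernel])
qed

lemma ennreal_four_cancel: "4 * (x::ennreal) = 4 * y \<Longrightarrow> x = y"
  by (subst (asm) ennreal_mult_cancel_left) auto

text \<open>Convolve the damped form with \<open>E\<close> and subtract: by the resolvent identity everything that contains
  \<open>K\<close> cancels. The equation has to hold almost everywhere for the convolution, but the conclusion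
  is drawn at a single point, with an arbitrary value \<open>a\<close> in place of \<open>U p\<close>: a mild solution agrees
  with its Borel representative \<open>U\<close> only almost everywhere in space-time, and its values on a
  fixed time slice may differ.\<close>
lemma wave_form_of_damped_form:
  assumes [measurable]: "U \<in> borel_measurable borel" "F \<in> borel_measurable borel"
      "g \<in> borel_measurable borel"
    and F: "\<And>q. F q \<le> ennreal M * indicator future q"
    and ae: "AE q in lborel. 4 * U q + 4 * conv damped_kernel F q = 4 * g q + conv damped_kernel g q"
    and p: "4 * a + 4 * conv damped_kernel F p = 4 * g p + conv damped_kernel g p"
  shows "4 * a + 4 * conv wave_kernel F p = 4 * g p + conv wave_kernel U p"
proof -
  let ?a = "conv wave_kernel U p" and ?b = "conv wave_kernel (conv damped_kernel F) p"
  have "4 * ?a + 4 * ?b = conv wave_kernel (\<lambda>q. 4 * U q + 4 * conv damped_kernel F q) p"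
    by (simp add: conv_add conv_cmult)
  also have "\<dots> = conv wave_kernel (\<lambda>q. 4 * g q + conv damped_kernel g q) p"
    by (rule conv_cong_AE[OF ae])
  also have "\<dots> = 4 * conv wave_kernel g p + conv wave_kernel (conv damped_kernel g) p"
    by (simp add: conv_add conv_cmult)
  also have "\<dots> = 4 * conv damped_kernel g p"
    by (rule conv_resolvent) measurable
  finally have "4 * (?a + ?b) = 4 * conv damped_kernel g p"
    by (simp add: distrib_left)
  then have ab: "?a + ?b = conv damped_kernel g p"
    by (rule ennreal_four_cancel)
  have r: "4 * conv wave_kernel F p + ?b = 4 * conv damped_kernel F p"
    by (rule conv_resolvent) measurable
  have "?b \<le> 4 * conv damped_kernel F p"
    unfolding r[symmetric] by simp
  also have "\<dots> < top"
    using conv_damped_kernel_finite[OF F] by (simp add: ennreal_mult_less_top)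
  finally have b: "?b \<noteq> top" by simp
  have "?b + (4 * a + 4 * conv wave_kernel F p) = ?b + (4 * g p + ?a)"
    using p unfolding r[symmetric] ab[symmetric] by (simp add: ac_simps)
  with b show ?thesis
    by (simp add: ennreal_add_left_cancel)
qed

text \<open>Convolving with \<open>K\<close> instead of \<open>E\<close> inverts the previous step.\<close>
lemma damped_form_of_wave_form:
  assumes [measurable]: "U \<in> borel_measurable borel" "F \<in> borel_measurable borel"
      "g \<in> borel_measurable borel"
    and U: "\<And>q. U q \<le> ennreal M * indicator future q"
    and eq: "\<And>q. 4 * U q + 4 * conv wave_kernel F q = 4 * g q + conv wave_kernel U q"
  shows "4 * U p + 4 * conv damped_kernel F p = 4 * g p + conv damped_kernel g p"
proof -
  let ?b = "conv damped_kernel (conv wave_kernel F) p"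
    and ?c = "conv damped_kernel (conv wave_kernel U) p"
  have rF: "4 * conv wave_kernel F p + ?b = 4 * conv damped_kernel F p"
    and rU: "4 * conv wave_kernel U p + ?c = 4 * conv damped_kernel U p"
    by (rule conv_resolvent, measurable)+
  have "4 * conv damped_kernel U p + 4 * ?b
      = conv damped_kernel (\<lambda>q. 4 * U q + 4 * conv wave_kernel F q) p"
    by (simp add: conv_add conv_cmult)
  also have "\<dots> = conv damped_kernel (\<lambda>q. 4 * g q + conv wave_kernel U q) p"
    unfolding eq ..
  also have "\<dots> = 4 * conv damped_kernel g p + ?c"
    by (simp add: conv_add conv_cmult)
  finally have "?c + 4 * (conv wave_kernel U p + ?b) = ?c + 4 * conv damped_kernel g p"
    unfolding rU[symmetric] by (simp add: ac_simps distrib_left)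
  moreover have "?c \<noteq> top"
  proof -
    have "?c \<le> 4 * conv damped_kernel U p"
      unfolding rU[symmetric] by simp
    also have "\<dots> < top"
      using conv_damped_kernel_finite[OF U] by (simp add: ennreal_mult_less_top)
    finally show ?thesis by simp
  qed
  ultimately have "4 * (conv wave_kernel U p + ?b) = 4 * conv damped_kernel g p"
    by (simp add: ennreal_add_left_cancel)
  then have "conv wave_kernel U p + ?b = conv damped_kernel g p"
    by (rule ennreal_four_cancel)
  then show ?thesis
    using eq[of p] unfolding rF[symmetric] by (simp add: add.assoc[symmetric])
qed

lemma damped_equation_one:
  "4 * indicator future p = 4 * unit_profile p + conv damped_kernel unit_profile p"
proof -
  have "4 * indicator future p + 4 * conv damped_kernel (\<lambda>_. 0) p
      = 4 * unit_profile p + conv damped_kernel unit_profile p"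
    by (rule damped_form_of_wave_form[where M=1])
       (simp_all add: wave_equation_one conv_def split: split_indicator)
  then show ?thesis by (simp add: conv_def)
qed

section \<open>The linear flow\<close>

text \<open>The convolution in space with initial data: \<open>G\<close> acts on the measure \<open>\<delta>\<^sub>0 \<otimes> f\<close>.\<close>
definition space_conv :: "(real \<times> real \<Rightarrow> ennreal) \<Rightarrow> (real \<Rightarrow> real) \<Rightarrow> real \<times> real \<Rightarrow> ennreal" where
  "space_conv G f p = (\<integral>\<^sup>+z. G (fst p, snd p - z) * ennreal (f z) \<partial>lborel)"

lemma space_conv_measurable [measurable]:
  assumes [measurable]: "G \<in> borel_measurable borel" "f \<in> borel_measurable borel"
  shows "space_conv G f \<in> borel_measurable borel"
  unfolding space_conv_def[abs_def] by measurable

lemma conv_space_conv: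
  assumes [measurable]: "G \<in> borel_measurable borel" "H \<in> borel_measurable borel"
    "f \<in> borel_measurable borel"
  shows "conv G (space_conv H f) p = space_conv (conv G H) f p"
proof -
  have "conv G (space_conv H f) p
      = (\<integral>\<^sup>+q. \<integral>\<^sup>+z. G (p - q) * (H (fst q, snd q - z) * ennreal (f z)) \<partial>lborel \<partial>lborel)"
    unfolding conv_def space_conv_def by (simp add: nn_integral_cmult)
  also have "\<dots> = (\<integral>\<^sup>+z. \<integral>\<^sup>+q. G (p - q) * (H (fst q, snd q - z) * ennreal (f z)) \<partial>lborel \<partial>lborel)"
    by (rule lborel_pair.Fubini') measurable
  also have "\<dots> = (\<integral>\<^sup>+z. conv G H (fst p, snd p - z) * ennreal (f z) \<partial>lborel)"
  proof (rule nn_integral_cong)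
    fix z :: real
    have "(\<integral>\<^sup>+q. G (p - q) * (H (fst q, snd q - z) * ennreal (f z)) \<partial>lborel)
        = (\<integral>\<^sup>+q. G (p - q) * H (q - (0, z)) \<partial>lborel) * ennreal (f z)"
      by (simp add: nn_integral_multc mult.assoc[symmetric] minus_prod_def)
    also have "(\<integral>\<^sup>+q. G (p - q) * H (q - (0, z)) \<partial>lborel) = conv G H (p - (0, z))"
      unfolding conv_def
      by (subst nn_integral_lborel_translation[of _ "(0, z)", symmetric])
         (simp_all add: algebra_simps)
    finally show "(\<integral>\<^sup>+q. G (p - q) * (H (fst q, snd q - z) * ennreal (f z)) \<partial>lborel)
        = conv G H (fst p, snd p - z) * ennreal (f z)"
      by (simp add: minus_prod_def)
  qed
  finally show ?thesis by (simp add: space_conv_def)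
qed

lemma space_conv_resolvent:
  assumes [measurable]: "f \<in> borel_measurable borel"
  shows "4 * space_conv damped_kernel f p
       = 4 * space_conv wave_kernel f p + conv damped_kernel (space_conv wave_kernel f) p"
proof -
  have "4 * space_conv wave_kernel f p + space_conv (conv wave_kernel damped_kernel) f p
      = (\<integral>\<^sup>+z. (4 * wave_kernel (fst p, snd p - z) + conv wave_kernel damped_kernel (fst p, snd p - z))
           * ennreal (f z) \<partial>lborel)"
    unfolding space_conv_def
    by (simp add: distrib_right nn_integral_add nn_integral_cmult mult.assoc)
  also have "\<dots> = 4 * space_conv damped_kernel f p"
    unfolding resolvent_identity
    by (simp add: space_conv_def nn_integral_cmult mult.assoc)
  finally show ?thesis
    by (simp add: conv_space_conv conv_commute[of damped_kernel wave_kernel])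
qed

text \<open>Affine maps preserve null sets. The property is arbitrary, as the almost everywhere statements below come from Lebesgue measurable functions.\<close>
lemma AE_lborel_affine:
  fixes P :: "real \<Rightarrow> bool"
  assumes "AE x in lborel. P x" "c \<noteq> 0"
  shows "AE x in lborel. P (t + c * x)"
proof -
  obtain N where N: "N \<in> null_sets lborel" "{x. \<not> P x} \<subseteq> N"
    using assms(1) unfolding eventually_ae_filter by auto
  have [measurable]: "N \<in> sets borel" using N(1) by auto
  have "AE x in lborel. t + c * x \<notin> N"
    using N(1) by (intro AE_borel_affine assms(2)) (auto intro: AE_not_in)
  then show ?thesis
    by eventually_elim (use N(2) in auto)
qed

lemma S_eq_space_conv:
  assumes [measurable]: "f \<in> borel_measurable borel" and f0: "\<And>x. 0 \<le> f x" and t: "0 \<le> t"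
  shows "S t f x = enn2real (space_conv damped_kernel f (t, x))"
proof -
  let ?h = "\<lambda>y. indicator {-t..t} y * (bessel_I0 (sqrt (t\<^sup>2 - y\<^sup>2) / 2) * f (x - y))"
  have h0: "0 \<le> ?h y" for y
    using bessel_I0_nonneg f0 by simp
  have "(LINT y:{-t..t}|lebesgue. bessel_I0 (sqrt (t\<^sup>2 - y\<^sup>2) / 2) * f (x - y)) = (LINT y|lborel. ?h y)"
    unfolding set_lebesgue_integral_def by (subst integral_completion) auto
  also have "\<dots> = enn2real (\<integral>\<^sup>+y. ennreal (?h y) \<partial>lborel)"
    using h0 by (intro integral_eq_nn_integral) auto
  finally have "S t f x = enn2real (ennreal (exp (- t / 2) / 2) * (\<integral>\<^sup>+y. ennreal (?h y) \<partial>lborel))"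
    by (simp add: S_def enn2real_mult)
  also have "ennreal (exp (- t / 2) / 2) * (\<integral>\<^sup>+y. ennreal (?h y) \<partial>lborel)
      = (\<integral>\<^sup>+y. damped_kernel (t, y) * ennreal (f (x - y)) \<partial>lborel)"
    by (subst nn_integral_cmult[symmetric], measurable, intro nn_integral_cong)
       (auto simp: damped_kernel_def light_cone_def abs_le_iff ennreal_mult'[symmetric] mult_ac
         ennreal_mult''[symmetric] f0 bessel_I0_nonneg split: split_indicator)
  also have "\<dots> = space_conv damped_kernel f (t, x)"
    unfolding space_conv_def
    by (subst nn_integral_lborel_reflection[of _ x, symmetric]) simp_all
  finally show ?thesis .
qed

lemma lebesgue_measurable_reflection:
  fixes f :: "real \<Rightarrow> real"
  assumes "f \<in> borel_measurable lebesgue"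
  shows "(\<lambda>y. f (x - y)) \<in> borel_measurable lebesgue"
  using measurable_compose[OF lebesgue_affine_measurable[of "\<lambda>_. -1" x] assms] by simp

text \<open>This is what allows Lebesgue measurable data to be replaced by Borel representatives.\<close>
lemma S_cong_AE:
  assumes f: "f \<in> borel_measurable lebesgue" and g: "g \<in> borel_measurable lebesgue"
    and ae: "AE x in lebesgue. f x = g x"
  shows "S t f x = S t g x"
proof -
  have "AE y in lborel. f (x - y) = g (x - y)"
    using AE_lborel_affine[of "\<lambda>y. f y = g y" "-1" x] ae by (simp add: AE_completion_iff)
  then have "AE y in lebesgue. f (x - y) = g (x - y)"
    by (simp add: AE_completion_iff)
  then have "(LINT y:{-t..t}|lebesgue. bessel_I0 (sqrt (t\<^sup>2 - y\<^sup>2) / 2) * f (x - y))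
      = (LINT y:{-t..t}|lebesgue. bessel_I0 (sqrt (t\<^sup>2 - y\<^sup>2) / 2) * g (x - y))"
    unfolding set_lebesgue_integral_def
    by (intro integral_cong_AE borel_measurable_scaleR borel_measurable_times
          lebesgue_measurable_reflection f g measurable_completion) auto
  then show ?thesis by (simp add: S_def)
qed

lemma space_conv_finite:
  assumes "\<And>z. f z \<le> M"
  shows "space_conv damped_kernel f p < top"
proof -
  have "space_conv damped_kernel f p
      \<le> (\<integral>\<^sup>+z. (ennreal (bessel_I0 (fst p / 2)) * ennreal (exp (- fst p / 2) / 2) * ennreal M)
            * indicator {snd p - fst p..snd p + fst p} z \<partial>lborel)"
    unfolding space_conv_def
  proof (rule nn_integral_mono)
    fix z
    have "damped_kernel (fst p, snd p - z) * ennreal (f z)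
       \<le> (ennreal (bessel_I0 (fst p / 2)) * wave_kernel (fst p, snd p - z)) * ennreal M"
      using assms by (intro mult_mono damped_kernel_le_wave_kernel ennreal_leI) auto
    also have "\<dots> \<le> (ennreal (bessel_I0 (fst p / 2)) * ennreal (exp (- fst p / 2) / 2) * ennreal M)
            * indicator {snd p - fst p..snd p + fst p} z"
      by (auto simp: wave_kernel_def light_cone_def abs_le_iff mult_ac split: split_indicator)
    finally show "damped_kernel (fst p, snd p - z) * ennreal (f z) \<le> \<dots>" .
  qed
  also have "\<dots> < top"
    by (simp add: nn_integral_cmult ennreal_mult_less_top emeasure_lborel_Icc_eq)
  finally show ?thesis .
qed

section \<open>The time derivative of the linear flow\<close>
text \<open>\<open>I\<^sub>0\<close> is an everywhere convergent power series in \<open>z\<^sup>2\<close>.\<close>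
lemma bessel_I0_continuous: "isCont bessel_I0 z"
proof -
  have s: "summable (\<lambda>k. (1 / 4) ^ k / (fact k)\<^sup>2 * y ^ k)" for y :: real
  proof (rule summable_comparison_test'[where N = 0])
    show "summable (\<lambda>k. \<bar>y / 4\<bar> ^ k / fact k)"
      using summable_exp_generic[of "\<bar>y / 4\<bar>"] by (simp add: field_simps)
    fix k :: nat
    have "(fact k :: real) \<ge> 1" by simp
    then have "(fact k :: real) \<le> (fact k)\<^sup>2"
      by (simp add: power2_eq_square)
    then have "\<bar>y / 4\<bar> ^ k / (fact k)\<^sup>2 \<le> \<bar>y / 4\<bar> ^ k / fact k"
      by (intro divide_left_mono) auto
    then show "norm ((1 / 4) ^ k / (fact k)\<^sup>2 * y ^ k) \<le> \<bar>y / 4\<bar> ^ k / fact k"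
      by (simp add: abs_mult power_abs power_divide)
  qed
  have "bessel_I0 = (\<lambda>w. \<Sum>k. (1 / 4) ^ k / (fact k)\<^sup>2 * (w\<^sup>2) ^ k)"
    by (rule ext) (simp add: bessel_I0_def power_mult power_divide)
  moreover have "isCont (\<lambda>w. \<Sum>k. (1 / 4) ^ k / (fact k)\<^sup>2 * (w\<^sup>2) ^ k) z"
    by (rule isCont_o2[where f = "\<lambda>w. w\<^sup>2", OF _ isCont_powser_converges_everywhere[OF s]]) simp
  ultimately show ?thesis by simp
qed

lemma damped_kernel_tendsto:
  assumes s: "s \<longlonglongrightarrow> t" and off: "\<bar>y\<bar> \<noteq> t"
  shows "(\<lambda>n. damped_kernel (s n, y)) \<longlonglongrightarrow> damped_kernel (t, y)"
proof (cases "\<bar>y\<bar> < t")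
  case True
  have "(\<lambda>n. ennreal (exp (- s n / 2) / 2 * bessel_I0 (sqrt ((s n)\<^sup>2 - y\<^sup>2) / 2)))
      \<longlonglongrightarrow> ennreal (exp (- t / 2) / 2 * bessel_I0 (sqrt (t\<^sup>2 - y\<^sup>2) / 2))"
    by (intro tendsto_ennrealI tendsto_intros s isCont_tendsto_compose[OF bessel_I0_continuous]) auto
  moreover have "\<forall>\<^sub>F n in sequentially.
      ennreal (exp (- s n / 2) / 2 * bessel_I0 (sqrt ((s n)\<^sup>2 - y\<^sup>2) / 2)) = damped_kernel (s n, y)"
    using order_tendstoD(1)[OF s True]
    by eventually_elim (simp add: damped_kernel_def light_cone_def)
  ultimately show ?thesis
    using True by (auto simp: damped_kernel_def light_cone_def elim: Lim_transform_eventually)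
next
  case False
  with off have "t < \<bar>y\<bar>" by simp
  have "\<forall>\<^sub>F n in sequentially. damped_kernel (s n, y) = 0"
    using order_tendstoD(2)[OF s \<open>t < \<bar>y\<bar>\<close>]
    by eventually_elim (simp add: damped_kernel_def light_cone_def)
  moreover have "damped_kernel (t, y) = 0"
    using \<open>t < \<bar>y\<bar>\<close> by (simp add: damped_kernel_def light_cone_def)
  ultimately show ?thesis
    by (simp add: tendsto_eventually)
qed

lemma AE_off_characteristics: "AE q in lborel. \<bar>x - snd q\<bar> \<noteq> t - fst (q :: real \<times> real)"
proof -
  have "negligible {q :: real \<times> real. (1, -1) \<bullet> q = t - x}"
       "negligible {q :: real \<times> real. (1, 1) \<bullet> q = t + x}"
    by (intro negligible_hyperplane disjI1; simp add: prod_eq_iff)+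
  then have "negligible ({q :: real \<times> real. (1, -1) \<bullet> q = t - x} \<union> {q. (1, 1) \<bullet> q = t + x})"
    by (rule negligible_Un)
  then have "AE q in lebesgue. q \<notin> {q :: real \<times> real. (1, -1) \<bullet> q = t - x} \<union> {q. (1, 1) \<bullet> q = t + x}"
    by (intro AE_not_in) (simp add: negligible_iff_null_sets)
  then show ?thesis
    unfolding AE_completion_iff by eventually_elim (auto simp: abs_if split: if_splits)
qed

text \<open>Dominated convergence. The kernel jumps across the boundary of the backward light cone of
  \<open>(t, x)\<close>, but that boundary is a null set.\<close>
lemma conv_damped_kernel_tendsto:
  assumes [measurable]: "F \<in> borel_measurable borel"
    and F: "\<And>q. F q \<le> ennreal M * indicator future q"
    and s: "s \<longlonglongrightarrow> t"
  shows "(\<lambda>n. conv damped_kernel F (s n, x)) \<longlonglongrightarrow> conv damped_kernel F (t, x)"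
proof -
  obtain T where T: "\<And>n. \<bar>s n\<bar> \<le> T" 
    using convergent_imp_Bseq[of s] s by (auto simp: convergent_def Bseq_def)
  let ?C = "ennreal (bessel_I0 (T / 2)) * ennreal M"
  show ?thesis
    unfolding conv_def
  proof (rule nn_integral_dominated_convergence)
    show "AE q in lborel. damped_kernel ((s n, x) - q) * F q
        \<le> ?C * indicator (cbox (0, x - T) (T, x + T)) q" for n
    proof (rule AE_I2)
      fix q :: "real \<times> real"
      show "damped_kernel ((s n, x) - q) * F q
        \<le> ?C * indicator (cbox (0, x - T) (T, x + T)) q"
      proof (cases "q \<in> future \<and> (s n, x) - q \<in> light_cone")
        case True
        then have q: "fst q \<le> s n" "0 \<le> fst q" "\<bar>x - snd q\<bar> \<le> s n - fst q"
          by (auto simp: future_def light_cone_def)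
        then have "q \<in> cbox (0, x - T) (T, x + T)"
          using T[of n] by (cases q) (auto simp: cbox_Pair_eq abs_le_iff)
        moreover have "damped_kernel ((s n, x) - q) \<le> ennreal (bessel_I0 (T / 2)) * wave_kernel ((s n, x) - q)"
          using q T[of n] by (intro damped_kernel_le_wave_kernel) auto
        moreover have "wave_kernel ((s n, x) - q) \<le> ennreal 1"
        proof -
          have "exp (- (s n - fst q) / 2) / 2 \<le> 1"
            using q by (intro order.trans[OF _ exp_le_one_iff[THEN iffD2, of "- (s n - fst q) / 2"]]) auto
          then show ?thesis
            unfolding wave_kernel_def using True by (simp add: ennreal_leI)
        qed
        ultimately show ?thesis
          using F[of q] True
          by (auto intro!: mult_mono order.trans[OF _ mult_left_mono[of _ 1]])
             (metis mult.right_neutral mult_left_mono order_trans zero_le)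
      next
        case False
        then show ?thesis
          using F[of q] by (auto simp: kernels_outside)
      qed
    qed
    show "(\<integral>\<^sup>+q. ?C * indicator (cbox (0, x - T) (T, x + T)) q \<partial>lborel) < \<infinity>"
      using emeasure_bounded_finite[OF bounded_cbox[of "(0, x - T)" "(T, x + T)"]]
      by (simp add: nn_integral_cmult ennreal_mult_less_top)
    show "AE q in lborel. (\<lambda>n. damped_kernel ((s n, x) - q) * F q)
        \<longlonglongrightarrow> damped_kernel ((t, x) - q) * F q"
      using AE_off_characteristics[of x t]
    proof eventually_elim
      case (elim q)
      have "(\<lambda>n. damped_kernel (s n - fst q, x - snd q)) \<longlonglongrightarrow> damped_kernel (t - fst q, x - snd q)"
        using elim by (intro damped_kernel_tendsto tendsto_intros s) auto
      moreover have "F q < top"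
        using F[of q] by (auto simp: ennreal_mult_less_top split: split_indicator_asm
            intro: le_less_trans)
      moreover have "damped_kernel (t - fst q, x - snd q) \<noteq> top"
        by (auto simp: damped_kernel_def ennreal_mult_eq_top_iff split: split_indicator)
      ultimately show ?case
        by (cases q) (auto intro!: tendsto_mult_ennreal tendsto_const)
    qed
  qed measurable
qed

lemma continuous_conv_damped_kernel:
  assumes [measurable]: "F \<in> borel_measurable borel"
    and F: "\<And>q. F q \<le> ennreal M * indicator future q"
  shows "continuous_on UNIV (\<lambda>t. enn2real (conv damped_kernel F (t, x)))"
  unfolding continuous_on_sequentially o_def
  using conv_damped_kernel_finite[of F M, OF F]
  by (auto intro!: tendsto_enn2real conv_damped_kernel_tendsto[of F M] F simp: less_top)

text \<open>Convolution in time with \<open>exp (-t/2)\<close> on \<open>t \<ge> 0\<close>, the solution operator of \<open>\<partial>\<^sub>t + 1/2\<close>.\<close>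
definition time_conv :: "(real \<times> real \<Rightarrow> ennreal) \<Rightarrow> real \<times> real \<Rightarrow> ennreal" where
  "time_conv F p = (\<integral>\<^sup>+r. ennreal (exp (- (fst p - r) / 2)) * indicator {..fst p} r * F (r, snd p) \<partial>lborel)"

lemma time_conv_measurable [measurable]:
  assumes [measurable]: "F \<in> borel_measurable borel"
  shows "time_conv F \<in> borel_measurable borel"
proof -
  have "(\<lambda>p :: real \<times> real. \<integral>\<^sup>+r. ennreal (exp (- (fst p - r) / 2)) * (if r \<le> fst p then 1 else 0)
       * F (r, snd p) \<partial>lborel) \<in> borel_measurable borel"
    by measurable
  then show ?thesis
    by (simp add: time_conv_def[abs_def] indicator_def)
qed

lemma conv_time_conv:
  assumes [measurable]: "G \<in> borel_measurable borel" "F \<in> borel_measurable borel"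
  shows "conv G (time_conv F) p = time_conv (conv G F) p"
proof -
  let ?D = "\<lambda>s. ennreal (exp (- s / 2)) * indicator {0..} s"
  have tc: "time_conv H q = (\<integral>\<^sup>+r. ?D (fst q - r) * H (r, snd q) \<partial>lborel)" for H q
    unfolding time_conv_def by (intro nn_integral_cong) (auto split: split_indicator)
  have "conv G (time_conv F) p = conv (time_conv F) G p"
    by (subst conv_commute) simp_all
  also have "\<dots> = (\<integral>\<^sup>+q. \<integral>\<^sup>+r. ?D (fst p - fst q - r) * F (r, snd p - snd q) * G q \<partial>lborel \<partial>lborel)"
    unfolding conv_def tc by (simp add: nn_integral_multc)
  also have "\<dots> = (\<integral>\<^sup>+q. \<integral>\<^sup>+r. ?D (fst p - r) * F (r - fst q, snd p - snd q) * G q \<partial>lborel \<partial>lborel)"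
  proof (rule nn_integral_cong)
    fix q :: "real \<times> real"
    show "(\<integral>\<^sup>+r. ?D (fst p - fst q - r) * F (r, snd p - snd q) * G q \<partial>lborel)
        = (\<integral>\<^sup>+r. ?D (fst p - r) * F (r - fst q, snd p - snd q) * G q \<partial>lborel)"
      by (subst nn_integral_lborel_translation[of _ "- fst q", symmetric]) simp_all
  qed
  also have "\<dots> = (\<integral>\<^sup>+r. \<integral>\<^sup>+q. ?D (fst p - r) * F (r - fst q, snd p - snd q) * G q \<partial>lborel \<partial>lborel)"
    by (rule lborel_pair.Fubini') measurable
  also have "\<dots> = (\<integral>\<^sup>+r. ?D (fst p - r) * conv F G (r, snd p) \<partial>lborel)"
    unfolding conv_def by (simp add: mult.assoc nn_integral_cmult minus_prod_def)
  also have "\<dots> = time_conv (conv G F) p"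
    unfolding tc by (subst conv_commute) simp_all
  finally show ?thesis .
qed

text \<open>\<open>(\<partial>\<^sub>t + 1/2)\<close> applied to the convolution of \<open>E(t, \<cdot>)\<close> with \<open>f\<close>.\<close>
definition dalembert_mean :: "(real \<Rightarrow> real) \<Rightarrow> real \<times> real \<Rightarrow> ennreal" where
  "dalembert_mean f p =
     ennreal (exp (- fst p / 2) / 2 * (f (snd p - fst p) + f (snd p + fst p))) * indicator future p"

lemma dalembert_mean_measurable [measurable]:
  assumes [measurable]: "f \<in> borel_measurable borel"
  shows "dalembert_mean f \<in> borel_measurable borel"
  unfolding dalembert_mean_def[abs_def] by measurable

lemma dalembert_mean_le:
  assumes "\<And>x. 0 \<le> f x" "\<And>x. f x \<le> M"
  shows "dalembert_mean f p \<le> ennreal M * indicator future p"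
proof (cases "p \<in> future")
  case True
  have "exp (- fst p / 2) * ((f (snd p - fst p) + f (snd p + fst p)) / 2) \<le> 1 * M"
    using True assms(1)[of "snd p - fst p"] assms(1)[of "snd p + fst p"]
      assms(2)[of "snd p - fst p"] assms(2)[of "snd p + fst p"]
    by (intro mult_mono) (auto simp: future_def)
  with True show ?thesis
    by (simp add: dalembert_mean_def ennreal_leI)
qed (simp add: dalembert_mean_def)

lemma nn_integral_symmetric_interval:
  fixes f :: "real \<Rightarrow> ennreal"
  assumes [measurable]: "f \<in> borel_measurable borel" and "0 \<le> t"
  shows "(\<integral>\<^sup>+r. f (x - r) * indicator {0..t} r \<partial>lborel) + (\<integral>\<^sup>+r. f (x + r) * indicator {0..t} r \<partial>lborel)
       = (\<integral>\<^sup>+z. f z * indicator {x - t..x + t} z \<partial>lborel)"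
proof -
  have "(\<integral>\<^sup>+r. f (x - r) * indicator {0..t} r \<partial>lborel) = (\<integral>\<^sup>+z. f z * indicator {x - t..x} z \<partial>lborel)"
    by (subst nn_integral_lborel_reflection[of "\<lambda>z. f z * indicator {x - t..x} z" x, symmetric])
       (auto intro!: nn_integral_cong split: split_indicator)
  moreover have "(\<integral>\<^sup>+r. f (x + r) * indicator {0..t} r \<partial>lborel) = (\<integral>\<^sup>+z. f z * indicator {x..x + t} z \<partial>lborel)"
    by (subst nn_integral_lborel_translation[of "\<lambda>z. f z * indicator {x..x + t} z" x, symmetric])
       (auto intro!: nn_integral_cong simp: add.commute split: split_indicator)
  moreover have "(\<integral>\<^sup>+z. f z * indicator {x - t..x} z \<partial>lborel) + (\<integral>\<^sup>+z. f z * indicator {x..x + t} z \<partial>lborel)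
      = (\<integral>\<^sup>+z. f z * indicator {x - t..x + t} z \<partial>lborel)"
  proof -
    have "AE z in lborel. f z * indicator {x - t..x} z + f z * indicator {x..x + t} z
        = f z * indicator {x - t..x + t} z"
      using AE_lborel_singleton[of x]
      by eventually_elim (use assms(2) in \<open>auto split: split_indicator\<close>)
    then show ?thesis
      by (subst nn_integral_add[symmetric]) (auto intro: nn_integral_cong_AE)
  qed
  ultimately show ?thesis by simp
qed

text \<open>Both sides are \<open>exp (-t/2)/2\<close> times the integral of \<open>f\<close> over \<open>[x - t, x + t]\<close>; on the left this interval is swept out by its two end points.\<close>
lemma time_conv_dalembert_mean:
  assumes [measurable]: "f \<in> borel_measurable borel" and f0: "\<And>x. 0 \<le> f x"
  shows "time_conv (dalembert_mean f) = space_conv wave_kernel f"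
proof
  fix p :: "real \<times> real"
  obtain t x where p: "p = (t, x)" by fastforce
  show "time_conv (dalembert_mean f) p = space_conv wave_kernel f p"
  proof (cases "0 \<le> t")
    case True
    have "time_conv (dalembert_mean f) p
        = (\<integral>\<^sup>+r. ennreal (exp (- t / 2) / 2) * ((ennreal (f (x - r)) * indicator {0..t} r)
              + (ennreal (f (x + r)) * indicator {0..t} r)) \<partial>lborel)"
      unfolding time_conv_def p
    proof (rule nn_integral_cong)
      fix r
      have "exp (- (t - r) / 2) * exp (- r / 2) = exp (- t / 2)"
        by (simp add: exp_add[symmetric] field_simps)
      then have "exp (- (t - r) / 2) * (exp (- r / 2) / 2 * (f (x - r) + f (x + r)))
          = exp (- t / 2) / 2 * (f (x - r) + f (x + r))"
        by (simp add: mult.assoc[symmetric])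
      then show "ennreal (exp (- (fst (t, x) - r) / 2)) * indicator {..fst (t, x)} r * dalembert_mean f (r, snd (t, x))
         = ennreal (exp (- t / 2) / 2) * ((ennreal (f (x - r)) * indicator {0..t} r)
              + (ennreal (f (x + r)) * indicator {0..t} r))"
        by (auto simp: dalembert_mean_def future_def ennreal_mult'[symmetric] f0
              ennreal_plus[symmetric] simp del: ennreal_plus split: split_indicator)
    qed
    also have "\<dots> = ennreal (exp (- t / 2) / 2)
        * (\<integral>\<^sup>+z. ennreal (f z) * indicator {x - t..x + t} z \<partial>lborel)"
      using True nn_integral_symmetric_interval[of "\<lambda>z. ennreal (f z)" t x]
      by (simp add: nn_integral_cmult nn_integral_add)
    also have "\<dots> = space_conv wave_kernel f p"
      unfolding space_conv_def p
      by (subst nn_integral_cmult[symmetric], measurable, intro nn_integral_cong)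
         (auto simp: wave_kernel_def light_cone_def abs_le_iff split: split_indicator)
    finally show ?thesis .
  next
    case False
    then show ?thesis
      by (auto simp: p time_conv_def space_conv_def dalembert_mean_def future_def wave_kernel_def
          light_cone_def nn_integral_0_iff_AE indicator_def intro!: nn_integral_cong)
  qed
qed

lemma AE_right_derivative_integral:
  fixes f :: "real \<Rightarrow> real"
  assumes f: "integrable lborel f"
  shows "AE x in lborel. ((\<lambda>h. (LINT z:{x..x + h}|lborel. f z) / h) \<longlongrightarrow> f x) (at_right 0)"
proof -
  have [measurable]: "f \<in> borel_measurable borel" using f by simp
  have si: "set_integrable lborel {a..b} f" for a b
    unfolding set_integrable_def by (rule integrable_mult_indicator[OF _ f]) simp
  have "f integrable_on cbox a b" for a b
    using set_borel_integral_eq_integral(1)[OF si[of a b]] by simp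
  then obtain N where N: "negligible N"
    "\<And>x e. \<lbrakk>x \<notin> N; 0 < e\<rbrakk> \<Longrightarrow> \<exists>d>0. \<forall>h. 0 < h \<and> h < d \<longrightarrow>
         norm (integral (cbox x (x + h *\<^sub>R One)) f /\<^sub>R h ^ DIM(real) - f x) < e"
    using integrable_ccontinuous_explicit[of f] by blast
  have "AE x in lebesgue. x \<notin> N"
    using N(1) by (intro AE_not_in) (simp add: negligible_iff_null_sets)
  then have "AE x in lborel. x \<notin> N" by (simp add: AE_completion_iff)
  then show ?thesis
  proof eventually_elim
    case (elim x)
    show ?case
    proof (rule tendstoI)
      fix e :: real assume "0 < e"
      from N(2)[OF elim this] obtain d where d: "0 < d"
        "\<And>h. 0 < h \<Longrightarrow> h < d \<Longrightarrow> \<bar>integral {x..x + h} f / h - f x\<bar> < e"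
        by (auto simp: field_simps)
      show "\<forall>\<^sub>F h in at_right 0. dist ((LINT z:{x..x + h}|lborel. f z) / h) (f x) < e"
        unfolding eventually_at_right_field
        using d by (auto simp: dist_real_def set_borel_integral_eq_integral[OF si] intro!: exI[of _ d])
    qed
  qed
qed

text \<open>Lebesgue differentiation on the line. The derivative from the left is the derivative from the right of the reflected function.\<close>
lemma AE_DERIV_integral:
  fixes f :: "real \<Rightarrow> real"
  assumes f: "integrable lborel f"
  shows "AE x in lborel. DERIV (\<lambda>y. LINT z:{..y}|lborel. f z) x :> f x"
proof -
  let ?G = "\<lambda>y. LINT z:{..y}|lborel. f z"
  have [measurable]: "f \<in> borel_measurable borel" using f by simp
  have si: "set_integrable lborel A f" if "A \<in> sets borel" for A
    unfolding set_integrable_def by (rule integrable_mult_indicator[OF _ f]) (simp add: that)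
  have diff: "?G b - ?G a = (LINT z:{a..b}|lborel. f z)" if "a \<le> b" for a b
  proof -
    have "{..b} = {..a} \<union> {a..b}"
      using that by auto
    then have "?G b = (LINT z:{..a} \<union> {a..b}|lborel. f z)"
      by simp
    also have "\<dots> = ?G a + (LINT z:{a..b}|lborel. f z)"
      using AE_lborel_singleton[of a]
      by (intro set_integral_Un_AE si) (auto elim: eventually_mono)
    finally show ?thesis by simp
  qed
  have f': "integrable lborel (\<lambda>x. f (- x))"
    using f lborel_integrable_real_affine[of f "-1" 0] by simp
  have left: "AE x in lborel. ((\<lambda>h. (LINT z:{x - h..x}|lborel. f z) / h) \<longlongrightarrow> f x) (at_right 0)"
  proof -
    have "AE x in lborel. ((\<lambda>h. (LINT z:{-x..-x + h}|lborel. f (- z)) / h) \<longlongrightarrow> f (- (- x))) (at_right 0)"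
      using AE_lborel_affine[OF AE_right_derivative_integral[OF f'], of "-1" 0] by simp
    moreover have "(LINT z:{-x..-x + h}|lborel. f (- z)) = (LINT z:{x - h..x}|lborel. f z)" for x h
      unfolding set_lebesgue_integral_def
      by (subst lborel_integral_real_affine[where c = "-1" and t = 0])
         (auto intro!: Bochner_Integration.integral_cong split: split_indicator)
    ultimately show ?thesis by simp
  qed
  from AE_right_derivative_integral[OF f] left show ?thesis
  proof eventually_elim
    case (elim x)
    have "((\<lambda>h. (?G (x + h) - ?G x) / h) \<longlongrightarrow> f x) (at_right 0)"
      using elim(1)
      by (rule Lim_transform_eventually)
         (auto intro!: eventually_at_right_less[THEN eventually_mono] simp: diff)
    moreover have "((\<lambda>h. (?G (x + h) - ?G x) / h) \<longlongrightarrow> f x) (at_left 0)"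
      unfolding filterlim_at_left_to_right[of _ _ 0] minus_zero
      using elim(2)
      by (rule Lim_transform_eventually)
         (auto intro!: eventually_at_right_less[THEN eventually_mono] simp: diff[symmetric] field_simps)
    ultimately show ?case
      unfolding DERIV_def by (simp add: filterlim_split_at)
  qed
qed

lemma four_ennreal: "4 * ennreal a = ennreal (4 * a)"
  by (simp add: ennreal_mult')

text \<open>By the resolvent identity \<open>exp (t/2) S(t) f\<close> is half the integral of \<open>f\<close> over \<open>[x - t, x + t]\<close> plus a
  Bessel term. The first part is differentiable at a fixed \<open>t\<close> whenever \<open>x - t\<close> and \<open>x + t\<close> are
  Lebesgue points of \<open>f\<close>, hence for almost every \<open>x\<close>. The second part is the primitive of a
  continuous function of time, because convolution with \<open>K\<close> commutes with convolution in time.\<close>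
lemma S_has_time_derivative:
  assumes [measurable]: "f \<in> borel_measurable borel"
    and f0: "\<And>x. 0 \<le> f x" and fM: "\<And>x. f x \<le> M" and int: "integrable lborel f" and t: "0 \<le> t"
  shows "AE x in lborel. ((\<lambda>s. S s f x) has_vector_derivative
      (enn2real (dalembert_mean f (t, x)) + enn2real (conv damped_kernel (dalembert_mean f) (t, x)) / 4
        - S t f x / 2)) (at t within {0..})"
proof -
  let ?G = "\<lambda>y. LINT z:{..y}|lborel. f z"
  let ?A = "dalembert_mean f"
  have A: "?A q \<le> ennreal M * indicator future q" for q
    by (rule dalembert_mean_le[OF f0 fM])
  have KA: "conv damped_kernel ?A q < top" for q
    by (rule conv_damped_kernel_finite[OF A])
  have ae: "AE x in lborel. DERIV ?G (x + t) :> f (x + t)" "AE x in lborel. DERIV ?G (x - t) :> f (x - t)"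
    using AE_lborel_affine[OF AE_DERIV_integral[OF int], of 1 t]
      AE_lborel_affine[OF AE_DERIV_integral[OF int], of 1 "- t"]
    by (simp_all add: add.commute)
  have si: "set_integrable lborel B f" if "B \<in> sets borel" for B
    unfolding set_integrable_def by (rule integrable_mult_indicator[OF _ int]) (simp add: that)
  have wave: "space_conv wave_kernel f (s, x) = ennreal (exp (- s / 2) / 2 * (?G (x + s) - ?G (x - s)))"
    and G_mono: "0 \<le> ?G (x + s) - ?G (x - s)" if "0 \<le> s" for s x
  proof -
    have "AE z in lborel. indicator {..x + s} z * f z
        = indicator {..x - s} z * f z + indicator {x - s..x + s} z * f z"
      using AE_lborel_singleton[of "x - s"]
      by eventually_elim (use that in \<open>auto split: split_indicator\<close>)
    then have "?G (x + s) = (LINT z|lborel. indicator {..x - s} z * f z + indicator {x - s..x + s} z * f z)"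
      unfolding set_lebesgue_integral_def by (intro integral_cong_AE) auto
    also have "\<dots> = ?G (x - s) + (LINT z|lborel. indicator {x - s..x + s} z * f z)"
      using si[of "{..x - s}"] si[of "{x - s..x + s}"]
      unfolding set_lebesgue_integral_def set_integrable_def by simp
    finally have G: "?G (x + s) - ?G (x - s) = (LINT z|lborel. indicator {x - s..x + s} z * f z)"
      by simp
    show "0 \<le> ?G (x + s) - ?G (x - s)"
      unfolding G using f0 by (intro integral_nonneg_AE) auto
    have "space_conv wave_kernel f (s, x)
        = (\<integral>\<^sup>+z. ennreal (exp (- s / 2) / 2) * ennreal (indicator {x - s..x + s} z * f z) \<partial>lborel)"
      unfolding space_conv_def
      by (intro nn_integral_cong) (auto simp: wave_kernel_def light_cone_def abs_le_iff split: split_indicator)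
    also have "\<dots> = ennreal (exp (- s / 2) / 2) * ennreal (?G (x + s) - ?G (x - s))"
      unfolding G using f0 si[of "{x - s..x + s}"]
      by (subst nn_integral_cmult, measurable, subst nn_integral_eq_integral)
         (auto simp: set_integrable_def)
    finally show "space_conv wave_kernel f (s, x) = ennreal (exp (- s / 2) / 2 * (?G (x + s) - ?G (x - s)))"
      by (simp add: ennreal_mult'[symmetric])
  qed
  from ae show ?thesis
  proof eventually_elim
    case (elim x)
    define \<phi> where "\<phi> r = exp (r / 2) * enn2real (conv damped_kernel ?A (r, x))" for r
    have \<phi>_cont: "continuous_on S \<phi>" for S
      unfolding \<phi>_def
      by (intro continuous_intros continuous_on_subset[OF continuous_conv_damped_kernel[OF _ A]]) auto
    have \<phi>0: "0 \<le> \<phi> r" for r by (simp add: \<phi>_def)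
    have [measurable]: "\<phi> \<in> borel_measurable borel"
      by (rule borel_measurable_continuous_onI[OF \<phi>_cont])
    obtain \<Phi> where \<Phi>: "\<And>r. r \<in> {-1..t + 1} \<Longrightarrow> (\<Phi> has_vector_derivative \<phi> r) (at r within {-1..t + 1})"
      using antiderivative_continuous[OF \<phi>_cont] by blast
    have D\<Phi>: "DERIV \<Phi> r :> \<phi> r" if "-1 < r" "r < t + 1" for r
      using \<Phi>[of r] that at_within_interior[of r "{-1..t + 1}"]
      by (simp add: has_real_derivative_iff_has_vector_derivative)
    have S_eq: "S s f x = exp (- s / 2) * ((?G (x + s) - ?G (x - s)) / 2 + (\<Phi> s - \<Phi> 0) / 4)"
      if s: "0 \<le> s" "s < t + 1" for s
    proof -
      have FTC: "(\<integral>\<^sup>+r. ennreal (\<phi> r) * indicator {0..s} r \<partial>lborel) = ennreal (\<Phi> s - \<Phi> 0)"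
        using s by (intro nn_integral_FTC_Icc D\<Phi> \<phi>0) auto
      have \<Phi>_mono: "\<Phi> 0 \<le> \<Phi> s"
      proof (rule DERIV_nonneg_imp_nondecreasing[OF s(1)])
        fix r assume "0 \<le> r" "r \<le> s"
        then show "\<exists>y. DERIV \<Phi> r :> y \<and> 0 \<le> y"
          using D\<Phi>[of r] \<phi>0[of r] s by (intro exI[of _ "\<phi> r"]) auto
      qed
      have "time_conv (conv damped_kernel ?A) (s, x)
          = (\<integral>\<^sup>+r. ennreal (exp (- s / 2)) * (ennreal (\<phi> r) * indicator {0..s} r) \<partial>lborel)"
        unfolding time_conv_def
      proof (rule nn_integral_cong)
        fix r
        show "ennreal (exp (- (fst (s, x) - r) / 2)) * indicator {..fst (s, x)} r
            * conv damped_kernel ?A (r, snd (s, x))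
          = ennreal (exp (- s / 2)) * (ennreal (\<phi> r) * indicator {0..s} r)"
        proof (cases "0 \<le> r")
          case True
          have "exp (- (s - r) / 2) = exp (- s / 2) * exp (r / 2)"
            by (simp add: exp_add[symmetric] field_simps)
          then have e: "ennreal (exp (- (s - r) / 2)) = ennreal (exp (- s / 2)) * ennreal (exp (r / 2))"
            by (simp only: ennreal_mult'[symmetric] exp_ge_zero)
          have "conv damped_kernel ?A (r, x) = ennreal (enn2real (conv damped_kernel ?A (r, x)))"
            using KA[of "(r, x)"] by simp
          then have "ennreal (\<phi> r) = ennreal (exp (r / 2)) * conv damped_kernel ?A (r, x)"
            by (metis \<phi>_def ennreal_mult' exp_ge_zero)
          with True show ?thesis
            unfolding fst_conv snd_conv e by (auto simp: mult.assoc split: split_indicator)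
        next
          case False
          then have "conv damped_kernel ?A (r, x) = 0"
            by (intro conv_past kernels_outside) (auto simp: future_def dalembert_mean_def)
          with False show ?thesis by simp
        qed
      qed
      also have "\<dots> = ennreal (exp (- s / 2) * (\<Phi> s - \<Phi> 0))"
        by (simp add: nn_integral_cmult FTC ennreal_mult')
      finally have tc: "time_conv (conv damped_kernel ?A) (s, x) = ennreal (exp (- s / 2) * (\<Phi> s - \<Phi> 0))" .
      have "4 * space_conv damped_kernel f (s, x)
          = 4 * space_conv wave_kernel f (s, x) + conv damped_kernel (time_conv ?A) (s, x)"
        by (subst space_conv_resolvent) (simp_all add: time_conv_dalembert_mean f0)
      also have "\<dots> = ennreal (4 * (exp (- s / 2) / 2 * (?G (x + s) - ?G (x - s)))
            + exp (- s / 2) * (\<Phi> s - \<Phi> 0))"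
      proof -
        have "0 \<le> 4 * (exp (- s / 2) / 2 * (?G (x + s) - ?G (x - s)))"
          "0 \<le> exp (- s / 2) * (\<Phi> s - \<Phi> 0)"
          using G_mono[OF s(1), of x] \<Phi>_mono by simp_all
        then show ?thesis
          unfolding wave[OF s(1)] four_ennreal by (simp only: conv_time_conv kernels_measurable tc
            dalembert_mean_measurable assms(1) ennreal_plus)
      qed
      also have "\<dots> = 4 * ennreal (exp (- s / 2) * ((?G (x + s) - ?G (x - s)) / 2 + (\<Phi> s - \<Phi> 0) / 4))"
        unfolding four_ennreal by (intro arg_cong[where f = ennreal]) (simp add: field_simps)
      finally have "space_conv damped_kernel f (s, x)
          = ennreal (exp (- s / 2) * ((?G (x + s) - ?G (x - s)) / 2 + (\<Phi> s - \<Phi> 0) / 4))"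
        by (rule ennreal_four_cancel)
      then show ?thesis
        using G_mono[OF s(1), of x] \<Phi>_mono by (simp add: S_eq_space_conv f0 s)
    qed
    have G1: "((\<lambda>s. ?G (x + s)) has_real_derivative f (x + t)) (at t)"
      using DERIV_shift[of ?G "f (x + t)" t x] elim(1) by (simp add: add.commute)
    have G2: "((\<lambda>s. ?G (x - s)) has_real_derivative - f (x - t)) (at t)"
      by (rule DERIV_cong[OF DERIV_chain2[where f = ?G and g = "\<lambda>s. x - s", OF elim(2)]])
         (auto intro!: derivative_eq_intros)
    have gen: "((\<lambda>s. exp (- s / 2) * ((g1 s - g2 s) / 2 + (g3 s - c) / 4)) has_real_derivative
        exp (- t / 2) * ((d1 - d2) / 2 + d3 / 4)
          - exp (- t / 2) * ((g1 t - g2 t) / 2 + (g3 t - c) / 4) / 2) (at t)"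
      if "DERIV g1 t :> d1" "DERIV g2 t :> d2" "DERIV g3 t :> d3"
      for g1 g2 g3 :: "real \<Rightarrow> real" and d1 d2 d3 c
      by (rule derivative_eq_intros that refl | simp add: field_simps)+
    have "((\<lambda>s. exp (- s / 2) * ((?G (x + s) - ?G (x - s)) / 2 + (\<Phi> s - \<Phi> 0) / 4))
       has_real_derivative exp (- t / 2) * ((f (x + t) + f (x - t)) / 2 + \<phi> t / 4) - S t f x / 2) (at t)"
      using gen[OF G1 G2 D\<Phi>[of t], of "\<Phi> 0"] t by (simp add: S_eq)
    moreover have "exp (- t / 2) * ((f (x + t) + f (x - t)) / 2 + \<phi> t / 4)
        = enn2real (?A (t, x)) + enn2real (conv damped_kernel ?A (t, x)) / 4"
    proof -
      have "enn2real (?A (t, x)) = exp (- t / 2) / 2 * (f (x - t) + f (x + t))"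
        using t f0 by (simp add: dalembert_mean_def future_def)
      moreover have "exp (- t / 2) * \<phi> t = enn2real (conv damped_kernel ?A (t, x))"
        unfolding \<phi>_def mult.assoc[symmetric] exp_add[symmetric] by simp
      ultimately show ?thesis by (simp add: algebra_simps)
    qed
    ultimately have "((\<lambda>s. exp (- s / 2) * ((?G (x + s) - ?G (x - s)) / 2 + (\<Phi> s - \<Phi> 0) / 4))
       has_vector_derivative enn2real (?A (t, x)) + enn2real (conv damped_kernel ?A (t, x)) / 4 - S t f x / 2)
       (at t within {0..})"
      by (simp add: has_real_derivative_iff_has_vector_derivative has_vector_derivative_at_within)
    then show ?case
      by (rule has_vector_derivative_transform_within[of _ _ _ _ 1]) (use t in \<open>auto simp: S_eq dist_real_def\<close>)
  qed
qed

text \<open>The d'Alembert solution \<open>g\<close> of \<open>(\<partial>\<^sub>t + 1/2)\<^sup>2 g = \<partial>\<^sub>x\<^sup>2 g\<close> with \<open>g = f\<close> and \<open>(\<partial>\<^sub>t + 1/2) g = h\<close> at \<open>t = 0\<close>.\<close>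
definition linear_wave :: "(real \<Rightarrow> real) \<Rightarrow> (real \<Rightarrow> real) \<Rightarrow> real \<times> real \<Rightarrow> ennreal" where
  "linear_wave f h p = dalembert_mean f p + space_conv wave_kernel h p"

lemma linear_wave_measurable [measurable]:
  assumes [measurable]: "f \<in> borel_measurable borel" "h \<in> borel_measurable borel"
  shows "linear_wave f h \<in> borel_measurable borel"
  unfolding linear_wave_def[abs_def] by measurable

lemma linear_wave_le:
  assumes "\<And>x. 0 \<le> f x" "\<And>x. f x \<le> M" "\<And>x. 0 \<le> h x" "\<And>x. h x \<le> M"
  shows "linear_wave f h p \<le> ennreal (2 * M) * unit_profile p"
proof -
  obtain t x where p: "p = (t, x)" by fastforce
  have M: "0 \<le> M" using assms(1,2) order_trans by blast
  show ?thesis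
  proof (cases "0 \<le> t")
    case True
    have "space_conv wave_kernel h p
        \<le> (\<integral>\<^sup>+z. ennreal (exp (- t / 2) / 2 * M) * indicator {x - t..x + t} z \<partial>lborel)"
      unfolding space_conv_def p
    proof (rule nn_integral_mono)
      fix z
      have "exp (- t / 2) / 2 * h z \<le> exp (- t / 2) / 2 * M"
        using assms(4) by (intro mult_left_mono) auto
      then show "wave_kernel (fst (t, x), snd (t, x) - z) * ennreal (h z)
          \<le> ennreal (exp (- t / 2) / 2 * M) * indicator {x - t..x + t} z"
        by (auto simp: wave_kernel_def light_cone_def abs_le_iff ennreal_mult'[symmetric] ennreal_leI
              split: split_indicator)
    qed
    also have "\<dots> = ennreal (exp (- t / 2) / 2 * M) * ennreal (2 * t)"
      using True by (subst nn_integral_cmult_indicator) simp_all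
    also have "\<dots> = ennreal (exp (- t / 2) * t * M)"
      using True M by (subst ennreal_mult[symmetric]) auto
    finally have 1: "space_conv wave_kernel h p \<le> ennreal (exp (- t / 2) * t * M)" .
    have "exp (- t / 2) / 2 * (f (x - t) + f (x + t)) \<le> exp (- t / 2) / 2 * (M + M)"
      using assms(2) by (intro mult_left_mono add_mono) auto
    then have 2: "dalembert_mean f p \<le> ennreal (exp (- t / 2) * M)"
      using True by (simp add: dalembert_mean_def p future_def ennreal_leI)
    have "linear_wave f h p \<le> ennreal (exp (- t / 2) * M) + ennreal (exp (- t / 2) * t * M)"
      unfolding linear_wave_def by (rule add_mono[OF 2 1])
    also have "\<dots> \<le> ennreal (2 * M * (exp (- t / 2) * (1 + t / 2)))"
      using True M by (subst ennreal_plus[symmetric]) (auto simp: algebra_simps intro!: ennreal_leI)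
    also have "\<dots> = ennreal (2 * M) * unit_profile p"
      using True M by (simp add: unit_profile_def p future_def ennreal_mult)
    finally show ?thesis .
  next
    case False
    then have "wave_kernel (t, x - z) = 0" for z
      by (intro kernels_outside) (auto simp: light_cone_def)
    with False show ?thesis
      by (simp add: p linear_wave_def space_conv_def dalembert_mean_def future_def)
  qed
qed

lemma linear_wave_bounded:
  assumes "\<And>x. 0 \<le> f x" "\<And>x. f x \<le> M" "\<And>x. 0 \<le> h x" "\<And>x. h x \<le> M"
  shows "linear_wave f h p \<le> ennreal (2 * M) * indicator future p"
proof -
  have "linear_wave f h p \<le> ennreal (2 * M) * unit_profile p"
    by (rule linear_wave_le[OF assms])
  also have "unit_profile p \<le> indicator future p"
  proof -
    have "4 * unit_profile p \<le> 4 * indicator future p"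
      by (subst wave_equation_one) simp
    then show ?thesis
      by (subst (asm) ennreal_mult_le_mult_iff) auto
  qed
  finally show ?thesis by (simp add: mult_left_mono)
qed

text \<open>
  The term \<open>- S(t) u\<^sub>0/2\<close> in the time derivative combines with \<open>S(t) (u\<^sub>0 + u\<^sub>1)\<close> to
  \<open>S(t) (u\<^sub>1 + u\<^sub>0/2)\<close>, and the resolvent identity rewrites the sum as \<open>g + 1/4 K * g\<close>.\<close>
lemma linear_flow_eq:
  assumes [measurable]: "f \<in> borel_measurable borel" "h \<in> borel_measurable borel"
    and f0: "\<And>x. 0 \<le> f x" and fM: "\<And>x. f x \<le> M" and h0: "\<And>x. 0 \<le> h x" and hM: "\<And>x. h x \<le> M"
    and int: "integrable lborel f"
    and m: "u0 \<in> borel_measurable lebesgue" "u1 \<in> borel_measurable lebesgue"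
    and u0: "AE x in lebesgue. u0 x = f x" and u1: "AE x in lebesgue. u1 x + u0 x / 2 = h x"
    and t: "0 \<le> t"
  shows "AE x in lebesgue. 0 \<le> S t (\<lambda>y. u0 y + u1 y) x + dt_S t u0 x \<and>
    4 * ennreal (S t (\<lambda>y. u0 y + u1 y) x + dt_S t u0 x)
      = 4 * linear_wave f h (t, x) + conv damped_kernel (linear_wave f h) (t, x)"
proof -
  let ?A = "dalembert_mean f"
  have fl: "f \<in> borel_measurable lebesgue" and hl: "h \<in> borel_measurable lebesgue"
    by (auto intro: measurable_completion)
  have dt: "dt_S t u0 x = vector_derivative (\<lambda>s. S s f x) (at t within {0..})" for x
    unfolding dt_S_def using S_cong_AE[OF m(1) fl u0] by simp
  have S01: "S t (\<lambda>y. u0 y + u1 y) x = S t (\<lambda>y. h y + f y / 2) x" for x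
  proof (rule S_cong_AE)
    show "AE y in lebesgue. u0 y + u1 y = h y + f y / 2"
      using u0 u1 by eventually_elim (simp add: field_simps)
  qed (use m fl hl in auto)
  have add: "S t (\<lambda>y. h y + f y / 2) x = S t h x + S t f x / 2" for x
  proof -
    have "space_conv damped_kernel (\<lambda>y. h y + f y / 2) (t, x)
        = space_conv damped_kernel h (t, x) + ennreal (1/2) * space_conv damped_kernel f (t, x)"
    proof -
      have *: "ennreal (h z + f z / 2) = ennreal (h z) + ennreal (1/2) * ennreal (f z)" for z
        using f0[of z] h0[of z] by (subst ennreal_mult[symmetric]) auto
      show ?thesis
        unfolding space_conv_def *
        by (simp add: distrib_left mult.left_commute nn_integral_add nn_integral_cmult)
    qed
    moreover have "enn2real (a + ennreal (1/2) * b) = enn2real a + enn2real b / 2"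
      if "a < top" "b < top" for a b :: ennreal
    proof -
      have "enn2real (a + ennreal (1/2) * b) = enn2real a + enn2real (ennreal (1/2) * b)"
        using that by (intro enn2real_plus ennreal_mult_less_top[THEN iffD2]) (auto simp only: ennreal_less_top)
      also have "enn2real (ennreal (1/2) * b) = enn2real (ennreal (1/2)) * enn2real b"
        by (rule enn2real_mult)
      also have "enn2real (ennreal (1/2)) = 1/2" by (rule enn2real_ennreal) simp
      finally show ?thesis by simp
    qed
    ultimately show ?thesis
      using space_conv_finite[of h M "(t, x)"] space_conv_finite[of f M "(t, x)"] f0 h0 fM hM t
      by (simp add: S_eq_space_conv)
  qed
  have "at_right t \<le> at t within {0..}"
    using t by (intro at_le) auto
  then have not_bot: "at t within {0..} \<noteq> bot"
    using trivial_limit_at_right_real[of t] by (metis bot.extremum_uniqueI trivial_limit_def)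
  have fin: "conv damped_kernel ?A p < top" "conv damped_kernel (space_conv wave_kernel h) p < top"
    "space_conv wave_kernel h p < top" "?A p < top" for p
  proof -
    have A: "?A q \<le> ennreal M * indicator future q" for q
      by (rule dalembert_mean_le[OF f0 fM])
    then show "conv damped_kernel ?A p < top"
      by (rule conv_damped_kernel_finite)
    have E: "space_conv wave_kernel h q \<le> ennreal (2 * M) * indicator future q" for q
    proof -
      have "space_conv wave_kernel h q \<le> linear_wave f h q"
        by (simp add: linear_wave_def)
      also have "\<dots> \<le> ennreal (2 * M) * indicator future q"
        by (rule linear_wave_bounded[OF f0 fM h0 hM])
      finally show ?thesis .
    qed
    then show "conv damped_kernel (space_conv wave_kernel h) p < top"
      by (rule conv_damped_kernel_finite)
    show "space_conv wave_kernel h p < top"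
      using E[of p] by (rule le_less_trans) (auto simp: ennreal_mult_less_top split: split_indicator)
    show "?A p < top"
      using A[of p] by (rule le_less_trans) (auto simp: ennreal_mult_less_top split: split_indicator)
  qed
  have "AE x in lborel. 0 \<le> S t (\<lambda>y. u0 y + u1 y) x + dt_S t u0 x \<and>
    4 * ennreal (S t (\<lambda>y. u0 y + u1 y) x + dt_S t u0 x)
      = 4 * linear_wave f h (t, x) + conv damped_kernel (linear_wave f h) (t, x)"
    using S_has_time_derivative[OF _ f0 fM int t]
  proof (rule eventually_mono)
    fix x
    let ?a = "enn2real (?A (t, x))" and ?k = "enn2real (conv damped_kernel ?A (t, x))"
    assume "((\<lambda>s. S s f x) has_vector_derivative ?a + ?k / 4 - S t f x / 2) (at t within {0..})"
    then have "dt_S t u0 x = ?a + ?k / 4 - S t f x / 2"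
      unfolding dt by (rule vector_derivative_within[OF not_bot])
    then have sum: "S t (\<lambda>y. u0 y + u1 y) x + dt_S t u0 x = S t h x + ?a + ?k / 4"
      by (simp add: S01 add)
    have Sh: "ennreal (S t h x) = space_conv damped_kernel h (t, x)" "0 \<le> S t h x"
      using space_conv_finite[of h M "(t, x)"] hM by (simp_all add: S_eq_space_conv h0 t)
    have "4 * ennreal (S t h x + ?a + ?k / 4) = 4 * (ennreal (S t h x) + ennreal ?a) + ennreal (4 * (?k / 4))"
      using Sh(2) by (subst ennreal_mult) (simp_all add: ennreal_plus distrib_left)
    also have "\<dots> = (4 * space_conv wave_kernel h (t, x) + conv damped_kernel (space_conv wave_kernel h) (t, x))
         + 4 * ?A (t, x) + conv damped_kernel ?A (t, x)"
      using fin by (simp add: Sh(1) distrib_left space_conv_resolvent)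
    also have "\<dots> = 4 * linear_wave f h (t, x) + conv damped_kernel (linear_wave f h) (t, x)"
      unfolding linear_wave_def[abs_def] by (simp add: conv_add distrib_left ac_simps)
    finally show "0 \<le> S t (\<lambda>y. u0 y + u1 y) x + dt_S t u0 x \<and>
    4 * ennreal (S t (\<lambda>y. u0 y + u1 y) x + dt_S t u0 x)
      = 4 * linear_wave f h (t, x) + conv damped_kernel (linear_wave f h) (t, x)"
      using Sh(2) by (simp add: sum)
  qed measurable
  then show ?thesis by (simp add: AE_completion_iff)
qed

section \<open>The barrier\<close>

text \<open>Duhamel's formula for \<open>E\<close> as an iterated integral: first along characteristics of slope \<open>-1\<close>, then
  along the one of slope \<open>1\<close> that ends at \<open>(t, x)\<close>.\<close>
lemma conv_wave_kernel_characteristics: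
  assumes [measurable]: "F \<in> borel_measurable borel" and past: "\<And>q. q \<notin> future \<Longrightarrow> F q = 0"
  shows "conv wave_kernel F (t, x) = ennreal (exp (- t / 2)) *
    (\<integral>\<^sup>+\<tau>. (\<integral>\<^sup>+\<sigma>. ennreal (exp (\<sigma> / 2)) * F (\<sigma>, x - t + 2 * \<tau> - \<sigma>) * indicator {0..\<tau>} \<sigma> \<partial>lborel)
        * indicator {0..t} \<tau> \<partial>lborel)"
proof -
  have "conv wave_kernel F (t, x)
      = (\<integral>\<^sup>+\<sigma>. \<integral>\<^sup>+y. wave_kernel (t - \<sigma>, x - y) * F (\<sigma>, y) \<partial>lborel \<partial>lborel)"
    by (rule conv_iterated) measurable
  also have "\<dots> = (\<integral>\<^sup>+\<sigma>. \<integral>\<^sup>+\<tau>. ennreal (exp (- t / 2)) * (ennreal (exp (\<sigma> / 2)) * F (\<sigma>, x - t + 2 * \<tau> - \<sigma>)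
        * indicator {0..\<tau>} \<sigma> * indicator {0..t} \<tau>) \<partial>lborel \<partial>lborel)"
  proof (rule nn_integral_cong)
    fix \<sigma>
    have "(\<integral>\<^sup>+y. wave_kernel (t - \<sigma>, x - y) * F (\<sigma>, y) \<partial>lborel)
        = ennreal \<bar>2\<bar> * (\<integral>\<^sup>+\<tau>. wave_kernel (t - \<sigma>, x - ((x - t - \<sigma>) + 2 * \<tau>)) * F (\<sigma>, (x - t - \<sigma>) + 2 * \<tau>) \<partial>lborel)"
      by (rule nn_integral_real_affine) simp_all
    also have "\<dots> = (\<integral>\<^sup>+\<tau>. 2 * (wave_kernel (t - \<sigma>, x - ((x - t - \<sigma>) + 2 * \<tau>)) * F (\<sigma>, (x - t - \<sigma>) + 2 * \<tau>)) \<partial>lborel)"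
      by (simp add: nn_integral_cmult)
    also have "\<dots> = (\<integral>\<^sup>+\<tau>. ennreal (exp (- t / 2)) * (ennreal (exp (\<sigma> / 2)) * F (\<sigma>, x - t + 2 * \<tau> - \<sigma>)
        * indicator {0..\<tau>} \<sigma> * indicator {0..t} \<tau>) \<partial>lborel)"
    proof (rule nn_integral_cong)
      fix \<tau>
      show "2 * (wave_kernel (t - \<sigma>, x - ((x - t - \<sigma>) + 2 * \<tau>)) * F (\<sigma>, (x - t - \<sigma>) + 2 * \<tau>))
         = ennreal (exp (- t / 2)) * (ennreal (exp (\<sigma> / 2)) * F (\<sigma>, x - t + 2 * \<tau> - \<sigma>)
        * indicator {0..\<tau>} \<sigma> * indicator {0..t} \<tau>)"
      proof (cases "0 \<le> \<sigma>")
        case True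
        have a: "(x - t - \<sigma>) + 2 * \<tau> = x - t + 2 * \<tau> - \<sigma>" by simp
        have c: "(t - \<sigma>, x - (x - t + 2 * \<tau> - \<sigma>)) \<in> light_cone \<longleftrightarrow> \<sigma> \<le> \<tau> \<and> \<tau> \<le> t"
          by (auto simp: light_cone_def abs_le_iff)
        have "2 * ennreal (exp (- (t - \<sigma>) / 2) / 2) = ennreal (2 * (exp (- (t - \<sigma>) / 2) / 2))"
          by (simp add: ennreal_mult' del: times_divide_eq_right)
        also have "2 * (exp (- (t - \<sigma>) / 2) / 2) = exp (- t / 2) * exp (\<sigma> / 2)"
          by (simp add: exp_add[symmetric] field_simps)
        finally have "2 * ennreal (exp (- (t - \<sigma>) / 2) / 2) = ennreal (exp (- t / 2)) * ennreal (exp (\<sigma> / 2))"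
          by (simp only: ennreal_mult' exp_ge_zero)
        then show ?thesis
          unfolding a wave_kernel_def using c True
          by (auto simp: mult.assoc[symmetric] split: split_indicator)
      qed (simp add: past future_def)
    qed
    finally show "(\<integral>\<^sup>+y. wave_kernel (t - \<sigma>, x - y) * F (\<sigma>, y) \<partial>lborel) = \<dots>" .
  qed
  also have "\<dots> = (\<integral>\<^sup>+\<tau>. \<integral>\<^sup>+\<sigma>. ennreal (exp (- t / 2)) * (ennreal (exp (\<sigma> / 2)) * F (\<sigma>, x - t + 2 * \<tau> - \<sigma>)
        * indicator {0..\<tau>} \<sigma> * indicator {0..t} \<tau>) \<partial>lborel \<partial>lborel)"
  proof (rule lborel_pair.Fubini'[symmetric])
    have "(\<lambda>(\<sigma>, \<tau>). ennreal (exp (- t / 2)) * (ennreal (exp (\<sigma> / 2)) * F (\<sigma>, x - t + 2 * \<tau> - \<sigma>)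
        * (if 0 \<le> \<sigma> \<and> \<sigma> \<le> \<tau> then 1 else 0) * indicator {0..t} \<tau>)) \<in> borel_measurable (lborel \<Otimes>\<^sub>M lborel)"
      by measurable
    then show "(\<lambda>(\<sigma>, \<tau>). ennreal (exp (- t / 2)) * (ennreal (exp (\<sigma> / 2)) * F (\<sigma>, x - t + 2 * \<tau> - \<sigma>)
        * indicator {0..\<tau>} \<sigma> * indicator {0..t} \<tau>)) \<in> borel_measurable (lborel \<Otimes>\<^sub>M lborel)"
      by (simp add: indicator_def)
  qed
  also have "\<dots> = ennreal (exp (- t / 2)) *
    (\<integral>\<^sup>+\<tau>. (\<integral>\<^sup>+\<sigma>. ennreal (exp (\<sigma> / 2)) * F (\<sigma>, x - t + 2 * \<tau> - \<sigma>) * indicator {0..\<tau>} \<sigma> \<partial>lborel)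
        * indicator {0..t} \<tau> \<partial>lborel)"
  proof -
    have [measurable]: "(\<lambda>\<tau>. \<integral>\<^sup>+\<sigma>. ennreal (exp (\<sigma> / 2)) * F (\<sigma>, x - t + 2 * \<tau> - \<sigma>) * indicator {0..\<tau>} \<sigma> \<partial>lborel)
        \<in> borel_measurable borel"
    proof -
      have "(\<lambda>\<tau>. \<integral>\<^sup>+\<sigma>. ennreal (exp (\<sigma> / 2)) * F (\<sigma>, x - t + 2 * \<tau> - \<sigma>) * (if 0 \<le> \<sigma> \<and> \<sigma> \<le> \<tau> then 1 else 0) \<partial>lborel)
        \<in> borel_measurable borel"
        by measurable
      then show ?thesis by (simp add: indicator_def)
    qed
    show ?thesis
      by (simp add: nn_integral_cmult nn_integral_multc)
  qed
  finally show ?thesis .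
qed

lemma space_conv_wave_kernel_characteristics:
  assumes [measurable]: "h \<in> borel_measurable borel" and "0 \<le> t"
  shows "space_conv wave_kernel h (t, x) = ennreal (exp (- t / 2)) *
    (\<integral>\<^sup>+\<tau>. ennreal (h (x - t + 2 * \<tau>)) * indicator {0..t} \<tau> \<partial>lborel)"
proof -
  have "space_conv wave_kernel h (t, x)
      = ennreal \<bar>2\<bar> * (\<integral>\<^sup>+\<tau>. wave_kernel (t, x - ((x - t) + 2 * \<tau>)) * ennreal (h ((x - t) + 2 * \<tau>)) \<partial>lborel)"
    unfolding space_conv_def fst_conv snd_conv by (rule nn_integral_real_affine) simp_all
  also have "\<dots> = (\<integral>\<^sup>+\<tau>. ennreal (exp (- t / 2)) * (ennreal (h (x - t + 2 * \<tau>)) * indicator {0..t} \<tau>) \<partial>lborel)"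
  proof (subst nn_integral_cmult[symmetric], measurable, rule nn_integral_cong)
    fix \<tau>
    have c: "(t, x - (x - t + 2 * \<tau>)) \<in> light_cone \<longleftrightarrow> 0 \<le> \<tau> \<and> \<tau> \<le> t"
      by (auto simp: light_cone_def abs_le_iff)
    have "ennreal \<bar>2\<bar> * ennreal (exp (- t / 2) / 2) = ennreal (exp (- t / 2))"
      by (subst ennreal_mult[symmetric]) auto
    then show "ennreal \<bar>2\<bar> * (wave_kernel (t, x - (x - t + 2 * \<tau>)) * ennreal (h (x - t + 2 * \<tau>)))
        = ennreal (exp (- t / 2)) * (ennreal (h (x - t + 2 * \<tau>)) * indicator {0..t} \<tau>)"
      unfolding wave_kernel_def using c
      by (auto simp: mult.assoc[symmetric] split: split_indicator)
  qed
  also have "\<dots> = ennreal (exp (- t / 2)) *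
    (\<integral>\<^sup>+\<tau>. ennreal (h (x - t + 2 * \<tau>)) * indicator {0..t} \<tau> \<partial>lborel)"
    by (rule nn_integral_cmult) measurable
  finally show ?thesis .
qed

text \<open>The exponents of the problem; the barrier and all constants depend on them only.\<close>
locale absorption =
  fixes p \<rho> :: real
  assumes p_gt_1: "1 < p" and rho_gt_1: "1 < \<rho>" and rho_less: "\<rho> < 2 / (p - 1)"
begin

definition \<alpha> :: real where "\<alpha> = 1 / (p - 1)"
definition m :: real where "m = \<rho> * (p - 1) / 2"
text \<open>The largest \<open>\<kappa>\<close> for which the error terms in \<open>barrier_supersolution\<close> add up to at most the absorption term.\<close>
definition \<kappa> :: real where "\<kappa> = 1 / (2 * \<alpha> + 4 * \<alpha> * (\<alpha> + 1))"

lemma alpha_pos: "0 < \<alpha>" using p_gt_1 by (simp add: \<alpha>_def)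
lemma alpha_p: "\<alpha> * p = \<alpha> + 1" using p_gt_1 by (simp add: \<alpha>_def field_simps)
lemma m_pos: "0 < m" using p_gt_1 rho_gt_1 by (simp add: m_def)
lemma m_less_1: "m < 1" using p_gt_1 rho_less by (simp add: m_def field_simps)
lemma alpha_p_minus_1: "\<alpha> * (p - 1) = 1" using p_gt_1 by (simp add: \<alpha>_def)
lemma m_alpha: "m * \<alpha> = \<rho> / 2"
  using alpha_p_minus_1 by (simp add: m_def mult.commute mult.left_commute)
lemma kappa_denominator_pos: "0 < 2 * \<alpha> + 4 * \<alpha> * (\<alpha> + 1)"
  using alpha_pos by (intro add_pos_pos mult_pos_pos) auto
lemma kappa_pos: "0 < \<kappa>" using kappa_denominator_pos by (simp add: \<kappa>_def)
lemma kappa_eq: "\<kappa> * (2 * \<alpha> + 4 * \<alpha> * (\<alpha> + 1)) = 1"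
  using kappa_denominator_pos by (simp add: \<kappa>_def)

lemma alpha_kappa_le: "\<alpha> * \<kappa> \<le> 1 / 2"
proof -
  have "0 \<le> \<kappa> * (4 * \<alpha> * (\<alpha> + 1))" using kappa_pos alpha_pos by simp
  then show ?thesis using kappa_eq by (simp add: algebra_simps)
qed

text \<open>The nonlinearity of the wave form.\<close>
definition reaction :: "real \<Rightarrow> real" where "reaction a = a / 4 - a powr p"
text \<open>The maximum point of \<open>reaction\<close>, the solution of \<open>p a\<^sup>p\<^sup>-\<^sup>1 = 1/4\<close>.\<close>
definition threshold :: real where "threshold = (4 * p) powr (- \<alpha>)"

lemma threshold_pos: "0 < threshold"
  using p_gt_1 by (simp add: threshold_def)

lemma powr_p_le:
  assumes "0 \<le> a" "a \<le> threshold"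
  shows "a powr (p - 1) \<le> 1 / (4 * p)"
proof -
  have "a powr (p - 1) \<le> threshold powr (p - 1)"
    using assms p_gt_1 by (intro powr_mono2) auto
  also have "\<dots> = (4 * p) powr (- 1)"
    unfolding threshold_def powr_powr using alpha_p_minus_1 by simp
  also have "\<dots> = 1 / (4 * p)"
    using p_gt_1 by (simp add: powr_minus_divide)
  finally show ?thesis .
qed

lemma reaction_mono:
  assumes "0 \<le> a" "a \<le> b" "b \<le> threshold"
  shows "reaction a \<le> reaction b"
proof (rule DERIV_nonneg_imp_increasing_open[OF assms(2)])
  fix z assume z: "a < z" "z < b"
  then have z0: "0 < z" using assms by simp
  have "DERIV reaction z :> 1 / 4 - p * z powr (p - 1)"
    unfolding reaction_def[abs_def] using z0
    by (auto intro!: derivative_eq_intros simp: powr_diff)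
  moreover have "p * z powr (p - 1) \<le> 1 / 4"
  proof -
    have "p * z powr (p - 1) \<le> p * (1 / (4 * p))"
      using powr_p_le[of z] z z0 assms p_gt_1 by (intro mult_left_mono) auto
    then show ?thesis using p_gt_1 by simp
  qed
  ultimately show "\<exists>y. DERIV reaction z :> y \<and> 0 \<le> y"
    by (intro exI[of _ "1 / 4 - p * z powr (p - 1)"]) simp
next
  show "continuous_on {a..b} reaction"
    unfolding reaction_def[abs_def] using assms p_gt_1
    by (intro continuous_intros continuous_on_powr') auto
qed

lemma reaction_nonneg: "0 \<le> a \<Longrightarrow> a \<le> threshold \<Longrightarrow> 0 \<le> reaction a"
  using reaction_mono[of 0 a] p_gt_1 by (simp add: reaction_def)

lemma reaction_le: "reaction a \<le> a / 4"
  by (simp add: reaction_def)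

text \<open>Monotonicity settles \<open>a \<le> b\<close>. For \<open>a > b\<close> the term \<open>- a\<^sup>p\<close> helps, and what remains is the linear part.\<close>
lemma reaction_diff_le:
  assumes "0 \<le> a" "0 \<le> b" "a \<le> threshold" "b \<le> threshold"
  shows "reaction a \<le> reaction b + max 0 (a - b) / 4"
proof (cases "a \<le> b")
  case True
  then show ?thesis using reaction_mono[of a b] assms by simp
next
  case False
  then have "b powr p \<le> a powr p"
    using assms p_gt_1 by (intro powr_mono2) auto
  with False show ?thesis
    by (simp add: reaction_def max_def field_simps)
qed

lemma reaction_measurable [measurable]: "reaction \<in> borel_measurable borel"
  unfolding reaction_def[abs_def] by measurable

definition weight :: "real \<Rightarrow> real" where "weight x = (1 + x\<^sup>2) powr m"
definition weight' :: "real \<Rightarrow> real" where "weight' x = 2 * m * x * (1 + x\<^sup>2) powr (m - 1)"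
definition weight'' :: "real \<Rightarrow> real" where
  "weight'' x = 2 * m * (1 + x\<^sup>2) powr (m - 1) + 4 * m * (m - 1) * x\<^sup>2 * (1 + x\<^sup>2) powr (m - 2)"

lemma one_plus_square_pos: "0 < 1 + (x::real)\<^sup>2"
  by (simp add: add_pos_nonneg)

lemma weight_DERIV: "DERIV weight x :> weight' x"
  unfolding weight_def[abs_def] weight'_def using one_plus_square_pos[of x]
  by (auto intro!: derivative_eq_intros simp: powr_diff field_simps)

lemma weight'_DERIV: "DERIV weight' x :> weight'' x"
proof -
  have "DERIV (\<lambda>x. 1 + x\<^sup>2) x :> 2 * x"
    by (auto intro!: derivative_eq_intros)
  then have "DERIV (\<lambda>x. (1 + x\<^sup>2) powr (m - 1)) x :> (m - 1) * (1 + x\<^sup>2) powr (m - 1 - of_nat 1) * (2 * x)"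
    using one_plus_square_pos by (rule DERIV_fun_powr)
  moreover have "DERIV (\<lambda>x. 2 * m * x) x :> 2 * m"
    by (auto intro!: derivative_eq_intros)
  ultimately have "DERIV weight' x :> 2 * m * (1 + x\<^sup>2) powr (m - 1)
      + (m - 1) * (1 + x\<^sup>2) powr (m - 1 - of_nat 1) * (2 * x) * (2 * m * x)"
    unfolding weight'_def[abs_def] by (rule DERIV_mult[rotated])
  then show ?thesis
    by (rule DERIV_cong) (simp add: weight''_def power2_eq_square algebra_simps)
qed

lemma weight_ge_1: "1 \<le> weight x"
  unfolding weight_def using m_pos by (intro ge_one_powr_ge_zero) auto

lemma weight''_ge: "- 1 \<le> weight'' x"
proof -
  let ?s = "1 + x\<^sup>2"
  have s: "1 \<le> ?s" "0 < ?s" by (auto simp: one_plus_square_pos)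
  have e: "?s powr (m - 2) = ?s powr (m - 1) / ?s"
    using s powr_diff[of ?s "m - 1" 1] by simp
  have y: "0 \<le> ?s powr (m - 1)" "?s powr (m - 1) \<le> 1"
    using s m_less_1 powr_mono[of "m - 1" 0 ?s] by auto
  have r: "0 \<le> x\<^sup>2 / ?s" "x\<^sup>2 / ?s \<le> 1" using s by auto
  have c: "4 * m * (1 - m) \<le> 1"
    using zero_le_power2[of "2 * m - 1"] by (simp add: power2_eq_square algebra_simps)
  have c0: "0 \<le> 4 * m * (1 - m)" using m_pos m_less_1 by simp
  have "4 * m * (1 - m) * (x\<^sup>2 / ?s) * ?s powr (m - 1) \<le> 1 * 1 * 1"
    using c c0 r y by (intro mult_mono) auto
  moreover have "weight'' x = 2 * m * ?s powr (m - 1) - 4 * m * (1 - m) * (x\<^sup>2 / ?s) * ?s powr (m - 1)"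
    unfolding weight''_def e by (simp add: algebra_simps)
  moreover have "0 \<le> 2 * m * ?s powr (m - 1)" using m_pos y by simp
  ultimately show ?thesis by linarith
qed

text \<open>Here \<open>m \<le> 1\<close> enters: the weight grows at most quadratically.\<close>
lemma weight'_square_le: "(weight' x)\<^sup>2 \<le> 4 * weight x"
proof -
  let ?s = "1 + x\<^sup>2"
  have s: "1 \<le> ?s" "0 < ?s" by (auto simp: one_plus_square_pos)
  have "(weight' x)\<^sup>2 = 4 * m\<^sup>2 * (x\<^sup>2 * (?s powr (m - 1) * ?s powr (m - 1)))"
    by (simp add: weight'_def power2_eq_square)
  also have "?s powr (m - 1) * ?s powr (m - 1) = weight x * (?s powr (m - 1) / ?s)"
    using s by (simp add: weight_def powr_diff)
  also have "4 * m\<^sup>2 * (x\<^sup>2 * (weight x * (?s powr (m - 1) / ?s)))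
      = (4 * m\<^sup>2) * ((x\<^sup>2 / ?s) * ?s powr (m - 1)) * weight x"
    by simp
  also have "\<dots> \<le> (4 * 1) * (1 * 1) * weight x"
    using s m_pos m_less_1 powr_mono[of "m - 1" 0 ?s] weight_ge_1[of x]
    by (intro mult_mono) (auto simp: power_le_one)
  finally show ?thesis by simp
qed

lemma weight_measurable [measurable]:
  "weight \<in> borel_measurable borel" "weight' \<in> borel_measurable borel"
  "weight'' \<in> borel_measurable borel"
  unfolding weight_def[abs_def] weight'_def[abs_def] weight''_def[abs_def] by measurable

definition barrier_base :: "real \<Rightarrow> real \<Rightarrow> real" where
  "barrier_base t x = \<kappa> * (weight x + t) + 4 * p"

definition barrier :: "real \<Rightarrow> real \<Rightarrow> real" where
  "barrier t x = barrier_base t x powr (- \<alpha>)"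

lemma barrier_base_ge:
  assumes "0 \<le> t"
  shows "4 * p \<le> barrier_base t x" "\<kappa> * weight x \<le> barrier_base t x" "0 < barrier_base t x"
proof -
  have "0 \<le> \<kappa> * weight x" "0 \<le> \<kappa> * t"
    using kappa_pos weight_ge_1[of x] assms by auto
  then show "4 * p \<le> barrier_base t x" "\<kappa> * weight x \<le> barrier_base t x" "0 < barrier_base t x"
    using p_gt_1 by (auto simp: barrier_base_def distrib_left)
qed

lemma barrier_pos: "0 \<le> t \<Longrightarrow> 0 < barrier t x"
  using barrier_base_ge(3)[of t x] by (simp add: barrier_def)

lemma barrier_le_threshold: "0 \<le> t \<Longrightarrow> barrier t x \<le> threshold"
  unfolding barrier_def threshold_def using barrier_base_ge(1)[of t x] p_gt_1 alpha_pos
  by (intro powr_mono2') auto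

text \<open>Since \<open>\<alpha> p = \<alpha> + 1\<close>.\<close>
lemma barrier_powr_p:
  assumes "0 \<le> t"
  shows "barrier t x powr p = barrier t x / barrier_base t x"
proof -
  have "barrier t x powr p = barrier_base t x powr (- \<alpha> - 1)"
    using alpha_p by (simp add: barrier_def powr_powr)
  also have "\<dots> = barrier t x / barrier_base t x"
    using barrier_base_ge(3)[OF assms, of x] by (simp add: barrier_def powr_diff)
  finally show ?thesis .
qed

lemma barrier_measurable [measurable]:
  "(\<lambda>q. barrier_base (fst q) (snd q)) \<in> borel_measurable borel"
  "(\<lambda>q. barrier (fst q) (snd q)) \<in> borel_measurable borel"
  unfolding barrier_def[abs_def] barrier_base_def[abs_def] by measurable

text \<open>This is \<open>(\<partial>\<^sub>t + \<partial>\<^sub>x) (exp (t / 2) * barrier t x)\<close>.\<close>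
definition barrier_slope :: "real \<Rightarrow> real \<Rightarrow> real" where
  "barrier_slope t x = exp (t / 2) *
     (barrier t x / 2 - \<alpha> * \<kappa> * (1 + weight' x) * barrier t x / barrier_base t x)"

text \<open>This is \<open>(\<partial>\<^sub>t - \<partial>\<^sub>x) (\<partial>\<^sub>t + \<partial>\<^sub>x) (exp (t / 2) * barrier t x)\<close>.\<close>
definition barrier_box :: "real \<Rightarrow> real \<Rightarrow> real" where
  "barrier_box t x = exp (t / 2) * (barrier t x / 4 - \<alpha> * \<kappa> * barrier t x / barrier_base t x
     + \<alpha> * \<kappa> * weight'' x * barrier t x / barrier_base t x
     + \<alpha> * (\<alpha> + 1) * \<kappa>\<^sup>2 * (1 - (weight' x)\<^sup>2) * barrier t x / (barrier_base t x)\<^sup>2)"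

lemma DERIV_powr_neg_alpha:
  assumes "DERIV g s :> g'" "0 < g s"
  shows "DERIV (\<lambda>s. g s powr (- \<alpha>)) s :> - \<alpha> * g' * g s powr (- \<alpha>) / g s"
  using assms by (auto intro!: derivative_eq_intros simp: powr_diff powr_minus_divide)

lemma barrier_DERIV_forward:
  assumes "0 \<le> \<tau>"
  shows "DERIV (\<lambda>\<tau>. exp (\<tau> / 2) * barrier \<tau> (\<xi> + \<tau>)) \<tau> :> barrier_slope \<tau> (\<xi> + \<tau>)"
proof -
  have "DERIV (\<lambda>\<tau>. weight (\<xi> + \<tau>)) \<tau> :> weight' (\<xi> + \<tau>)"
    by (rule DERIV_cong[OF DERIV_chain2[where f = weight and g = "\<lambda>\<tau>. \<xi> + \<tau>", OF weight_DERIV]])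
       (auto intro!: derivative_eq_intros)
  then have b: "DERIV (\<lambda>\<tau>. barrier_base \<tau> (\<xi> + \<tau>)) \<tau> :> \<kappa> * (weight' (\<xi> + \<tau>) + 1)"
    unfolding barrier_base_def by (auto intro!: derivative_eq_intros)
  have w: "DERIV (\<lambda>\<tau>. barrier \<tau> (\<xi> + \<tau>)) \<tau> :>
      - \<alpha> * (\<kappa> * (weight' (\<xi> + \<tau>) + 1)) * barrier \<tau> (\<xi> + \<tau>) / barrier_base \<tau> (\<xi> + \<tau>)"
    unfolding barrier_def by (rule DERIV_powr_neg_alpha[OF b barrier_base_ge(3)[OF assms]])
  have e: "DERIV (\<lambda>\<tau>. exp (\<tau> / 2)) \<tau> :> exp (\<tau> / 2) / 2" for \<tau> :: real
    by (auto intro!: derivative_eq_intros)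
  show ?thesis
    by (rule DERIV_cong[OF DERIV_mult[OF e w]])
       (use barrier_base_ge(3)[OF assms, of "\<xi> + \<tau>"] in \<open>simp add: barrier_slope_def field_simps\<close>)
qed

lemma barrier_DERIV_backward:
  assumes "0 \<le> \<sigma>"
  shows "DERIV (\<lambda>\<sigma>. barrier_slope \<sigma> (b - \<sigma>)) \<sigma> :> barrier_box \<sigma> (b - \<sigma>)"
proof -
  let ?x = "b - \<sigma>" 
  let ?g = "barrier_base \<sigma> ?x" and ?y = "barrier \<sigma> ?x"
  have g0: "0 < ?g" by (rule barrier_base_ge(3)[OF assms])
  have "DERIV (\<lambda>\<sigma>. weight (b - \<sigma>)) \<sigma> :> - weight' ?x"
    by (rule DERIV_cong[OF DERIV_chain2[where f = weight and g = "\<lambda>\<sigma>. b - \<sigma>", OF weight_DERIV]])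
       (auto intro!: derivative_eq_intros)
  then have b: "DERIV (\<lambda>\<sigma>. barrier_base \<sigma> (b - \<sigma>)) \<sigma> :> \<kappa> * (1 - weight' ?x)"
    unfolding barrier_base_def by (auto intro!: derivative_eq_intros simp: algebra_simps)
  have w: "DERIV (\<lambda>\<sigma>. barrier \<sigma> (b - \<sigma>)) \<sigma> :> - \<alpha> * (\<kappa> * (1 - weight' ?x)) * ?y / ?g"
    unfolding barrier_def by (rule DERIV_powr_neg_alpha[OF b g0])
  have w': "DERIV (\<lambda>\<sigma>. weight' (b - \<sigma>)) \<sigma> :> - weight'' ?x"
    by (rule DERIV_cong[OF DERIV_chain2[where f = weight' and g = "\<lambda>\<sigma>. b - \<sigma>", OF weight'_DERIV]])
       (auto intro!: derivative_eq_intros)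
  have gen: "DERIV (\<lambda>s. exp (s / 2) * (Y s / 2 - a * (1 + H s) * Y s / G s)) s
     :> exp (s / 2) * (Y s / 4 - a * (1 + H s) * Y s / G s / 2 + Y' / 2 - a * H' * Y s / G s
          - a * (1 + H s) * Y' / G s + a * (1 + H s) * Y s * G' / (G s)\<^sup>2)"
    if "DERIV Y s :> Y'" "DERIV G s :> G'" "DERIV H s :> H'" "G s \<noteq> 0"
    for Y G H :: "real \<Rightarrow> real" and Y' G' H' a s
    by (rule derivative_eq_intros that refl | simp add: that)+
       (simp add: that field_simps power2_eq_square)
  have "exp (\<sigma> / 2) * (?y / 4 - \<alpha> * \<kappa> * (1 + weight' ?x) * ?y / ?g / 2
        + (- \<alpha> * (\<kappa> * (1 - weight' ?x)) * ?y / ?g) / 2 - \<alpha> * \<kappa> * (- weight'' ?x) * ?y / ?g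
        - \<alpha> * \<kappa> * (1 + weight' ?x) * (- \<alpha> * (\<kappa> * (1 - weight' ?x)) * ?y / ?g) / ?g
        + \<alpha> * \<kappa> * (1 + weight' ?x) * ?y * (\<kappa> * (1 - weight' ?x)) / ?g\<^sup>2)
      = barrier_box \<sigma> ?x"
    unfolding barrier_box_def using g0 by (simp add: field_simps power2_eq_square)
  then show ?thesis
    unfolding barrier_slope_def by (intro DERIV_cong[OF gen[OF w b w']]) (use g0 in simp_all)
qed

end

context absorption begin

lemma reaction_barrier:
  "0 \<le> t \<Longrightarrow> reaction (barrier t x) = barrier t x / 4 - barrier t x / barrier_base t x"
  by (simp add: reaction_def barrier_powr_p)

text \<open>After division by \<open>barrier / barrier_base\<close> the absorption contributes \<open>1\<close>. The time derivative
  costs \<open>\<alpha> \<kappa>\<close>, the second space derivative costs \<open>\<alpha> \<kappa>\<close> through \<open>weight''\<close>, and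
  \<open>4 \<alpha> (\<alpha> + 1) \<kappa>\<close> through \<open>(weight')\<^sup>2\<close>.\<close>
lemma barrier_supersolution:
  assumes t: "0 \<le> t"
  shows "exp (t / 2) * reaction (barrier t x) \<le> barrier_box t x"
proof -
  let ?g = "barrier_base t x" and ?y = "barrier t x" and ?h = "weight' x"
  have g0: "0 < ?g" and y0: "0 < ?y"
    by (rule barrier_base_ge(3)[OF t] barrier_pos[OF t])+
  have "\<kappa>\<^sup>2 * ?h\<^sup>2 \<le> \<kappa> * (4 * (\<kappa> * weight x))"
    using mult_left_mono[OF weight'_square_le[of x], of "\<kappa>\<^sup>2"] by (simp add: power2_eq_square mult_ac)
  also have "\<dots> \<le> \<kappa> * (4 * ?g)"
    using barrier_base_ge(2)[OF t, of x] kappa_pos by (intro mult_left_mono) auto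
  finally have "\<kappa>\<^sup>2 * ?h\<^sup>2 / ?g \<le> 4 * \<kappa>"
    using g0 by (simp add: field_simps)
  moreover have "0 \<le> \<kappa>\<^sup>2 / ?g" using g0 by simp
  ultimately have "- (4 * \<kappa>) \<le> \<kappa>\<^sup>2 * (1 - ?h\<^sup>2) / ?g"
    by (simp add: right_diff_distrib diff_divide_distrib)
  then have 1: "\<alpha> * (\<alpha> + 1) * (- (4 * \<kappa>)) \<le> \<alpha> * (\<alpha> + 1) * (\<kappa>\<^sup>2 * (1 - ?h\<^sup>2) / ?g)"
    using alpha_pos by (intro mult_left_mono) auto
  have 2: "\<alpha> * \<kappa> * (- 1) \<le> \<alpha> * \<kappa> * weight'' x"
    using alpha_pos kappa_pos weight''_ge by (intro mult_left_mono) auto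
  have "0 \<le> 1 - \<alpha> * \<kappa> + \<alpha> * \<kappa> * weight'' x + \<alpha> * (\<alpha> + 1) * (\<kappa>\<^sup>2 * (1 - ?h\<^sup>2) / ?g)"
    using 1 2 kappa_eq by (simp add: algebra_simps)
  then have "0 \<le> ?y / ?g * (1 - \<alpha> * \<kappa> + \<alpha> * \<kappa> * weight'' x + \<alpha> * (\<alpha> + 1) * (\<kappa>\<^sup>2 * (1 - ?h\<^sup>2) / ?g))"
    using g0 y0 by (intro mult_nonneg_nonneg) auto
  also have "\<dots> = (?y / 4 - \<alpha> * \<kappa> * ?y / ?g + \<alpha> * \<kappa> * weight'' x * ?y / ?g
     + \<alpha> * (\<alpha> + 1) * \<kappa>\<^sup>2 * (1 - ?h\<^sup>2) * ?y / ?g\<^sup>2) - (?y / 4 - ?y / ?g)"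
    using g0 by (simp add: field_simps power2_eq_square)
  finally show ?thesis
    unfolding barrier_box_def reaction_barrier[OF t] by (intro mult_left_mono) simp_all
qed

text \<open>This is \<open>\<partial>\<^sub>t (exp (t / 2) * barrier t x)\<close> at \<open>t = 0\<close>.\<close>
definition barrier_velocity :: "real \<Rightarrow> real" where
  "barrier_velocity x = barrier 0 x / 2 - \<alpha> * \<kappa> * barrier 0 x / barrier_base 0 x"

lemma barrier_velocity_ge: "barrier 0 x / 4 \<le> barrier_velocity x"
proof -
  have g: "4 \<le> barrier_base 0 x" using barrier_base_ge(1)[of 0 x] p_gt_1 by simp
  have "\<alpha> * \<kappa> / barrier_base 0 x \<le> (1/2) / 2"
    using g alpha_kappa_le alpha_pos kappa_pos by (intro frac_le) auto
  then have "barrier 0 x * (\<alpha> * \<kappa> / barrier_base 0 x) \<le> barrier 0 x * (1/4)"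
    using barrier_pos[of 0 x] by (intro mult_left_mono) auto
  then show ?thesis by (simp add: barrier_velocity_def mult_ac)
qed

text \<open>At \<open>t = 0\<close> the barrier is at least \<open>4 \<epsilon>\<^sub>0\<close> times \<open>\<langle>x\<rangle> powr -\<rho>\<close>, and its velocity is smaller
  by at most a factor 4.\<close>
definition \<epsilon>\<^sub>0 :: real where "\<epsilon>\<^sub>0 = (\<kappa> + 4 * p) powr (- \<alpha>) / 4"

lemma eps0_pos: "0 < \<epsilon>\<^sub>0"
  using kappa_pos p_gt_1 by (simp add: \<epsilon>\<^sub>0_def)

lemma eps0_threshold: "2 * \<epsilon>\<^sub>0 \<le> threshold"
proof -
  have "(\<kappa> + 4 * p) powr (- \<alpha>) \<le> threshold"
    unfolding threshold_def using kappa_pos p_gt_1 alpha_pos by (intro powr_mono2') auto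
  then show ?thesis using threshold_pos by (simp add: \<epsilon>\<^sub>0_def)
qed

lemma initial_data_le_barrier:
  assumes "0 < \<epsilon>" "\<epsilon> \<le> \<epsilon>\<^sub>0"
  shows "\<epsilon> * japanese_bracket x powr (- \<rho>) \<le> barrier 0 x / 4"
proof -
  have j: "japanese_bracket x powr (- \<rho>) = weight x powr (- \<alpha>)"
    by (simp add: japanese_bracket_def weight_def powr_powr m_alpha)
  have "(\<kappa> + 4 * p) powr (- \<alpha>) * weight x powr (- \<alpha>) = ((\<kappa> + 4 * p) * weight x) powr (- \<alpha>)"
    using kappa_pos p_gt_1 weight_ge_1[of x] by (simp add: powr_mult)
  also have "\<dots> \<le> barrier 0 x"
    unfolding barrier_def
  proof (rule powr_mono2')
    have "4 * p * 1 \<le> 4 * p * weight x"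
      using p_gt_1 weight_ge_1[of x] by (intro mult_left_mono) auto
    then show "barrier_base 0 x \<le> (\<kappa> + 4 * p) * weight x"
      by (simp add: barrier_base_def algebra_simps)
  qed (use alpha_pos barrier_base_ge(3)[of 0 x] in auto)
  finally have "\<epsilon>\<^sub>0 * weight x powr (- \<alpha>) \<le> barrier 0 x / 4"
    by (simp add: \<epsilon>\<^sub>0_def)
  moreover have "\<epsilon> * weight x powr (- \<alpha>) \<le> \<epsilon>\<^sub>0 * weight x powr (- \<alpha>)"
    using assms by (intro mult_right_mono) auto
  ultimately show ?thesis by (simp add: j)
qed

lemma barrier_box_measurable [measurable]:
  "(\<lambda>q. barrier_box (fst q) (snd q)) \<in> borel_measurable borel"
  "(\<lambda>q. barrier_slope (fst q) (snd q)) \<in> borel_measurable borel"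
  unfolding barrier_box_def[abs_def] barrier_slope_def[abs_def] by measurable

text \<open>D'Alembert's formula for \<open>exp (t/2) w\<close> as an inequality. Along a backward characteristic the
  supersolution property bounds the increments of \<open>barrier_slope\<close> from below by the reaction term;
  integration along the forward characteristic then recovers \<open>exp (t/2) w\<close>.\<close>
lemma barrier_dominates:
  assumes [measurable]: "f \<in> borel_measurable borel" "h \<in> borel_measurable borel"
    and f0: "\<And>x. 0 \<le> f x" and h0: "\<And>x. 0 \<le> h x"
    and f: "\<And>x. f x \<le> barrier 0 x" and h: "\<And>x. h x \<le> barrier_velocity x" and t: "0 \<le> t"
  shows "linear_wave f h (t, x)
      + conv wave_kernel (\<lambda>q. ennreal (reaction (barrier (fst q) (snd q))) * indicator future q) (t, x)
    \<le> ennreal (barrier t x)"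
proof -
  define \<xi> where "\<xi> = x - t"
  define F where "F q = ennreal (reaction (barrier (fst q) (snd q))) * indicator future q" for q
  have [measurable]: "F \<in> borel_measurable borel"
    unfolding F_def by measurable
  define J where "J \<tau> = (\<integral>\<^sup>+\<sigma>. ennreal (exp (\<sigma> / 2)) * F (\<sigma>, x - t + 2 * \<tau> - \<sigma>) * indicator {0..\<tau>} \<sigma> \<partial>lborel)" for \<tau>
  have J_meas [measurable]: "J \<in> borel_measurable borel"
  proof -
    have "(\<lambda>\<tau>. \<integral>\<^sup>+\<sigma>. ennreal (exp (\<sigma> / 2)) * F (\<sigma>, x - t + 2 * \<tau> - \<sigma>) * (if 0 \<le> \<sigma> \<and> \<sigma> \<le> \<tau> then 1 else 0) \<partial>lborel)
      \<in> borel_measurable borel"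
      by measurable
    then show ?thesis by (simp add: indicator_def J_def[abs_def])
  qed
  define V where "V \<tau> = exp (\<tau> / 2) * barrier \<tau> (\<xi> + \<tau>)" for \<tau>
  \<comment> \<open>Subtracting half of the initial barrier accounts for the space derivative in
    \<open>barrier_slope 0\<close>; only the velocity of the barrier is left to be compared with \<open>h\<close>.\<close>
  define W where "W \<tau> = V \<tau> - barrier 0 (\<xi> + 2 * \<tau>) / 2" for \<tau>
  define d where "d \<tau> = barrier_slope \<tau> (\<xi> + \<tau>) - barrier_slope 0 (\<xi> + 2 * \<tau>) + barrier_velocity (\<xi> + 2 * \<tau>)" for \<tau>
  have J_le: "J \<tau> \<le> ennreal (barrier_slope \<tau> (\<xi> + \<tau>) - barrier_slope 0 (\<xi> + 2 * \<tau>))"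
    and d0: "0 \<le> barrier_slope \<tau> (\<xi> + \<tau>) - barrier_slope 0 (\<xi> + 2 * \<tau>)"
    if \<tau>: "0 \<le> \<tau>" for \<tau>
  proof -
    let ?b = "\<xi> + 2 * \<tau>"
    have r0: "0 \<le> exp (\<sigma> / 2) * reaction (barrier \<sigma> (?b - \<sigma>))" if "0 \<le> \<sigma>" for \<sigma>
      using that by (intro mult_nonneg_nonneg reaction_nonneg barrier_le_threshold less_imp_le[OF barrier_pos]) auto
    then have box0: "0 \<le> barrier_box \<sigma> (?b - \<sigma>)" if "0 \<le> \<sigma>" for \<sigma>
      using barrier_supersolution[OF that, of "?b - \<sigma>"] that by (meson order_trans)
    have [measurable]: "(\<lambda>\<sigma>. barrier_box \<sigma> (?b - \<sigma>)) \<in> borel_measurable borel"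
      using measurable_compose[of "\<lambda>\<sigma>. (\<sigma>, ?b - \<sigma>)" borel borel, OF _ barrier_box_measurable(1)] by simp
    have "J \<tau> \<le> (\<integral>\<^sup>+\<sigma>. ennreal (barrier_box \<sigma> (?b - \<sigma>)) * indicator {0..\<tau>} \<sigma> \<partial>lborel)"
      unfolding J_def
    proof (rule nn_integral_mono)
      fix \<sigma>
      show "ennreal (exp (\<sigma> / 2)) * F (\<sigma>, x - t + 2 * \<tau> - \<sigma>) * indicator {0..\<tau>} \<sigma>
          \<le> ennreal (barrier_box \<sigma> (?b - \<sigma>)) * indicator {0..\<tau>} \<sigma>"
        using barrier_supersolution[of \<sigma> "?b - \<sigma>"]
        by (auto simp: F_def future_def \<xi>_def ennreal_mult'[symmetric] intro!: ennreal_leI split: split_indicator)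
    qed
    also have "\<dots> = ennreal (barrier_slope \<tau> (?b - \<tau>) - barrier_slope 0 (?b - 0))"
      using \<tau> by (intro nn_integral_FTC_Icc barrier_DERIV_backward box0) auto
    also have "?b - \<tau> = \<xi> + \<tau>" by simp
    finally show "J \<tau> \<le> ennreal (barrier_slope \<tau> (\<xi> + \<tau>) - barrier_slope 0 (\<xi> + 2 * \<tau>))" by simp
    have "barrier_slope 0 (?b - 0) \<le> barrier_slope \<tau> (?b - \<tau>)"
    proof (rule DERIV_nonneg_imp_nondecreasing[OF \<tau>, of "\<lambda>\<sigma>. barrier_slope \<sigma> (?b - \<sigma>)"])
      fix \<sigma> assume "0 \<le> \<sigma>" "\<sigma> \<le> \<tau>"
      then show "\<exists>y. DERIV (\<lambda>\<sigma>. barrier_slope \<sigma> (?b - \<sigma>)) \<sigma> :> y \<and> 0 \<le> y"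
        using barrier_DERIV_backward box0 by blast
    qed
    then show "0 \<le> barrier_slope \<tau> (\<xi> + \<tau>) - barrier_slope 0 (\<xi> + 2 * \<tau>)"
      by (simp add: add.commute)
  qed
  have v0: "0 \<le> barrier_velocity y" for y
    using h0[of y] h[of y] by simp
  have DW: "DERIV W \<tau> :> d \<tau>" if "0 \<le> \<tau>" for \<tau>
  proof -
    have "DERIV (\<lambda>y. barrier 0 y) y :> - \<alpha> * (\<kappa> * weight' y) * barrier 0 y / barrier_base 0 y" for y
      unfolding barrier_def
      by (rule DERIV_powr_neg_alpha)
         (use barrier_base_ge(3)[of 0 y] in
           \<open>auto simp: barrier_base_def[abs_def] intro!: derivative_eq_intros weight_DERIV\<close>)
    then have "DERIV (\<lambda>\<tau>. barrier 0 (\<xi> + 2 * \<tau>)) \<tau>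
        :> (- \<alpha> * (\<kappa> * weight' (\<xi> + 2 * \<tau>)) * barrier 0 (\<xi> + 2 * \<tau>) / barrier_base 0 (\<xi> + 2 * \<tau>)) * 2"
      by (rule DERIV_chain2) (auto intro!: derivative_eq_intros)
    from DERIV_diff[OF barrier_DERIV_forward[OF that, of \<xi>] DERIV_cdivide[OF this, of 2]]
    show ?thesis
      unfolding W_def V_def
      by (rule DERIV_cong)
         (use barrier_base_ge(3)[of 0 "\<xi> + 2 * \<tau>"] in
           \<open>simp add: d_def barrier_slope_def[of 0] barrier_velocity_def field_simps\<close>)
  qed
  have [measurable]: "d \<in> borel_measurable borel"
  proof -
    have "(\<lambda>\<tau>. (\<tau>, \<xi> + \<tau>)) \<in> borel \<rightarrow>\<^sub>M borel" "(\<lambda>\<tau>. (0 :: real, \<xi> + 2 * \<tau>)) \<in> borel \<rightarrow>\<^sub>M borel"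
      by (intro borel_measurable_continuous_onI continuous_intros)+
    from measurable_compose[OF this(1) barrier_box_measurable(2)]
      measurable_compose[OF this(2) barrier_box_measurable(2)]
      measurable_compose[OF this(2) barrier_measurable(1)]
      measurable_compose[OF this(2) barrier_measurable(2)]
    have [measurable]: "(\<lambda>\<tau>. barrier_slope \<tau> (\<xi> + \<tau>)) \<in> borel_measurable borel"
      "(\<lambda>\<tau>. barrier_slope 0 (\<xi> + 2 * \<tau>)) \<in> borel_measurable borel"
      "(\<lambda>\<tau>. barrier_base 0 (\<xi> + 2 * \<tau>)) \<in> borel_measurable borel"
      "(\<lambda>\<tau>. barrier 0 (\<xi> + 2 * \<tau>)) \<in> borel_measurable borel"
      by simp_all
    show ?thesis
      unfolding d_def[abs_def] barrier_velocity_def by measurable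
  qed
  have d_nonneg: "0 \<le> d \<tau>" if "0 \<le> \<tau>" for \<tau>
    using d0[OF that] v0[of "\<xi> + 2 * \<tau>"] by (simp add: d_def)
  have "(\<integral>\<^sup>+\<tau>. (J \<tau> + ennreal (h (\<xi> + 2 * \<tau>))) * indicator {0..t} \<tau> \<partial>lborel)
      \<le> (\<integral>\<^sup>+\<tau>. ennreal (d \<tau>) * indicator {0..t} \<tau> \<partial>lborel)"
  proof (rule nn_integral_mono)
    fix \<tau>
    show "(J \<tau> + ennreal (h (\<xi> + 2 * \<tau>))) * indicator {0..t} \<tau> \<le> ennreal (d \<tau>) * indicator {0..t} \<tau>"
    proof (cases "0 \<le> \<tau>")
      case True
      have "J \<tau> + ennreal (h (\<xi> + 2 * \<tau>))
          \<le> ennreal (barrier_slope \<tau> (\<xi> + \<tau>) - barrier_slope 0 (\<xi> + 2 * \<tau>)) + ennreal (barrier_velocity (\<xi> + 2 * \<tau>))"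
        by (intro add_mono J_le True ennreal_leI h)
      also have "\<dots> = ennreal (d \<tau>)"
        using d0[OF True] v0 by (simp add: d_def ennreal_plus[symmetric] del: ennreal_plus)
      finally show ?thesis by (auto split: split_indicator)
    qed simp
  qed
  also have "\<dots> = ennreal (W t - W 0)"
    using t by (intro nn_integral_FTC_Icc DW d_nonneg) auto
  finally have int: "(\<integral>\<^sup>+\<tau>. J \<tau> * indicator {0..t} \<tau> \<partial>lborel)
      + (\<integral>\<^sup>+\<tau>. ennreal (h (\<xi> + 2 * \<tau>)) * indicator {0..t} \<tau> \<partial>lborel) \<le> ennreal (W t - W 0)"
    by (simp add: distrib_right nn_integral_add)
  have W0: "0 \<le> W t - W 0"
  proof -
    have "W 0 \<le> W t"
      using DW d_nonneg by (intro DERIV_nonneg_imp_nondecreasing[OF t]) blast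
    then show ?thesis by simp
  qed
  have Wt: "W t - W 0 = exp (t / 2) * barrier t x - (barrier 0 (x - t) + barrier 0 (x + t)) / 2"
    by (simp add: W_def V_def \<xi>_def field_simps)
  have "linear_wave f h (t, x) + conv wave_kernel F (t, x)
      = dalembert_mean f (t, x) + ennreal (exp (- t / 2)) *
        ((\<integral>\<^sup>+\<tau>. J \<tau> * indicator {0..t} \<tau> \<partial>lborel)
          + (\<integral>\<^sup>+\<tau>. ennreal (h (\<xi> + 2 * \<tau>)) * indicator {0..t} \<tau> \<partial>lborel))"
  proof -
    have "conv wave_kernel F (t, x) = ennreal (exp (- t / 2)) * (\<integral>\<^sup>+\<tau>. J \<tau> * indicator {0..t} \<tau> \<partial>lborel)"
      unfolding J_def by (rule conv_wave_kernel_characteristics) (auto simp: F_def)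
    moreover have "space_conv wave_kernel h (t, x)
        = ennreal (exp (- t / 2)) * (\<integral>\<^sup>+\<tau>. ennreal (h (\<xi> + 2 * \<tau>)) * indicator {0..t} \<tau> \<partial>lborel)"
      unfolding \<xi>_def by (rule space_conv_wave_kernel_characteristics[OF _ t]) simp
    ultimately show ?thesis
      by (simp add: linear_wave_def distrib_left ac_simps)
  qed
  also have "\<dots> \<le> ennreal (exp (- t / 2) / 2 * (barrier 0 (x - t) + barrier 0 (x + t)))
      + ennreal (exp (- t / 2)) * ennreal (W t - W 0)"
  proof (intro add_mono mult_left_mono int)
    show "dalembert_mean f (t, x) \<le> ennreal (exp (- t / 2) / 2 * (barrier 0 (x - t) + barrier 0 (x + t)))"
      using f t by (auto simp: dalembert_mean_def future_def intro!: ennreal_leI mult_left_mono add_mono)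
  qed simp
  also have "\<dots> = ennreal (exp (- t / 2) / 2 * (barrier 0 (x - t) + barrier 0 (x + t)) + exp (- t / 2) * (W t - W 0))"
    using W0 barrier_pos[of 0] by (subst ennreal_plus) (auto simp: ennreal_mult' less_imp_le add_nonneg_nonneg)
  also have "exp (- t / 2) / 2 * (barrier 0 (x - t) + barrier 0 (x + t)) + exp (- t / 2) * (W t - W 0)
      = exp (- t / 2) * exp (t / 2) * barrier t x"
    unfolding Wt by (simp add: algebra_simps)
  also have "\<dots> = barrier t x"
    by (simp add: exp_add[symmetric])
  finally show ?thesis
    unfolding F_def .
qed

end

section \<open>Comparison and existence\<close>

text \<open>Each application of the inequality improves the bound \<open>M exp t\<close> by the factor \<open>1/4\<close>.\<close>
lemma wave_gronwall:
  assumes [measurable]: "d \<in> borel_measurable borel"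
    and M: "0 \<le> M" and bounded: "\<And>q. d q \<le> ennreal M * indicator future q"
    and d: "AE q in lborel. 4 * d q \<le> conv wave_kernel d q"
  shows "AE q in lborel. d q = 0"
proof -
  have "AE q in lborel. d q \<le> ennreal (M * (1 / 4) ^ n) * (ennreal (exp (fst q)) * indicator future q)" for n
  proof (induction n)
    case 0
    show ?case
    proof (rule AE_I2)
      fix q :: "real \<times> real"
      have "ennreal M * indicator future q \<le> ennreal M * (ennreal (exp (fst q)) * indicator future q)"
        by (intro mult_left_mono) (auto simp: future_def split: split_indicator)
      then show "d q \<le> ennreal (M * (1 / 4) ^ 0) * (ennreal (exp (fst q)) * indicator future q)"
        using bounded[of q] by (simp add: order_trans)
    qed
  next
    case (Suc n)
    let ?C = "ennreal (M * (1 / 4) ^ n)" and ?e = "\<lambda>q. ennreal (exp (fst q)) * indicator future q"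
    have C: "?C = 4 * ennreal (M * (1 / 4) ^ Suc n)"
      using M by (simp add: four_ennreal)
    from d show ?case
    proof eventually_elim
      case (elim q)
      note elim
      also have "conv wave_kernel d q \<le> conv wave_kernel (\<lambda>q. ?C * ?e q) q"
        by (rule conv_mono_AE[OF Suc])
      also have "\<dots> = ?C * conv wave_kernel ?e q"
        by (rule conv_cmult) measurable
      also have "\<dots> \<le> ?C * ?e q"
        by (intro mult_left_mono conv_wave_kernel_exp_le) simp
      also have "\<dots> = 4 * (ennreal (M * (1 / 4) ^ Suc n) * ?e q)"
        unfolding C by (simp only: mult.assoc)
      finally show ?case
        by (subst (asm) ennreal_mult_le_mult_iff) auto
    qed
  qed
  then have "AE q in lborel. \<forall>n. d q \<le> ennreal (M * (1 / 4) ^ n) * (ennreal (exp (fst q)) * indicator future q)"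
    by (simp add: AE_all_countable)
  then show ?thesis
  proof eventually_elim
    case (elim q)
    have "d q \<le> ennreal (M * (1 / 4) ^ n * exp (fst q))" for n
    proof -
      have "d q \<le> ennreal (M * (1 / 4) ^ n) * (ennreal (exp (fst q)) * indicator future q)"
        using elim by blast
      also have "\<dots> \<le> ennreal (M * (1 / 4) ^ n) * ennreal (exp (fst q))"
        by (intro mult_left_mono) (auto split: split_indicator)
      finally show ?thesis using M by (simp add: ennreal_mult)
    qed
    moreover have "(\<lambda>n. ennreal (M * (1 / 4) ^ n * exp (fst q))) \<longlonglongrightarrow> ennreal (M * 0 * exp (fst q))"
      by (intro tendsto_ennrealI tendsto_intros LIMSEQ_realpow_zero) auto
    ultimately have "d q \<le> ennreal (M * 0 * exp (fst q))"
      by (intro LIMSEQ_le_const) auto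
    then show ?case by simp
  qed
qed

lemma conv_wave_kernel_finite:
  assumes "\<And>q. F q \<le> ennreal M * indicator future q"
  shows "conv wave_kernel F p < top"
proof -
  have "conv wave_kernel F p \<le> conv wave_kernel (\<lambda>q. ennreal M * indicator future q) p"
    by (rule conv_mono[OF assms])
  also have "\<dots> = ennreal M * conv wave_kernel (indicator future) p"
    by (rule conv_cmult) measurable
  also have "\<dots> < top"
  proof -
    have "conv wave_kernel (indicator future) p \<le> 4 * indicator future p"
      by (subst wave_equation_one) simp
    also have "\<dots> \<le> 4" by (simp split: split_indicator)
    also have "\<dots> < top" by simp
    finally show ?thesis by (simp add: ennreal_mult_less_top)
  qed
  finally show ?thesis .
qed

context absorption begin

text \<open>The source \<open>u\<^sup>p\<close> of the damped form and the source \<open>u/4 - u\<^sup>p\<close> of the wave form.\<close>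
definition absorbed :: "(real \<times> real \<Rightarrow> ennreal) \<Rightarrow> real \<times> real \<Rightarrow> ennreal" where
  "absorbed U q = ennreal (enn2real (U q) powr p)"

definition reacted :: "(real \<times> real \<Rightarrow> ennreal) \<Rightarrow> real \<times> real \<Rightarrow> ennreal" where
  "reacted U q = ennreal (reaction (enn2real (U q)))"

lemma absorbed_measurable [measurable]:
  assumes [measurable]: "U \<in> borel_measurable borel"
  shows "absorbed U \<in> borel_measurable borel" "reacted U \<in> borel_measurable borel"
  unfolding absorbed_def[abs_def] reacted_def[abs_def] by measurable

lemma bounded_values:
  assumes "\<And>q. U q \<le> ennreal M * indicator future q" "0 \<le> M"
  shows "U q < top" "enn2real (U q) \<le> M" "q \<notin> future \<Longrightarrow> U q = 0"
proof -
  have "U q \<le> ennreal M"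
    using assms(1)[of q] by (rule order_trans) (auto split: split_indicator)
  then show "U q < top" "enn2real (U q) \<le> M"
    using assms(2) by (auto intro: le_less_trans simp: enn2real_leI)
  show "q \<notin> future \<Longrightarrow> U q = 0" using assms(1)[of q] by simp
qed

lemma absorbed_le:
  assumes "\<And>q. U q \<le> ennreal M * indicator future q" "0 \<le> M"
  shows "absorbed U q \<le> ennreal (M powr p) * indicator future q"
  using bounded_values[OF assms, of q] p_gt_1
  by (auto simp: absorbed_def intro!: ennreal_leI powr_mono2 split: split_indicator)

text \<open>Here \<open>U = 4 (U/4 - U\<^sup>p) + 4 U\<^sup>p\<close> is substituted into the convolution with \<open>U\<close>, and the finite convolution with \<open>U\<^sup>p\<close> cancels.\<close>
lemma wave_form_iff:
  assumes [measurable]: "U \<in> borel_measurable borel"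
    and M: "0 \<le> M" "M \<le> threshold" and U: "\<And>q. U q \<le> ennreal M * indicator future q"
  shows "4 * a + 4 * conv wave_kernel (absorbed U) q = 4 * g q + conv wave_kernel U q
     \<longleftrightarrow> a = g q + conv wave_kernel (reacted U) q"
proof -
  let ?a = "conv wave_kernel (absorbed U) q" and ?r = "conv wave_kernel (reacted U) q"
  have split: "U q = 4 * reacted U q + 4 * absorbed U q" for q
  proof -
    have "0 \<le> reaction (enn2real (U q))"
      using bounded_values[OF U M(1), of q] M by (intro reaction_nonneg) auto
    then have "4 * reacted U q + 4 * absorbed U q
       = ennreal (4 * reaction (enn2real (U q)) + 4 * (enn2real (U q) powr p))"
      by (simp add: reacted_def absorbed_def four_ennreal)
    also have "\<dots> = U q"
      using bounded_values[OF U M(1), of q] by (simp add: reaction_def)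
    finally show ?thesis by simp
  qed
  have fin: "4 * ?a \<noteq> top"
    using conv_wave_kernel_finite[OF absorbed_le[OF U M(1)], of q] by (simp add: ennreal_mult_eq_top_iff)
  have "conv wave_kernel U q = conv wave_kernel (\<lambda>q. 4 * reacted U q + 4 * absorbed U q) q"
    by (simp only: split[symmetric])
  also have "\<dots> = 4 * ?r + 4 * ?a"
    by (simp add: conv_add conv_cmult)
  finally have c: "conv wave_kernel U q = 4 * ?r + 4 * ?a" .
  have "4 * a + 4 * ?a = 4 * g q + conv wave_kernel U q \<longleftrightarrow> 4 * ?a + 4 * a = 4 * ?a + 4 * (g q + ?r)"
    unfolding c by (simp add: distrib_left ac_simps)
  also have "\<dots> \<longleftrightarrow> a = g q + ?r"
    using fin ennreal_four_cancel[of a] by (auto simp: ennreal_add_left_cancel)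
  finally show ?thesis .
qed

text \<open>The positive part \<open>d\<close> of \<open>U - w\<close> satisfies \<open>d \<le> 1/4 E * d\<close> because reaction terms differ by at
  most \<open>d/4\<close>. As in \<open>wave_form_of_damped_form\<close>, the value \<open>a\<close> at the point under consideration
  is allowed to differ from \<open>U\<close> there.\<close>
lemma comparison:
  assumes [measurable]: "f \<in> borel_measurable borel" "h \<in> borel_measurable borel" "U \<in> borel_measurable borel"
    and f0: "\<And>x. 0 \<le> f x" and h0: "\<And>x. 0 \<le> h x"
    and f: "\<And>x. f x \<le> barrier 0 x" and h: "\<And>x. h x \<le> barrier_velocity x"
    and M: "0 \<le> M" "M \<le> threshold" and U: "\<And>q. U q \<le> ennreal M * indicator future q"
    and ae: "AE q in lborel. U q = linear_wave f h q + conv wave_kernel (reacted U) q"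
    and p: "a = linear_wave f h (t, x) + conv wave_kernel (reacted U) (t, x)" and t: "0 \<le> t"
  shows "a \<le> ennreal (barrier t x)"
proof -
  let ?w = "\<lambda>q. barrier (fst q) (snd q)"
  define d where "d q = ennreal (max 0 (enn2real (U q) - ?w q)) * indicator future q" for q
  have [measurable]: "d \<in> borel_measurable borel"
    unfolding d_def[abs_def] by measurable
  have d_le: "d q \<le> ennreal M * indicator future q" for q
    using bounded_values(2)[OF U M(1), of q] barrier_pos[of "fst q" "snd q"] M(1)
    by (auto simp: d_def future_def intro!: ennreal_leI split: split_indicator)
  have r: "4 * reacted U q \<le> 4 * (ennreal (reaction (?w q)) * indicator future q) + d q" for q
  proof (cases "q \<in> future")
    case True
    then have t: "0 \<le> fst q" by (simp add: future_def)
    have "reaction (enn2real (U q)) \<le> reaction (?w q) + max 0 (enn2real (U q) - ?w q) / 4"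
      using bounded_values(2)[OF U M(1), of q] M barrier_le_threshold[OF t] barrier_pos[OF t, of "snd q"]
      by (intro reaction_diff_le) auto
    then have "ennreal (4 * reaction (enn2real (U q))) \<le> ennreal (4 * reaction (?w q) + max 0 (enn2real (U q) - ?w q))"
      by (intro ennreal_leI) simp
    also have "\<dots> = ennreal (4 * reaction (?w q)) + ennreal (max 0 (enn2real (U q) - ?w q))"
      using reaction_nonneg[of "?w q"] barrier_le_threshold[OF t] barrier_pos[OF t, of "snd q"]
      by (intro ennreal_plus) auto
    finally show ?thesis using True by (simp add: reacted_def d_def four_ennreal)
  next
    case False
    then show ?thesis
      using bounded_values(3)[OF U M(1), of q] p_gt_1 by (simp add: reacted_def reaction_def)
  qed
  have main: "4 * b \<le> 4 * ennreal (?w q) + conv wave_kernel d q"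
    if "b = linear_wave f h q + conv wave_kernel (reacted U) q" "q \<in> future" for b q
  proof -
    let ?R = "\<lambda>q. ennreal (reaction (?w q)) * indicator future q"
    have "4 * conv wave_kernel (reacted U) q = conv wave_kernel (\<lambda>q. 4 * reacted U q) q"
      by (subst conv_cmult) simp_all
    also have "\<dots> \<le> conv wave_kernel (\<lambda>q. 4 * ?R q + d q) q"
      by (rule conv_mono[OF r])
    also have "\<dots> = 4 * conv wave_kernel ?R q + conv wave_kernel d q"
      by (subst conv_add, measurable) (subst conv_cmult, measurable)
    finally have "4 * b \<le> 4 * (linear_wave f h q + conv wave_kernel ?R q) + conv wave_kernel d q"
      using that by (simp add: distrib_left add.assoc add_left_mono)
    also have "linear_wave f h q + conv wave_kernel ?R q \<le> ennreal (?w q)"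
      using barrier_dominates[OF _ _ f0 h0 f h, of "fst q" "snd q"] that(2) by (simp add: future_def)
    finally show ?thesis by (simp add: mult_left_mono add_right_mono)
  qed
  have "AE q in lborel. 4 * d q \<le> conv wave_kernel d q"
    using ae
  proof eventually_elim
    case (elim q)
    show ?case
    proof (cases "q \<in> future \<and> ?w q < enn2real (U q)")
      case True
      then have w0: "0 < ?w q" by (auto simp: future_def barrier_pos)
      have "ennreal (?w q) + d q = U q"
        using True w0 bounded_values(1)[OF U M(1), of q]
        by (simp add: d_def ennreal_plus[symmetric] del: ennreal_plus)
      then have "4 * ennreal (?w q) + 4 * d q \<le> 4 * ennreal (?w q) + conv wave_kernel d q"
        using main[OF elim] True by (simp add: distrib_left[symmetric])
      then show ?thesis
        by (simp add: four_ennreal)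
    qed (auto simp: d_def split: split_indicator)
  qed
  then have "AE q in lborel. d q = 0"
    by (intro wave_gronwall[OF _ M(1) d_le]) auto
  then have "conv wave_kernel d (t, x) = conv wave_kernel (\<lambda>_. 0) (t, x)"
    by (rule conv_cong_AE)
  then have "conv wave_kernel d (t, x) = 0" by (simp add: conv_def)
  then have "4 * a \<le> 4 * ennreal (barrier t x)"
    using main[OF p] t by (simp add: future_def)
  then show ?thesis
    by (subst (asm) ennreal_mult_le_mult_iff) auto
qed

primrec iterate :: "(real \<times> real \<Rightarrow> ennreal) \<Rightarrow> nat \<Rightarrow> real \<times> real \<Rightarrow> ennreal" where
  "iterate g 0 = (\<lambda>_. 0)"
| "iterate g (Suc n) = (\<lambda>q. g q + conv wave_kernel (reacted (iterate g n)) q)"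

lemma iterate_measurable [measurable]:
  assumes [measurable]: "g \<in> borel_measurable borel"
  shows "iterate g n \<in> borel_measurable borel"
  by (induction n) simp_all

text \<open>The constant \<open>M\<close> is a supersolution, since it solves the linear equation with larger data and the reaction is at most a quarter of its argument.\<close>
lemma iterate_le:
  assumes [measurable]: "g \<in> borel_measurable borel"
    and M: "0 \<le> M" "M \<le> threshold" and g: "\<And>q. g q \<le> ennreal M * unit_profile q"
  shows "iterate g n q \<le> ennreal M * indicator future q"
proof (induction n arbitrary: q)
  case (Suc n)
  have r: "4 * reacted (iterate g n) q \<le> ennreal M * indicator future q" for q
  proof (cases "q \<in> future")
    case True
    have "4 * reaction (enn2real (iterate g n q)) \<le> M"
      using reaction_le[of "enn2real (iterate g n q)"] bounded_values(2)[OF Suc M(1), of q] by simp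
    then show ?thesis using True by (simp add: reacted_def four_ennreal ennreal_leI)
  next
    case False
    then show ?thesis
      using bounded_values(3)[OF Suc M(1), of q] p_gt_1 by (simp add: reacted_def reaction_def)
  qed
  have "4 * iterate g (Suc n) q = 4 * g q + 4 * conv wave_kernel (reacted (iterate g n)) q"
    by (simp add: distrib_left)
  also have "4 * conv wave_kernel (reacted (iterate g n)) q = conv wave_kernel (\<lambda>q. 4 * reacted (iterate g n) q) q"
    by (subst conv_cmult) simp_all
  also have "\<dots> \<le> conv wave_kernel (\<lambda>q. ennreal M * indicator future q) q"
    by (rule conv_mono[OF r])
  also have "\<dots> = ennreal M * conv wave_kernel (indicator future) q"
    by (rule conv_cmult) measurable
  also have "4 * g q + \<dots> \<le> 4 * (ennreal M * unit_profile q) + \<dots>"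
    by (intro add_right_mono mult_left_mono g) simp
  also have "\<dots> = ennreal M * (4 * unit_profile q + conv wave_kernel (indicator future) q)"
    by (simp add: distrib_left mult.left_commute)
  also have "\<dots> = 4 * (ennreal M * indicator future q)"
    unfolding wave_equation_one[symmetric] by (simp only: mult.left_commute)
  finally have "4 * iterate g (Suc n) q \<le> 4 * (ennreal M * indicator future q)"
    by (blast intro: add_left_mono)
  then show ?case
    by (subst (asm) ennreal_mult_le_mult_iff) auto
qed simp

lemma iterate_incseq:
  assumes [measurable]: "g \<in> borel_measurable borel"
    and M: "0 \<le> M" "M \<le> threshold" and g: "\<And>q. g q \<le> ennreal M * unit_profile q"
  shows "iterate g n q \<le> iterate g (Suc n) q"
proof (induction n arbitrary: q)
  case (Suc n)
  note b = iterate_le[OF assms(1) M g]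
  have "reacted (iterate g n) q \<le> reacted (iterate g (Suc n)) q" for q
    unfolding reacted_def
    using bounded_values[where U = "iterate g n", OF b M(1), of q]
        bounded_values[where U = "iterate g (Suc n)", OF b M(1), of q] Suc[of q] M
    by (intro ennreal_leI reaction_mono enn2real_mono) auto
  then have "conv wave_kernel (reacted (iterate g n)) q \<le> conv wave_kernel (reacted (iterate g (Suc n))) q"
    by (rule conv_mono)
  then show ?case
    by (simp add: add_left_mono)
qed simp

text \<open>Monotone convergence in the convolution; the reaction is continuous and increasing on the range of the iterates.\<close>
lemma wave_form_solution_exists:
  assumes [measurable]: "g \<in> borel_measurable borel"
    and M: "0 \<le> M" "M \<le> threshold" and g: "\<And>q. g q \<le> ennreal M * unit_profile q"
  obtains U where "U \<in> borel_measurable borel" "\<And>q. U q \<le> ennreal M * indicator future q"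
    "\<And>q. U q = g q + conv wave_kernel (reacted U) q"
proof -
  define U where "U q = (SUP n. iterate g n q)" for q
  note b = iterate_le[OF assms(1) M g]
  have inc: "incseq (\<lambda>n. iterate g n q)" for q
    by (intro incseq_SucI iterate_incseq[OF assms(1) M g])
  have U_meas [measurable]: "U \<in> borel_measurable borel"
    unfolding U_def[abs_def] by measurable
  have U_le: "U q \<le> ennreal M * indicator future q" for q
    unfolding U_def by (rule SUP_least) (rule b)
  have lim: "(\<lambda>n. iterate g n q) \<longlonglongrightarrow> U q" for q
    unfolding U_def by (rule LIMSEQ_SUP[OF inc])
  have r_inc: "incseq (\<lambda>n. reacted (iterate g n) q)" for q
  proof (rule incseq_SucI)
    fix n
    show "reacted (iterate g n) q \<le> reacted (iterate g (Suc n)) q"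
      unfolding reacted_def
      using bounded_values[where U = "iterate g n", OF b M(1), of q]
        bounded_values[where U = "iterate g (Suc n)", OF b M(1), of q] incseq_SucD[OF inc, of n q] M
      by (intro ennreal_leI reaction_mono enn2real_mono) auto
  qed
  have r_lim: "(\<lambda>n. reacted (iterate g n) q) \<longlonglongrightarrow> reacted U q" for q
  proof -
    have "(\<lambda>n. enn2real (iterate g n q)) \<longlonglongrightarrow> enn2real (U q)"
      using bounded_values(1)[OF U_le M(1), of q] lim[of q] by (intro tendsto_enn2real) auto
    moreover have "(\<lambda>n. reaction (a n)) \<longlonglongrightarrow> reaction l" if "a \<longlonglongrightarrow> l" "\<And>n. 0 \<le> a n" for a l
      unfolding reaction_def using p_gt_1 that
      by (intro tendsto_intros tendsto_powr') auto
    ultimately show ?thesis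
      unfolding reacted_def by (intro tendsto_ennrealI) auto
  qed
  have r_sup: "(SUP n. reacted (iterate g n) q) = reacted U q" for q
    by (rule LIMSEQ_unique[OF LIMSEQ_SUP[OF r_inc] r_lim])
  have "conv wave_kernel (reacted U) q = (SUP n. conv wave_kernel (reacted (iterate g n)) q)" for q
  proof -
    have "conv wave_kernel (reacted U) q = (\<integral>\<^sup>+r. (SUP n. wave_kernel (q - r) * reacted (iterate g n) r) \<partial>lborel)"
      unfolding conv_def by (simp add: r_sup[symmetric] SUP_mult_left_ennreal)
    also have "\<dots> = (SUP n. conv wave_kernel (reacted (iterate g n)) q)"
      unfolding conv_def
    proof (rule nn_integral_monotone_convergence_SUP)
      show "incseq (\<lambda>n r. wave_kernel (q - r) * reacted (iterate g n) r)"
        using r_inc by (auto simp: incseq_def le_fun_def intro!: mult_left_mono)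
    qed simp
    finally show ?thesis .
  qed
  then have "g q + conv wave_kernel (reacted U) q = (SUP n. iterate g (Suc n) q)" for q
    by (simp add: ennreal_SUP_add_right)
  moreover have "(SUP n. iterate g (Suc n) q) = U q" for q
    using LIMSEQ_unique[OF LIMSEQ_SUP[of "\<lambda>n. iterate g (Suc n) q"] LIMSEQ_Suc[OF lim]] inc
    by (auto simp: incseq_def simp del: iterate.simps)
  ultimately show ?thesis
    using U_meas U_le by (intro that[of U]) simp_all
qed

end

section \<open>Mild solutions\<close>

lemma S_nonneg: "(\<And>y. 0 \<le> f y) \<Longrightarrow> 0 \<le> S t f x"
  unfolding S_def set_lebesgue_integral_def
  by (intro mult_nonneg_nonneg integral_nonneg_AE) (auto intro!: AE_I2 mult_nonneg_nonneg bessel_I0_nonneg)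

lemma set_integral_nonneg_on:
  assumes "\<And>\<tau>. \<tau> \<in> A \<Longrightarrow> 0 \<le> f \<tau>"
  shows "0 \<le> (LINT \<tau>:A|M. (f \<tau> :: real))"
  unfolding set_lebesgue_integral_def using assms
  by (intro integral_nonneg_AE) (auto split: split_indicator)

context absorption begin

text \<open>Identifies the Duhamel integral of a function \<open>v\<close>, which is only Lebesgue measurable in space, with
  the space-time convolution of a Borel representative \<open>V\<close> that agrees with it for almost every
  time. For almost every \<open>\<tau>\<close> the integrands agree, since \<open>S\<close> does not see null sets.\<close>
lemma duhamel_eq:
  assumes [measurable]: "V \<in> borel_measurable borel"
    and M: "0 \<le> M" and V: "\<And>q. V q \<le> ennreal M * indicator future q"
    and v: "\<And>\<tau>. 0 \<le> \<tau> \<Longrightarrow> v \<tau> \<in> borel_measurable lebesgue"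
    and ae: "AE \<tau> in lborel. 0 \<le> \<tau> \<longrightarrow> (AE y in lebesgue. v \<tau> y = enn2real (V (\<tau>, y)))"
    and t: "0 \<le> t"
  shows "set_integrable lebesgue {0..t} (\<lambda>\<tau>. S (t - \<tau>) (\<lambda>y. v \<tau> y powr p) x)"
    and "ennreal (LINT \<tau>:{0..t}|lebesgue. S (t - \<tau>) (\<lambda>y. v \<tau> y powr p) x)
       = conv damped_kernel (absorbed V) (t, x)"
proof -
  let ?G = "\<lambda>\<tau>. S (t - \<tau>) (\<lambda>y. v \<tau> y powr p) x"
  define inner where "inner \<tau> = (\<integral>\<^sup>+y. damped_kernel (t - \<tau>, x - y) * absorbed V (\<tau>, y) \<partial>lborel)" for \<tau>
  define k where "k \<tau> = enn2real (inner \<tau>)" for \<tau>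
  have [measurable]: "inner \<in> borel_measurable borel"
    unfolding inner_def[abs_def] by measurable
  then have [measurable]: "k \<in> borel_measurable borel"
    unfolding k_def[abs_def] by measurable
  have total: "(\<integral>\<^sup>+\<tau>. inner \<tau> \<partial>lborel) = conv damped_kernel (absorbed V) (t, x)"
    unfolding inner_def by (rule conv_iterated[symmetric]) measurable
  have sc: "inner \<tau> = space_conv damped_kernel (\<lambda>y. enn2real (V (\<tau>, y)) powr p) (t - \<tau>, x)" for \<tau>
    by (simp add: inner_def space_conv_def absorbed_def)
  have fin: "inner \<tau> < top" for \<tau>
    unfolding sc using bounded_values(2)[OF V M] p_gt_1
    by (intro space_conv_finite[of _ "M powr p"] powr_mono2) auto
  have outside: "inner \<tau> = 0" if "\<tau> \<notin> {0..t}" for \<tau>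
  proof (cases "\<tau> < 0")
    case True
    then have "absorbed V (\<tau>, y) = 0" for y
      using bounded_values(3)[OF V M, of "(\<tau>, y)"] by (simp add: absorbed_def future_def)
    then show ?thesis by (simp add: inner_def)
  next
    case False
    with that have "damped_kernel (t - \<tau>, x - y) = 0" for y
      by (intro kernels_outside) (auto simp: light_cone_def)
    then show ?thesis by (simp add: inner_def)
  qed
  have k0: "0 \<le> k \<tau>" for \<tau> by (simp add: k_def)
  have k_out: "indicator {0..t} \<tau> *\<^sub>R k \<tau> = k \<tau>" for \<tau>
    using outside[of \<tau>] by (auto simp: k_def split: split_indicator)
  have nn: "(\<integral>\<^sup>+\<tau>. ennreal (k \<tau>) \<partial>lborel) = conv damped_kernel (absorbed V) (t, x)"
    unfolding total[symmetric] k_def using fin by simp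
  have "integrable lborel k"
    using conv_damped_kernel_finite[OF absorbed_le[OF V M], of "(t, x)"] k0
    by (intro integrableI_nonneg) (simp_all add: nn)
  then have ki: "integrable lebesgue k" and kint: "ennreal (LINT \<tau>|lebesgue. k \<tau>) = conv damped_kernel (absorbed V) (t, x)"
    using nn_integral_eq_integral[of lborel k] k0
    by (simp_all add: integrable_completion integral_completion nn)
  have ks: "set_integrable lebesgue {0..t} k"
    unfolding set_integrable_def k_out by (rule ki)
  have "AE \<tau> in lborel. \<tau> \<in> {0..t} \<longrightarrow> ?G \<tau> = k \<tau>"
    using ae
  proof eventually_elim
    case (elim \<tau>)
    show ?case
    proof
      assume \<tau>: "\<tau> \<in> {0..t}"
      have b: "(\<lambda>y. enn2real (V (\<tau>, y)) powr p) \<in> borel_measurable borel" by measurable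
      have "?G \<tau> = S (t - \<tau>) (\<lambda>y. enn2real (V (\<tau>, y)) powr p) x"
      proof (rule S_cong_AE)
        show "(\<lambda>y. v \<tau> y powr p) \<in> borel_measurable lebesgue"
          using v[of \<tau>] \<tau> by simp
        show "(\<lambda>y. enn2real (V (\<tau>, y)) powr p) \<in> borel_measurable lebesgue"
          using b by (auto intro: measurable_completion)
        show "AE y in lebesgue. v \<tau> y powr p = enn2real (V (\<tau>, y)) powr p"
          using elim \<tau> by (auto elim: eventually_mono)
      qed
      also have "\<dots> = k \<tau>"
        unfolding k_def sc using \<tau> by (intro S_eq_space_conv b) auto
      finally show "?G \<tau> = k \<tau>" .
    qed
  qed
  then have "AE \<tau> in lebesgue. \<tau> \<in> {0..t} \<longrightarrow> ?G \<tau> = k \<tau>"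
    by (simp add: AE_completion_iff)
  then obtain N where N: "N \<in> null_sets lebesgue" "{\<tau>. \<not> (\<tau> \<in> {0..t} \<longrightarrow> ?G \<tau> = k \<tau>)} \<subseteq> N"
    unfolding eventually_ae_filter by auto
  have neg: "negligible N" using N(1) by (simp add: negligible_iff_null_sets)
  show G: "set_integrable lebesgue {0..t} ?G"
    using N(2) by (intro absolutely_integrable_spike[OF ks neg]) auto
  have "(LINT \<tau>:{0..t}|lebesgue. ?G \<tau>) = integral {0..t} ?G"
    by (rule set_lebesgue_integral_eq_integral[OF G])
  also have "\<dots> = integral {0..t} k"
    using N(2) by (intro integral_spike[OF neg]) auto
  also have "\<dots> = (LINT \<tau>:{0..t}|lebesgue. k \<tau>)"
    by (rule set_lebesgue_integral_eq_integral(2)[OF ks, symmetric])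
  also have "\<dots> = (LINT \<tau>|lebesgue. k \<tau>)"
    unfolding set_lebesgue_integral_def k_out ..
  finally show "ennreal (LINT \<tau>:{0..t}|lebesgue. ?G \<tau>) = conv damped_kernel (absorbed V) (t, x)"
    using kint by simp
qed

end

text \<open>Data \<open>u\<^sub>0\<close>, \<open>u\<^sub>1\<close> together with Borel representatives \<open>f\<close> of \<open>u\<^sub>0\<close> and \<open>h\<close> of \<open>u\<^sub>1 + u\<^sub>0/2\<close> that satisfy the bounds everywhere.\<close>
locale small_data = absorption +
  fixes \<epsilon> :: real and u0 u1 :: "real \<Rightarrow> real" and f h :: "real \<Rightarrow> real"
  assumes eps: "0 < \<epsilon>" "\<epsilon> \<le> \<epsilon>\<^sub>0"
    and u0_measurable: "u0 \<in> borel_measurable lebesgue" and u1_measurable: "u1 \<in> borel_measurable lebesgue"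
    and f_measurable [measurable]: "f \<in> borel_measurable borel"
    and h_measurable [measurable]: "h \<in> borel_measurable borel"
    and f_nonneg: "\<And>x. 0 \<le> f x" and h_nonneg: "\<And>x. 0 \<le> h x"
    and f_le: "\<And>x. f x \<le> \<epsilon> * japanese_bracket x powr (- \<rho>)"
    and h_le: "\<And>x. h x \<le> \<epsilon> * japanese_bracket x powr (- \<rho>)"
    and f_integrable: "integrable lborel f"
    and u0_eq: "AE x in lebesgue. u0 x = f x"
    and u1_eq: "AE x in lebesgue. u1 x + u0 x / 2 = h x"
begin

abbreviation "g \<equiv> linear_wave f h"

lemma bracket_le: "\<epsilon> * japanese_bracket x powr (- \<rho>) \<le> \<epsilon>"
proof -
  have "1 \<le> japanese_bracket x"
    unfolding japanese_bracket_def by (intro ge_one_powr_ge_zero) auto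
  then have "japanese_bracket x powr (- \<rho>) \<le> japanese_bracket x powr 0"
    using rho_gt_1 by (intro powr_mono) auto
  also have "\<dots> \<le> 1" by simp
  finally show ?thesis using eps by simp
qed

lemma f_le_eps: "f x \<le> \<epsilon>" and h_le_eps: "h x \<le> \<epsilon>"
  using f_le[of x] h_le[of x] bracket_le[of x] by simp_all

lemma f_le_barrier: "f x \<le> barrier 0 x" and h_le_velocity: "h x \<le> barrier_velocity x"
  using f_le[of x] h_le[of x] initial_data_le_barrier[OF eps, of x] barrier_velocity_ge[of x]
    barrier_pos[of 0 x] by simp_all

lemma two_eps: "0 \<le> 2 * \<epsilon>" "2 * \<epsilon> \<le> threshold"
  using eps eps0_threshold by auto

lemma g_le: "g q \<le> ennreal (2 * \<epsilon>) * unit_profile q"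
  by (rule linear_wave_le[OF f_nonneg f_le_eps h_nonneg h_le_eps])

lemma linear_part:
  assumes "0 \<le> t"
  shows "AE x in lebesgue. 0 \<le> S t (\<lambda>y. u0 y + u1 y) x + dt_S t u0 x \<and>
    4 * ennreal (S t (\<lambda>y. u0 y + u1 y) x + dt_S t u0 x) = 4 * g (t, x) + conv damped_kernel g (t, x)"
  using assms
  by (intro linear_flow_eq[OF _ _ f_nonneg f_le_eps h_nonneg h_le_eps f_integrable
        u0_measurable u1_measurable u0_eq u1_eq]) simp_all

text \<open>The linear flow preserves the order, the data are below those of \<open>2 \<epsilon>\<close> times the constant solution, and \<open>damped_equation_one\<close> evaluates the latter.\<close>
lemma damped_linear_le: "4 * g q + conv damped_kernel g q \<le> 4 * (ennreal (2 * \<epsilon>) * indicator future q)"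
proof -
  have "conv damped_kernel g q \<le> conv damped_kernel (\<lambda>q. ennreal (2 * \<epsilon>) * unit_profile q) q"
    by (rule conv_mono[OF g_le])
  also have "\<dots> = ennreal (2 * \<epsilon>) * conv damped_kernel unit_profile q"
    by (rule conv_cmult) measurable
  finally have "4 * g q + conv damped_kernel g q
      \<le> 4 * (ennreal (2 * \<epsilon>) * unit_profile q) + ennreal (2 * \<epsilon>) * conv damped_kernel unit_profile q"
    by (intro add_mono mult_left_mono g_le) simp_all
  also have "\<dots> = ennreal (2 * \<epsilon>) * (4 * unit_profile q + conv damped_kernel unit_profile q)"
    by (simp add: distrib_left mult.left_commute)
  also have "\<dots> = 4 * (ennreal (2 * \<epsilon>) * indicator future q)"
    unfolding damped_equation_one[symmetric] by (simp only: mult.left_commute)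
  finally show ?thesis .
qed

lemma mild_solution_exists: "\<exists>u. mild_solution p u0 u1 u"
proof -
  obtain U where U_meas [measurable]: "U \<in> borel_measurable borel"
    and U_le: "\<And>q. U q \<le> ennreal (2 * \<epsilon>) * indicator future q"
    and U_eq: "\<And>q. U q = g q + conv wave_kernel (reacted U) q"
    using wave_form_solution_exists[OF _ two_eps g_le] by (metis f_measurable h_measurable linear_wave_measurable)
  have damped: "4 * U q + 4 * conv damped_kernel (absorbed U) q = 4 * g q + conv damped_kernel g q" for q
  proof (rule damped_form_of_wave_form[OF _ _ _ U_le])
    show "4 * U q + 4 * conv wave_kernel (absorbed U) q = 4 * g q + conv wave_kernel U q" for q
      by (rule wave_form_iff[THEN iffD2, OF _ two_eps U_le U_eq]) simp
  qed simp_all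
  define u where "u t x = enn2real (U (t, x))" for t x
  have u_sec [measurable]: "u t \<in> borel_measurable borel" for t
    unfolding u_def[abs_def] by measurable
  have u_le: "u t x \<le> 2 * \<epsilon>" "0 \<le> u t x" for t x
    using bounded_values(2)[OF U_le two_eps(1)] by (auto simp: u_def)
  note D = duhamel_eq[OF U_meas two_eps(1) U_le, of u]
  have "mild_solution p u0 u1 u"
    unfolding mild_solution_def
  proof (intro conjI allI impI)
    have "(\<lambda>(t, x). u t x) = (\<lambda>q. enn2real (U q))"
      by (auto simp: u_def)
    moreover have "(\<lambda>q. enn2real (U q)) \<in> borel_measurable lebesgue"
      by (auto intro!: measurable_completion)
    ultimately show "(\<lambda>(t, x). u t x) \<in> borel_measurable (lebesgue_on ({0..} \<times> UNIV))"
      by (auto intro: measurable_restrict_space1)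
    show "u t \<in> borel_measurable lebesgue" for t
      using u_sec[of t] by (auto intro: measurable_completion)
    show "AE x in lebesgue. 0 \<le> u t x" for t
      using u_le by simp
    show "locally_integrable (\<lambda>x. u t x powr p)" for t
      unfolding locally_integrable_def
    proof (intro allI impI)
      fix K :: "real set" assume "compact K"
      then have "K \<in> lmeasurable" by (rule lmeasurable_compact)
      then have "K \<in> sets lebesgue" "emeasure lebesgue K < \<infinity>"
        using fmeasurableD2[of K lebesgue] fmeasurableD[of K lebesgue]
        by (simp_all only: top.not_eq_extremum infinity_ennreal_def)
      moreover have "(\<lambda>x. u t x powr p) \<in> borel_measurable borel" by measurable
      then have "(\<lambda>x. u t x powr p) \<in> borel_measurable lebesgue"
        by (auto intro: measurable_completion)
      ultimately show "(\<lambda>x. u t x powr p) absolutely_integrable_on K"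
        unfolding set_integrable_def using u_le p_gt_1
        by (intro integrableI_bounded_set_indicator[where B = "(2 * \<epsilon>) powr p"]) (auto intro!: powr_mono2)
    qed
    fix t :: real assume t: "0 \<le> t"
    have int: "set_integrable lebesgue {0..t} (\<lambda>\<tau>. S (t - \<tau>) (\<lambda>y. u \<tau> y powr p) x)"
      and duh: "ennreal (LINT \<tau>:{0..t}|lebesgue. S (t - \<tau>) (\<lambda>y. u \<tau> y powr p) x)
        = conv damped_kernel (absorbed U) (t, x)" for x
      using u_sec by (intro D t; auto simp: u_def intro: measurable_completion)+
    show "AE x in lebesgue.
          set_integrable lebesgue {0..t} (\<lambda>\<tau>. S (t - \<tau>) (\<lambda>y. u \<tau> y powr p) x) \<and>
          u t x = S t (\<lambda>y. u0 y + u1 y) x + dt_S t u0 x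
            - (LINT \<tau>:{0..t}|lebesgue. S (t - \<tau>) (\<lambda>y. u \<tau> y powr p) x)"
      using linear_part[OF t]
    proof eventually_elim
      case (elim x)
      let ?L = "S t (\<lambda>y. u0 y + u1 y) x + dt_S t u0 x"
      let ?D = "LINT \<tau>:{0..t}|lebesgue. S (t - \<tau>) (\<lambda>y. u \<tau> y powr p) x"
      have D0: "0 \<le> ?D"
        by (intro set_integral_nonneg_on S_nonneg) simp
      have "ennreal (u t x) = U (t, x)"
        using bounded_values(1)[OF U_le two_eps(1), of "(t, x)"] by (simp add: u_def)
      then have "4 * ennreal (u t x) + 4 * ennreal ?D = 4 * ennreal ?L"
        using damped[of "(t, x)"] elim by (simp add: duh)
      then have "4 * ennreal (u t x + ?D) = 4 * ennreal ?L"
        by (simp only: ennreal_plus[OF u_le(2) D0] distrib_left)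
      then have "ennreal (u t x + ?D) = ennreal ?L"
        by (rule ennreal_four_cancel)
      then have "u t x + ?D = ?L"
        using D0 u_le(2)[of t x] elim by (subst (asm) ennreal_inj) auto
      then show ?case using int by simp
    qed
  qed
  then show "\<exists>u. mild_solution p u0 u1 u" by (intro exI[of _ u])
qed

text \<open>The Duhamel term is non-negative, so the solution lies below the linear flow.\<close>
lemma mild_solution_le_two_eps:
  assumes u: "mild_solution p u0 u1 u" and t: "0 \<le> t"
  shows "AE x in lebesgue. 0 \<le> u t x \<and> u t x \<le> 2 * \<epsilon>"
proof -
  have eq: "AE x in lebesgue. u t x = S t (\<lambda>y. u0 y + u1 y) x + dt_S t u0 x
                - (LINT \<tau>:{0..t}|lebesgue. S (t - \<tau>) (\<lambda>y. u \<tau> y powr p) x)"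
    and pos: "AE x in lebesgue. 0 \<le> u t x"
    using u t by (auto simp: mild_solution_def)
  from eq pos linear_part[OF t] show ?thesis
  proof eventually_elim
    case (elim x)
    let ?L = "S t (\<lambda>y. u0 y + u1 y) x + dt_S t u0 x"
    have "0 \<le> (LINT \<tau>:{0..t}|lebesgue. S (t - \<tau>) (\<lambda>y. u \<tau> y powr p) x)"
      by (intro set_integral_nonneg_on S_nonneg) simp
    moreover have "4 * ennreal ?L \<le> 4 * (ennreal (2 * \<epsilon>) * indicator future (t, x))"
      using elim damped_linear_le[of "(t, x)"] by simp
    then have "ennreal ?L \<le> ennreal (2 * \<epsilon>)"
      using t by (subst (asm) ennreal_mult_le_mult_iff) (auto simp: future_def)
    then have "?L \<le> 2 * \<epsilon>" using eps by (simp add: ennreal_le_iff)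
    ultimately show ?case using elim by simp
  qed
qed

text \<open>Truncation at \<open>0\<close> and \<open>2 \<epsilon>\<close> changes the Borel representative only on a null set, by the previous lemma.\<close>
lemma mild_solution_borel_version:
  assumes u: "mild_solution p u0 u1 u"
  obtains V where "V \<in> borel_measurable borel" "\<And>q. V q \<le> ennreal (2 * \<epsilon>) * indicator future q"
    "AE \<tau> in lborel. 0 \<le> \<tau> \<longrightarrow> (AE y in lebesgue. u \<tau> y = enn2real (V (\<tau>, y)))"
proof -
  let ?ext = "\<lambda>q. if q \<in> {0..} \<times> UNIV then (\<lambda>(t, x). u t x) q else 0"
  have "closed ({0..} \<times> UNIV :: (real \<times> real) set)"
    by (intro closed_Times) auto
  then have "({0..} \<times> UNIV :: (real \<times> real) set) \<in> sets lebesgue"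
    by (intro sets_completionI_sets) simp
  then have "?ext \<in> borel_measurable lebesgue"
    using u by (intro borel_measurable_if_I) (auto simp: mild_solution_def)
  then obtain V0 where V0 [measurable]: "V0 \<in> borel_measurable borel"
    and V0_eq: "AE q in lborel. ?ext q = V0 q"
    using completion_ex_borel_measurable_real[of ?ext lborel] by auto
  define V where "V q = ennreal (min (2 * \<epsilon>) (max 0 (V0 q))) * indicator future q" for q
  show ?thesis
  proof
    show "V \<in> borel_measurable borel"
      unfolding V_def[abs_def] by measurable
    show "V q \<le> ennreal (2 * \<epsilon>) * indicator future q" for q
      unfolding V_def by (intro mult_right_mono ennreal_leI) auto
    have "AE \<tau> in lborel. AE y in lborel. ?ext (\<tau>, y) = V0 (\<tau>, y)"
      using V0_eq unfolding lborel_prod[symmetric] by (rule lborel_pair.AE_pair)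
    then show "AE \<tau> in lborel. 0 \<le> \<tau> \<longrightarrow> (AE y in lebesgue. u \<tau> y = enn2real (V (\<tau>, y)))"
    proof eventually_elim
      case (elim \<tau>)
      show ?case
      proof
        assume \<tau>: "0 \<le> \<tau>"
        from elim have "AE y in lebesgue. ?ext (\<tau>, y) = V0 (\<tau>, y)"
          by (simp add: AE_completion_iff)
        with mild_solution_le_two_eps[OF u \<tau>] show "AE y in lebesgue. u \<tau> y = enn2real (V (\<tau>, y))"
          by eventually_elim (use \<tau> in \<open>auto simp: V_def future_def\<close>)
      qed
    qed
  qed
qed

text \<open>The mild formulation is an identity for each time and almost every \<open>x\<close>. It passes to the Borel
  representative almost everywhere in space-time, where the wave form follows. On the given time
  slice the pointwise version of the comparison is applied to the values of \<open>u\<close> itself.\<close>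
lemma mild_solution_le_barrier:
  assumes u: "mild_solution p u0 u1 u" and t: "0 \<le> t"
  shows "AE x in lebesgue. 0 \<le> u t x \<and> u t x \<le> barrier t x"
proof -
  obtain V where V_meas [measurable]: "V \<in> borel_measurable borel"
    and V_le: "\<And>q. V q \<le> ennreal (2 * \<epsilon>) * indicator future q"
    and V_eq: "AE \<tau> in lborel. 0 \<le> \<tau> \<longrightarrow> (AE y in lebesgue. u \<tau> y = enn2real (V (\<tau>, y)))"
    using mild_solution_borel_version[OF u] by blast
  have u_meas: "u \<tau> \<in> borel_measurable lebesgue" if "0 \<le> \<tau>" for \<tau>
    using u that by (auto simp: mild_solution_def)
  have damped: "AE x in lebesgue. 4 * ennreal (u \<tau> x) + 4 * conv damped_kernel (absorbed V) (\<tau>, x)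
      = 4 * g (\<tau>, x) + conv damped_kernel g (\<tau>, x)" if \<tau>: "0 \<le> \<tau>" for \<tau>
  proof -
    have eq: "AE x in lebesgue. u \<tau> x = S \<tau> (\<lambda>y. u0 y + u1 y) x + dt_S \<tau> u0 x
                - (LINT s:{0..\<tau>}|lebesgue. S (\<tau> - s) (\<lambda>y. u s y powr p) x)"
      using u \<tau> by (auto simp: mild_solution_def)
    from eq mild_solution_le_two_eps[OF u \<tau>] linear_part[OF \<tau>] show ?thesis
    proof eventually_elim
      case (elim x)
      let ?L = "S \<tau> (\<lambda>y. u0 y + u1 y) x + dt_S \<tau> u0 x"
      let ?D = "LINT s:{0..\<tau>}|lebesgue. S (\<tau> - s) (\<lambda>y. u s y powr p) x"
      have D: "ennreal ?D = conv damped_kernel (absorbed V) (\<tau>, x)"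
        by (rule duhamel_eq(2)[OF V_meas two_eps(1) V_le u_meas V_eq \<tau>])
      have D0: "0 \<le> ?D"
        by (intro set_integral_nonneg_on S_nonneg) simp
      have "ennreal (u \<tau> x) + ennreal ?D = ennreal ?L"
        using elim D0 by (subst ennreal_plus[symmetric]) auto
      then show ?case
        using elim by (simp add: D[symmetric] distrib_left[symmetric])
    qed
  qed
  have "AE q in lborel. 4 * V q + 4 * conv damped_kernel (absorbed V) q = 4 * g q + conv damped_kernel g q"
    unfolding lborel_prod[symmetric]
  proof (rule lborel_pair.AE_pair_measure)
    show "{q \<in> space (lborel \<Otimes>\<^sub>M lborel). 4 * V q + 4 * conv damped_kernel (absorbed V) q
        = 4 * g q + conv damped_kernel g q} \<in> sets (lborel \<Otimes>\<^sub>M lborel)"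
      unfolding lborel_prod by measurable
    show "AE \<tau> in lborel. AE y in lborel. 4 * V (\<tau>, y) + 4 * conv damped_kernel (absorbed V) (\<tau>, y)
        = 4 * g (\<tau>, y) + conv damped_kernel g (\<tau>, y)"
      using V_eq
    proof eventually_elim
      case (elim \<tau>)
      show ?case
      proof (cases "0 \<le> \<tau>")
        case True
        then have "AE y in lebesgue. u \<tau> y = enn2real (V (\<tau>, y))" using elim by blast
        with damped[OF True] have "AE y in lebesgue. 4 * V (\<tau>, y) + 4 * conv damped_kernel (absorbed V) (\<tau>, y)
            = 4 * g (\<tau>, y) + conv damped_kernel g (\<tau>, y)"
          by eventually_elim (simp add: bounded_values(1)[OF V_le two_eps(1)])
        then show ?thesis by (simp add: AE_completion_iff)
      next
        case False
        then have q: "(\<tau>, y) \<notin> future" for y by (simp add: future_def)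
        have "absorbed V q = 0" if "q \<notin> future" for q
          using absorbed_le[OF V_le two_eps(1), of q] that by simp
        then have "conv damped_kernel (absorbed V) (\<tau>, y) = 0" for y
          using q by (intro conv_past kernels_outside)
        moreover have "conv damped_kernel g (\<tau>, y) = 0" "g (\<tau>, y) = 0" for y
          using q damped_linear_le[of "(\<tau>, y)"] by auto
        moreover have "V (\<tau>, y) = 0" for y
          using bounded_values(3)[OF V_le two_eps(1)] q by blast
        ultimately show ?thesis by simp
      qed
    qed
  qed
  note ae = this
  have wave: "a = g q + conv wave_kernel (reacted V) q"
    if "4 * a + 4 * conv damped_kernel (absorbed V) q = 4 * g q + conv damped_kernel g q" for a q
    using wave_form_of_damped_form[OF _ _ _ absorbed_le[OF V_le two_eps(1)] ae that]
      wave_form_iff[OF _ two_eps V_le, of a q g] by simp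
  have ae_wave: "AE q in lborel. V q = g q + conv wave_kernel (reacted V) q"
    using ae by eventually_elim (rule wave)
  have "AE x in lebesgue. ennreal (u t x) \<le> ennreal (barrier t x)"
    using damped[OF t]
  proof eventually_elim
    case (elim x)
    show ?case
      by (rule comparison[OF _ _ _ f_nonneg h_nonneg f_le_barrier h_le_velocity two_eps V_le ae_wave wave[OF elim] t]) simp_all
  qed
  with mild_solution_le_two_eps[OF u t] show ?thesis
    by eventually_elim (use barrier_pos[OF t] in \<open>simp add: ennreal_le_iff less_imp_le\<close>)
qed

end

section \<open>Norms of the barrier\<close>

lemma nn_integral_power_tail:
  assumes "1 < (r::real)"
  shows "(\<integral>\<^sup>+y. ennreal (y powr (- r)) * indicator {1..} y \<partial>lborel) < top"
proof -
  have "(\<integral>\<^sup>+y. ennreal (y powr (- r)) * indicator {1..} y \<partial>lborel)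
      = ennreal (0 - (1 powr (1 - r) / (1 - r)))"
  proof (rule nn_integral_FTC_atLeast[where F = "\<lambda>y. y powr (1 - r) / (1 - r)"])
    show "DERIV (\<lambda>y. y powr (1 - r) / (1 - r)) y :> y powr (- r)" if "1 \<le> y" for y :: real
      using DERIV_cdivide[OF has_real_derivative_powr[of y "1 - r"], of "1 - r"] that assms by simp
    have "((\<lambda>y. y powr (1 - r)) \<longlongrightarrow> 0) at_top"
      using assms by (intro tendsto_neg_powr filterlim_ident) auto
    then show "((\<lambda>y. y powr (1 - r) / (1 - r)) \<longlongrightarrow> 0) at_top"
      by (intro tendsto_divide_zero)
  qed auto
  then show ?thesis by simp
qed

text \<open>An integrable majorant, for \<open>r > 1\<close>, of functions bounded by \<open>1\<close> that decay like \<open>\<bar>y\<bar> powr -r\<close>.\<close>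
definition envelope :: "real \<Rightarrow> real \<Rightarrow> ennreal" where
  "envelope r y = indicator {-1..1} y + (ennreal (y powr (- r)) * indicator {1..} y
     + ennreal ((- y) powr (- r)) * indicator {1..} (- y))"

lemma envelope_measurable [measurable]: "envelope r \<in> borel_measurable borel"
  unfolding envelope_def[abs_def] by measurable

lemma envelope_finite:
  assumes "1 < r"
  shows "(\<integral>\<^sup>+y. envelope r y \<partial>lborel) < top"
proof -
  have "(\<integral>\<^sup>+y. ennreal ((- y) powr (- r)) * indicator {1..} (- y) \<partial>lborel)
      = (\<integral>\<^sup>+y. ennreal (y powr (- r)) * indicator {1..} y \<partial>lborel)"
    using nn_integral_lborel_reflection[of "\<lambda>y. ennreal (y powr (- r)) * indicator {1..} y" "0::real"]
    by simp
  then show ?thesis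
    using nn_integral_power_tail[OF assms]
    by (simp add: envelope_def nn_integral_add)
qed

lemma le_envelope:
  assumes "F y \<le> 1" "1 \<le> \<bar>y\<bar> \<Longrightarrow> F y \<le> \<bar>y\<bar> powr (- r)"
  shows "ennreal (F y) \<le> envelope r y"
proof (cases "\<bar>y\<bar> \<le> 1")
  case True
  then have "ennreal (F y) \<le> indicator {-1..1} y"
    using assms(1) ennreal_leI[of "F y" 1] by (simp add: abs_le_iff)
  then show ?thesis unfolding envelope_def by (rule order_trans) simp
next
  case False
  then have "ennreal (F y) \<le> ennreal (\<bar>y\<bar> powr (- r))"
    using assms(2) by (intro ennreal_leI) simp
  also have "\<dots> \<le> envelope r y"
    using False unfolding envelope_def by (cases "0 \<le> y") auto
  finally show ?thesis .
qed

lemma japanese_bracket_integrable: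
  assumes "1 < r"
  shows "integrable lborel (\<lambda>y. japanese_bracket y powr (- r))"
proof (rule integrableI_nonneg)
  have "(\<integral>\<^sup>+y. ennreal (japanese_bracket y powr (- r)) \<partial>lborel) \<le> (\<integral>\<^sup>+y. envelope r y \<partial>lborel)"
  proof (intro nn_integral_mono le_envelope)
    fix y :: real
    have eq: "japanese_bracket y powr (- r) = (1 + y\<^sup>2) powr (- r / 2)"
      by (simp add: japanese_bracket_def powr_powr)
    have "(1 + y\<^sup>2) powr (- r / 2) \<le> (1 + y\<^sup>2) powr 0"
      using assms by (intro powr_mono) auto
    then show "japanese_bracket y powr (- r) \<le> 1"
      unfolding eq by (auto simp: add_nonneg_eq_0_iff split: if_splits)
    assume y: "1 \<le> \<bar>y\<bar>"
    have "(1 + y\<^sup>2) powr (- (r / 2)) \<le> (\<bar>y\<bar> powr 2) powr (- (r / 2))"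
      using y assms by (intro powr_mono2') (auto simp: powr_realpow)
    also have "\<dots> = \<bar>y\<bar> powr (2 * (- (r / 2)))" by (rule powr_powr)
    also have "\<dots> = \<bar>y\<bar> powr (- r)" by simp
    finally show "japanese_bracket y powr (- r) \<le> \<bar>y\<bar> powr (- r)"
      unfolding eq by simp
  qed
  also have "\<dots> < \<infinity>" using envelope_finite[OF assms] by simp
  finally show "(\<integral>\<^sup>+y. ennreal (japanese_bracket y powr (- r)) \<partial>lborel) < \<infinity>" .
qed (auto simp: japanese_bracket_def[abs_def])

context absorption begin

text \<open>The additive constant of \<open>barrier_base\<close>, measured as a delay in time. It keeps the bounds below integrable in time near \<open>t = 0\<close>.\<close>
definition shift :: real where "shift = 4 * p / \<kappa>"

lemma shift_pos: "0 < shift" using p_gt_1 kappa_pos by (simp add: shift_def)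

lemma barrier_le_scaled:
  assumes t: "0 \<le> t"
  shows "barrier t x \<le> (\<kappa> * (\<bar>x\<bar> powr (2 * m) + (t + shift))) powr (- \<alpha>)"
  unfolding barrier_def
proof (rule powr_mono2')
  have "\<bar>x\<bar> powr (2 * m) = (x\<^sup>2) powr m"
    by (cases "x = 0") (simp_all add: powr_powr[symmetric] powr_realpow)
  also have "\<dots> \<le> weight x"
    unfolding weight_def using m_pos by (intro powr_mono2) auto
  finally have "\<kappa> * \<bar>x\<bar> powr (2 * m) \<le> \<kappa> * weight x"
    using kappa_pos by (intro mult_left_mono) auto
  moreover have "\<kappa> * shift = 4 * p" using kappa_pos by (simp add: shift_def)
  ultimately show "\<kappa> * (\<bar>x\<bar> powr (2 * m) + (t + shift)) \<le> barrier_base t x"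
    by (simp add: barrier_base_def distrib_left)
  show "0 < \<kappa> * (\<bar>x\<bar> powr (2 * m) + (t + shift))"
    using kappa_pos shift_pos t by (intro mult_pos_pos add_nonneg_pos) auto
qed (use alpha_pos in simp)

lemma barrier_sup:
  assumes t: "0 < t"
  shows "barrier t x \<le> \<kappa> powr (- \<alpha>) * t powr (- \<alpha>)"
proof -
  have "barrier t x \<le> (\<kappa> * (\<bar>x\<bar> powr (2 * m) + (t + shift))) powr (- \<alpha>)"
    using t by (intro barrier_le_scaled) simp
  also have "\<dots> \<le> (\<kappa> * t) powr (- \<alpha>)"
    using t kappa_pos shift_pos alpha_pos by (intro powr_mono2' mult_left_mono mult_pos_pos) auto
  also have "\<dots> = \<kappa> powr (- \<alpha>) * t powr (- \<alpha>)"
    using t kappa_pos by (simp add: powr_mult)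
  finally show ?thesis .
qed

definition profile_mass :: real where
  "profile_mass = enn2real (\<integral>\<^sup>+y. ennreal ((\<bar>y\<bar> powr (2 * m) + 1) powr (- \<alpha>)) \<partial>lborel)"

lemma profile_mass:
  "(\<integral>\<^sup>+y. ennreal ((\<bar>y\<bar> powr (2 * m) + 1) powr (- \<alpha>)) \<partial>lborel) = ennreal profile_mass"
  "0 \<le> profile_mass"
proof -
  have "(\<integral>\<^sup>+y. ennreal ((\<bar>y\<bar> powr (2 * m) + 1) powr (- \<alpha>)) \<partial>lborel) \<le> (\<integral>\<^sup>+y. envelope \<rho> y \<partial>lborel)"
  proof (intro nn_integral_mono le_envelope)
    fix y :: real
    have "(\<bar>y\<bar> powr (2 * m) + 1) powr (- \<alpha>) \<le> 1 powr (- \<alpha>)"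
      using alpha_pos by (intro powr_mono2') auto
    then show "(\<bar>y\<bar> powr (2 * m) + 1) powr (- \<alpha>) \<le> 1" by simp
    assume y: "1 \<le> \<bar>y\<bar>"
    have "(\<bar>y\<bar> powr (2 * m) + 1) powr (- \<alpha>) \<le> (\<bar>y\<bar> powr (2 * m)) powr (- \<alpha>)"
      using y alpha_pos by (intro powr_mono2') auto
    also have "\<dots> = \<bar>y\<bar> powr (2 * m * (- \<alpha>))" by (rule powr_powr)
    also have "2 * m * (- \<alpha>) = - \<rho>" by (simp add: m_alpha mult.assoc)
    finally show "(\<bar>y\<bar> powr (2 * m) + 1) powr (- \<alpha>) \<le> \<bar>y\<bar> powr (- \<rho>)" .
  qed
  also have "\<dots> < top" by (rule envelope_finite[OF rho_gt_1])
  finally show "(\<integral>\<^sup>+y. ennreal ((\<bar>y\<bar> powr (2 * m) + 1) powr (- \<alpha>)) \<partial>lborel) = ennreal profile_mass"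
    by (simp add: profile_mass_def)
  show "0 \<le> profile_mass" by (simp add: profile_mass_def)
qed

text \<open>The substitution \<open>x = (t + shift) powr (1/(2m)) y\<close> makes the two terms in \<open>barrier_le_scaled\<close> homogeneous.\<close>
lemma barrier_power_integral:
  assumes t: "0 \<le> t" and q: "1 \<le> q"
  shows "(\<integral>\<^sup>+x. ennreal (barrier t x powr q) \<partial>lborel)
    \<le> ennreal (\<kappa> powr (- \<alpha> * q) * profile_mass * (t + shift) powr (1 / (2 * m) - \<alpha> * q))"
proof -
  define s where "s = t + shift"
  define c where "c = s powr (1 / (2 * m))"
  have s: "0 < s" using t shift_pos by (simp add: s_def)
  then have c: "0 < c" by (simp add: c_def)
  have c_pow: "c powr (2 * m) = s" using m_pos s by (simp add: c_def powr_powr)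
  let ?F = "\<lambda>x. ennreal (((\<kappa> * (\<bar>x\<bar> powr (2 * m) + s)) powr (- \<alpha>)) powr q)"
  have "(\<integral>\<^sup>+x. ennreal (barrier t x powr q) \<partial>lborel) \<le> (\<integral>\<^sup>+x. ?F x \<partial>lborel)"
    using barrier_le_scaled[OF t] barrier_pos[OF t] q
    by (intro nn_integral_mono ennreal_leI powr_mono2) (auto simp: s_def less_imp_le)
  also have "\<dots> = ennreal \<bar>c\<bar> * (\<integral>\<^sup>+y. ?F (0 + c * y) \<partial>lborel)"
    using c by (intro nn_integral_real_affine) auto
  also have "\<dots> \<le> ennreal \<bar>c\<bar> * (\<integral>\<^sup>+y. ennreal (\<kappa> powr (- \<alpha> * q) * s powr (- \<alpha> * q))
      * ennreal ((\<bar>y\<bar> powr (2 * m) + 1) powr (- \<alpha>)) \<partial>lborel)"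
  proof (intro mult_left_mono nn_integral_mono)
    fix y :: real
    let ?b = "\<bar>y\<bar> powr (2 * m) + 1"
    have b: "1 \<le> ?b" by simp
    have "\<bar>c * y\<bar> powr (2 * m) + s = s * ?b"
      using c c_pow by (simp add: abs_mult powr_mult distrib_left)
    then have "((\<kappa> * (\<bar>0 + c * y\<bar> powr (2 * m) + s)) powr (- \<alpha>)) powr q
        = (\<kappa> * (s * ?b)) powr (- \<alpha> * q)"
      by (simp add: powr_powr)
    also have "\<dots> = \<kappa> powr (- \<alpha> * q) * s powr (- \<alpha> * q) * ?b powr (- \<alpha> * q)"
      using kappa_pos s b by (simp add: powr_mult)
    also have "\<dots> \<le> \<kappa> powr (- \<alpha> * q) * s powr (- \<alpha> * q) * ?b powr (- \<alpha>)"
      using b q alpha_pos by (intro mult_left_mono powr_mono) (auto simp: mult_le_cancel_left)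
    finally show "?F (0 + c * y) \<le> ennreal (\<kappa> powr (- \<alpha> * q) * s powr (- \<alpha> * q)) * ennreal (?b powr (- \<alpha>))"
      by (simp add: ennreal_mult'[symmetric] ennreal_leI)
  qed simp
  also have "\<dots> = ennreal (c * (\<kappa> powr (- \<alpha> * q) * s powr (- \<alpha> * q) * profile_mass))"
    using c profile_mass(2) by (simp add: nn_integral_cmult profile_mass(1) ennreal_mult)
  also have "c * (\<kappa> powr (- \<alpha> * q) * s powr (- \<alpha> * q) * profile_mass)
      = \<kappa> powr (- \<alpha> * q) * profile_mass * s powr (1 / (2 * m) - \<alpha> * q)"
  proof -
    have "s powr (1 / (2 * m) - \<alpha> * q) = c * s powr (- \<alpha> * q)"
      unfolding c_def by (subst powr_add[symmetric]) simp
    then show ?thesis by simp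
  qed
  finally show ?thesis unfolding s_def .
qed

lemma exponent_nonpos:
  assumes "1 \<le> q"
  shows "1 / (2 * m) - \<alpha> * q \<le> 0"
proof -
  have "1 / (2 * m) = \<alpha> / \<rho>"
    using m_alpha m_pos rho_gt_1 by (simp add: field_simps)
  also have "\<dots> \<le> \<alpha> / 1"
    using alpha_pos rho_gt_1 by (intro divide_left_mono) auto
  also have "\<dots> \<le> \<alpha> * q" using alpha_pos assms by simp
  finally show ?thesis by simp
qed

text \<open>The exponent is \<open>-1 - \<alpha> (1 - 1/\<rho>)\<close>, so \<open>\<rho> > 1\<close> is exactly what makes the integral over time finite.\<close>
lemma exponent_p: "1 / (2 * m) - \<alpha> * p < - 1"
proof -
  have "1 / (2 * m) = \<alpha> / \<rho>"
    using m_alpha m_pos rho_gt_1 by (simp add: field_simps)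
  also have "\<dots> < \<alpha> / 1"
    using alpha_pos rho_gt_1 by (intro divide_strict_left_mono) auto
  finally show ?thesis by (simp add: alpha_p)
qed

lemma barrier_time_integral:
  "(\<integral>\<^sup>+t. ennreal ((t + shift) powr (1 / (2 * m) - \<alpha> * p)) * indicator {0..} t \<partial>lborel) < top"
proof -
  let ?e = "1 / (2 * m) - \<alpha> * p"
  have "(\<integral>\<^sup>+t. ennreal ((t + shift) powr ?e) * indicator {0..} t \<partial>lborel)
      = ennreal (0 - (0 + shift) powr (?e + 1) / (?e + 1))"
  proof (rule nn_integral_FTC_atLeast[where F = "\<lambda>t. (t + shift) powr (?e + 1) / (?e + 1)"])
    show "DERIV (\<lambda>t. (t + shift) powr (?e + 1) / (?e + 1)) t :> (t + shift) powr ?e" if "0 \<le> t" for t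
    proof -
      have "DERIV (\<lambda>t. t + shift) t :> 1" by (auto intro!: derivative_eq_intros)
      from DERIV_fun_powr[OF this, of "?e + 1"] that shift_pos
      have "DERIV (\<lambda>t. (t + shift) powr (?e + 1)) t :> (?e + 1) * (t + shift) powr ?e"
        by simp
      from DERIV_cdivide[OF this, of "?e + 1"] show ?thesis
        using exponent_p by simp
    qed
    have "((\<lambda>t. (t + shift) powr (?e + 1)) \<longlongrightarrow> 0) at_top"
      using exponent_p filterlim_tendsto_add_at_top[OF tendsto_const[of shift] filterlim_ident]
      by (intro tendsto_neg_powr) (auto simp: add.commute)
    then show "((\<lambda>t. (t + shift) powr (?e + 1) / (?e + 1)) \<longlongrightarrow> 0) at_top"
      by (intro tendsto_divide_zero)
  qed auto
  then show ?thesis by simp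
qed

end

section \<open>Decay of mild solutions\<close>

context small_data begin

lemma mild_solution_measurable:
  "mild_solution p u0 u1 u \<Longrightarrow> 0 \<le> t \<Longrightarrow> u t \<in> borel_measurable lebesgue"
  by (auto simp: mild_solution_def)

lemma mild_solution_power_integral:
  assumes u: "mild_solution p u0 u1 u" and t: "0 \<le> t" and r: "1 \<le> r"
  shows "(\<integral>\<^sup>+x. ennreal (\<bar>u t x\<bar> powr r) \<partial>lebesgue)
    \<le> ennreal (\<kappa> powr (- \<alpha> * r) * profile_mass * (t + shift) powr (1 / (2 * m) - \<alpha> * r))"
proof -
  have "(\<integral>\<^sup>+x. ennreal (\<bar>u t x\<bar> powr r) \<partial>lebesgue) \<le> (\<integral>\<^sup>+x. ennreal (barrier t x powr r) \<partial>lebesgue)"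
  proof (rule nn_integral_mono_AE)
    show "AE x in lebesgue. ennreal (\<bar>u t x\<bar> powr r) \<le> ennreal (barrier t x powr r)"
      using mild_solution_le_barrier[OF u t]
      by eventually_elim (use r in \<open>auto intro!: ennreal_leI powr_mono2\<close>)
  qed
  also have "\<dots> = (\<integral>\<^sup>+x. ennreal (barrier t x powr r) \<partial>lborel)"
    by (rule nn_integral_completion)
  also have "\<dots> \<le> ennreal (\<kappa> powr (- \<alpha> * r) * profile_mass * (t + shift) powr (1 / (2 * m) - \<alpha> * r))"
    by (rule barrier_power_integral[OF t r])
  finally show ?thesis .
qed

lemma Lq_norm_finite_exponent:
  assumes u: "mild_solution p u0 u1 u" and t: "0 \<le> t" and r: "1 \<le> r"
  shows "Lq_norm lebesgue (ennreal r) (u t)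
    = ennreal (enn2real (\<integral>\<^sup>+x. ennreal (\<bar>u t x\<bar> powr r) \<partial>lebesgue) powr (1 / r))"
proof -
  have "(\<integral>\<^sup>+x. ennreal (\<bar>u t x\<bar> powr r) \<partial>lebesgue) < top"
    using mild_solution_power_integral[OF assms] by (rule le_less_trans) simp
  then show ?thesis
    using r by (simp add: Lq_norm_def Let_def)
qed

lemma mild_solution_Lq_decay:
  assumes u: "mild_solution p u0 u1 u" and q: "1 \<le> q"
  shows "\<exists>C::real. \<forall>t>0. Lq_norm lebesgue q (u t)
    \<le> ennreal (C * t powr (enn2real (1 / q) / (\<rho> * (p - 1)) - 1 / (p - 1)))"
proof (cases "q = \<infinity>")
  case True
  show ?thesis
  proof (intro exI allI impI)
    fix t :: real assume t: "0 < t"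
    have "esssup lebesgue (\<lambda>x. ennreal \<bar>u t x\<bar>) \<le> ennreal (\<kappa> powr (- \<alpha>) * t powr (- \<alpha>))"
    proof (rule esssup_I)
      show "(\<lambda>x. ennreal \<bar>u t x\<bar>) \<in> borel_measurable lebesgue"
        using mild_solution_measurable[OF u, of t] t by simp
      show "AE x in lebesgue. ennreal \<bar>u t x\<bar> \<le> ennreal (\<kappa> powr (- \<alpha>) * t powr (- \<alpha>))"
        using mild_solution_le_barrier[OF u less_imp_le[OF t]]
      proof eventually_elim
        case (elim x)
        then show ?case
          using barrier_sup[OF t, of x] by (intro ennreal_leI) linarith
      qed
    qed
    then show "Lq_norm lebesgue q (u t)
        \<le> ennreal (\<kappa> powr (- \<alpha>) * t powr (enn2real (1 / q) / (\<rho> * (p - 1)) - 1 / (p - 1)))"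
      using True by (simp add: Lq_norm_def \<alpha>_def)
  qed
next
  case False
  define r where "r = enn2real q"
  have qr: "q = ennreal r" using False by (simp add: r_def top.not_eq_extremum)
  have r: "1 \<le> r" using q unfolding qr by (simp add: ennreal_le_iff2 flip: ennreal_1)
  define B where "B = \<kappa> powr (- \<alpha> * r) * profile_mass"
  define e where "e = 1 / (2 * m) - \<alpha> * r"
  have B: "0 \<le> B" using profile_mass(2) by (simp add: B_def)
  have e: "e \<le> 0" unfolding e_def by (rule exponent_nonpos[OF r])
  have inv: "enn2real (1 / q) = 1 / r"
    using r divide_ennreal[of 1 r] by (simp add: qr)
  have e_div: "e * (1 / r) = enn2real (1 / q) / (\<rho> * (p - 1)) - 1 / (p - 1)"
  proof -
    have "(a - b * r) * (1 / r) = 1 / r * a - b" for a b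
      using r by (simp add: field_simps)
    from this[of "1 / (2 * m)" \<alpha>] show ?thesis
      unfolding inv e_def by (simp add: m_def \<alpha>_def)
  qed
  show ?thesis
  proof (intro exI allI impI)
    fix t :: real assume t: "0 < t"
    have "(\<integral>\<^sup>+x. ennreal (\<bar>u t x\<bar> powr r) \<partial>lebesgue) \<le> ennreal (B * (t + shift) powr e)"
      unfolding B_def e_def using t r by (intro mild_solution_power_integral[OF u]) auto
    also have "\<dots> \<le> ennreal (B * t powr e)"
      using B e t shift_pos by (intro ennreal_leI mult_left_mono powr_mono2') auto
    finally have "enn2real (\<integral>\<^sup>+x. ennreal (\<bar>u t x\<bar> powr r) \<partial>lebesgue) \<le> B * t powr e"
      using B by (intro enn2real_leI) auto
    then have "enn2real (\<integral>\<^sup>+x. ennreal (\<bar>u t x\<bar> powr r) \<partial>lebesgue) powr (1 / r) \<le> (B * t powr e) powr (1 / r)"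
      using r by (intro powr_mono2) auto
    also have "\<dots> = B powr (1 / r) * t powr (e * (1 / r))"
      using B by (simp add: powr_mult powr_powr)
    finally show "Lq_norm lebesgue q (u t)
        \<le> ennreal (B powr (1 / r) * t powr (enn2real (1 / q) / (\<rho> * (p - 1)) - 1 / (p - 1)))"
      unfolding e_div[symmetric] unfolding qr using t r
      by (simp add: Lq_norm_finite_exponent[OF u] ennreal_leI)
  qed
qed

text \<open>The time integral of \<open>\<parallel>u(t)\<parallel>\<^sub>p\<^sup>p\<close> converges by \<open>barrier_time_integral\<close>. Measurability of the norm in
  time is inherited from the Borel representative, whose spatial integrals are Borel functions
  of time by Tonelli.\<close>
lemma mild_solution_in_Lp_Lp:
  assumes u: "mild_solution p u0 u1 u"
  shows "u \<in> Lr_time_Lq_space (ennreal p) (ennreal p)"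
proof -
  have p: "1 \<le> p" "0 < p" using p_gt_1 by auto
  define I where "I t = (\<integral>\<^sup>+x. ennreal (\<bar>u t x\<bar> powr p) \<partial>lebesgue)" for t
  define N where "N t = enn2real (Lq_norm lebesgue (ennreal p) (u t))" for t
  define B where "B = \<kappa> powr (- \<alpha> * p) * profile_mass"
  define e where "e = 1 / (2 * m) - \<alpha> * p"
  have B: "0 \<le> B" using profile_mass(2) by (simp add: B_def)
  have I_le: "I t \<le> ennreal (B * (t + shift) powr e)" if "0 \<le> t" for t
    unfolding I_def B_def e_def by (rule mild_solution_power_integral[OF u that p(1)])
  have I_fin: "I t < top" if "0 \<le> t" for t
    using I_le[OF that] by (rule le_less_trans) simp
  have N_eq: "N t = enn2real (I t) powr (1 / p)" if "0 \<le> t" for t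
    unfolding N_def I_def by (simp add: Lq_norm_finite_exponent[OF u that p(1)])
  have Lq: "u t \<in> Lq_space lebesgue (ennreal p)" if "0 \<le> t" for t
    using mild_solution_measurable[OF u that] by (simp add: Lq_space_def Lq_norm_finite_exponent[OF u that p(1)])
  have joint: "(\<lambda>(t, x). u t x) \<in> borel_measurable (lebesgue_on ({0<..} \<times> UNIV))"
    by (rule measurable_restrict_mono[of _ _ "{0..} \<times> UNIV"]) (use u in \<open>auto simp: mild_solution_def\<close>)
  have N_meas: "N \<in> borel_measurable (lebesgue_on {0<..})"
  proof (rule borel_measurable_if_D)
    obtain V where V_meas [measurable]: "V \<in> borel_measurable borel"
      and V_eq: "AE \<tau> in lborel. 0 \<le> \<tau> \<longrightarrow> (AE y in lebesgue. u \<tau> y = enn2real (V (\<tau>, y)))"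
      using mild_solution_borel_version[OF u] by blast
    define I' where "I' t = (\<integral>\<^sup>+y. absorbed V (t, y) \<partial>lborel)" for t
    have [measurable]: "I' \<in> borel_measurable borel"
      unfolding I'_def[abs_def] by measurable
    have "(\<lambda>t. if t \<in> {0<..} then enn2real (I' t) powr (1 / p) else 0) \<in> borel_measurable borel"
      by measurable
    then have m: "(\<lambda>t. if t \<in> {0<..} then enn2real (I' t) powr (1 / p) else 0) \<in> borel_measurable lebesgue"
      by (auto intro: measurable_completion)
    have "AE t in lebesgue. (if t \<in> {0<..} then enn2real (I' t) powr (1 / p) else 0)
        = (if t \<in> {0<..} then N t else 0)"
      unfolding AE_completion_iff using V_eq
    proof eventually_elim
      case (elim t)
      show ?case
      proof (cases "0 < t")
        case True
        then have ae: "AE y in lebesgue. u t y = enn2real (V (t, y))" using elim by auto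
        have "I t = (\<integral>\<^sup>+y. absorbed V (t, y) \<partial>lebesgue)"
          unfolding I_def by (rule nn_integral_cong_AE) (use ae in \<open>auto elim!: eventually_mono simp: absorbed_def\<close>)
        also have "\<dots> = I' t"
          unfolding I'_def by (rule nn_integral_completion)
        finally show ?thesis using True by (simp add: N_eq)
      qed simp
    qed
    then show "(\<lambda>t. if t \<in> {0<..} then N t else 0) \<in> borel_measurable lebesgue"
      by (rule borel_measurable_AE[OF m])
  qed
  have "(\<integral>\<^sup>+t. ennreal (\<bar>N t\<bar> powr p) \<partial>lebesgue_on {0<..})
      = (\<integral>\<^sup>+t. ennreal (\<bar>N t\<bar> powr p) * indicator {0<..} t \<partial>lebesgue)"
    by (rule nn_integral_restrict_space) simp
  also have "\<dots> \<le> (\<integral>\<^sup>+t. ennreal B * (ennreal ((t + shift) powr e) * indicator {0..} t) \<partial>lebesgue)"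
  proof (rule nn_integral_mono)
    fix t :: real
    show "ennreal (\<bar>N t\<bar> powr p) * indicator {0<..} t
        \<le> ennreal B * (ennreal ((t + shift) powr e) * indicator {0..} t)"
    proof (cases "0 < t")
      case True
      then have "\<bar>N t\<bar> powr p = enn2real (I t)"
        using p by (simp add: N_eq powr_powr)
      then have "ennreal (\<bar>N t\<bar> powr p) = I t"
        using I_fin[of t] True by simp
      with I_le[of t] True B show ?thesis
        by (simp add: ennreal_mult)
    qed simp
  qed
  also have "\<dots> = (\<integral>\<^sup>+t. ennreal B * (ennreal ((t + shift) powr e) * indicator {0..} t) \<partial>lborel)"
    by (rule nn_integral_completion)
  also have "\<dots> = ennreal B * (\<integral>\<^sup>+t. ennreal ((t + shift) powr e) * indicator {0..} t \<partial>lborel)"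
    by (rule nn_integral_cmult) measurable
  also have "\<dots> < top"
    using barrier_time_integral by (simp add: e_def ennreal_mult_less_top)
  finally have "Lq_norm (lebesgue_on {0<..}) (ennreal p) N < \<infinity>"
    using p by (simp add: Lq_norm_def Let_def)
  then have "N \<in> Lq_space (lebesgue_on {0<..}) (ennreal p)"
    using N_meas by (simp add: Lq_space_def)
  moreover have "AE t in lebesgue_on {0<..}. u t \<in> Lq_space lebesgue (ennreal p)"
    by (rule AE_I2) (use Lq in auto)
  ultimately show ?thesis
    using joint by (simp add: Lr_time_Lq_space_def N_def[abs_def])
qed

end

text \<open>Bounds that hold almost everywhere can be enforced everywhere by truncating a Borel representative.\<close>
lemma bounded_borel_representative:
  fixes v b :: "real \<Rightarrow> real"
  assumes v: "v \<in> borel_measurable lebesgue" and [measurable]: "b \<in> borel_measurable borel"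
    and ae: "AE x in lebesgue. 0 \<le> v x \<and> v x \<le> b x" and b: "\<And>x. 0 \<le> b x"
  obtains w where "w \<in> borel_measurable borel" "\<And>x. 0 \<le> w x" "\<And>x. w x \<le> b x"
    "AE x in lebesgue. v x = w x"
proof -
  obtain v' where [measurable]: "v' \<in> borel_measurable borel" and v': "AE x in lborel. v x = v' x"
    using completion_ex_borel_measurable_real[OF v] by auto
  from v' have "AE x in lebesgue. v x = v' x" by (simp add: AE_completion_iff)
  with ae have "AE x in lebesgue. v x = max 0 (min (v' x) (b x))"
    by eventually_elim auto
  then show ?thesis
    using b by (intro that[of "\<lambda>x. max 0 (min (v' x) (b x))"]) auto
qed

theorem corollary1p2:
  fixes p \<rho> :: real
  assumes "p > 1" and "1 < \<rho>" and "\<rho> < 2 / (p - 1)"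
  shows "\<exists>\<epsilon>\<^sub>0>0. \<forall>\<epsilon>. 0 < \<epsilon> \<and> \<epsilon> \<le> \<epsilon>\<^sub>0 \<longrightarrow>
    (\<forall>u0 u1 :: real \<Rightarrow> real.
       u0 \<in> W1q_space 1 \<inter> W1q_space \<infinity> \<and>
       u1 \<in> Lq_space lebesgue 1 \<inter> Lq_space lebesgue \<infinity> \<and>
       (AE x in lebesgue. 0 \<le> u0 x \<and> u0 x \<le> \<epsilon> * japanese_bracket x powr (- \<rho>)) \<and>
       (AE x in lebesgue. 0 \<le> u1 x + u0 x / 2 \<and>
          u1 x + u0 x / 2 \<le> \<epsilon> * japanese_bracket x powr (- \<rho>))
       \<longrightarrow>
       (\<exists>u. mild_solution p u0 u1 u) \<and>
       (\<forall>u. mild_solution p u0 u1 u \<longrightarrow>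
          (\<forall>q::ennreal. 1 \<le> q \<longrightarrow>
             (\<exists>C::real. \<forall>t>0. Lq_norm lebesgue q (u t)
                \<le> ennreal (C * t powr (enn2real (1 / q) / (\<rho> * (p - 1)) - 1 / (p - 1))))) \<and>
          u \<in> Lr_time_Lq_space (ennreal p) (ennreal p)))"
proof -
  interpret absorption p \<rho>
    by unfold_locales (use assms in auto)
  show ?thesis
  proof (rule exI[of _ \<epsilon>\<^sub>0], rule conjI[OF eps0_pos], intro allI impI)
    fix \<epsilon> and u0 u1 :: "real \<Rightarrow> real"
    assume eps: "0 < \<epsilon> \<and> \<epsilon> \<le> \<epsilon>\<^sub>0"
      and data: "u0 \<in> W1q_space 1 \<inter> W1q_space \<infinity> \<and>
       u1 \<in> Lq_space lebesgue 1 \<inter> Lq_space lebesgue \<infinity> \<and>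
       (AE x in lebesgue. 0 \<le> u0 x \<and> u0 x \<le> \<epsilon> * japanese_bracket x powr (- \<rho>)) \<and>
       (AE x in lebesgue. 0 \<le> u1 x + u0 x / 2 \<and>
          u1 x + u0 x / 2 \<le> \<epsilon> * japanese_bracket x powr (- \<rho>))"
    from data have u0: "AE x in lebesgue. 0 \<le> u0 x \<and> u0 x \<le> \<epsilon> * japanese_bracket x powr (- \<rho>)"
      and u1: "AE x in lebesgue. 0 \<le> u1 x + u0 x / 2 \<and> u1 x + u0 x / 2 \<le> \<epsilon> * japanese_bracket x powr (- \<rho>)"
      by blast+
    from data have meas: "u0 \<in> borel_measurable lebesgue" "u1 \<in> borel_measurable lebesgue"
      by (auto simp: W1q_space_def Lq_space_def)
    let ?b = "\<lambda>x. \<epsilon> * japanese_bracket x powr (- \<rho>)"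
    have b: "?b \<in> borel_measurable borel" "\<And>x. 0 \<le> ?b x"
      using eps by (auto simp: japanese_bracket_def)
    obtain f where f: "f \<in> borel_measurable borel" "\<And>x. 0 \<le> f x" "\<And>x. f x \<le> ?b x"
      "AE x in lebesgue. u0 x = f x"
      using bounded_borel_representative[OF meas(1) b(1) u0 b(2)] by blast
    obtain h where h: "h \<in> borel_measurable borel" "\<And>x. 0 \<le> h x" "\<And>x. h x \<le> ?b x"
      "AE x in lebesgue. u1 x + u0 x / 2 = h x"
      using bounded_borel_representative[OF _ b(1) u1 b(2)] meas by auto
    have "integrable lborel ?b"
      using japanese_bracket_integrable[OF assms(2)] by simp
    then have "integrable lborel f"
      by (rule Bochner_Integration.integrable_bound) (use f b in auto)
    then interpret small_data p \<rho> \<epsilon> u0 u1 f h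
      by unfold_locales (use eps meas f h in auto)
    show "(\<exists>u. mild_solution p u0 u1 u) \<and>
       (\<forall>u. mild_solution p u0 u1 u \<longrightarrow>
          (\<forall>q::ennreal. 1 \<le> q \<longrightarrow>
             (\<exists>C::real. \<forall>t>0. Lq_norm lebesgue q (u t)
                \<le> ennreal (C * t powr (enn2real (1 / q) / (\<rho> * (p - 1)) - 1 / (p - 1))))) \<and>
          u \<in> Lr_time_Lq_space (ennreal p) (ennreal p))"
      using mild_solution_exists mild_solution_Lq_decay mild_solution_in_Lp_Lp by blast
  qed
qed

end
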